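(* Let $E=(d_0,d_1)$ with $-\infty\le d_0<d_1\le\infty$, equipped with Lebesgue measure, and $L^1=L^1(E)$. Let $g\colon E\to\mathbb{R}$ be continuous with $g(x)<0$ for all $x\in E$ and let $\varphi\ge0$ be Borel measurable and integrable on compact subsets of $E$. Define $G,Q,\pi_t$ as in the context and assume $G(d_0)=+\infty$. For $t\ge0$, $u\in L^1$, $x\in E$ let $P_0(t)u(x)=\mathbf{1}_E(\pi_{-t}x)u(\pi_{-t}x)\frac{g(\pi_{-t}x)}{g(x)}$ and $S(t)u(x)=e^{Q(\pi_{-t}x)-Q(x)}P_0(t)u(x)$ (interpreted as $0$ if $\pi_{-t}x\notin E$). Then the operator $A_0u=-\frac{d}{dx}(gu)$ with domain \[ \mathcal{D}(A_0)=\{u\in L^1:\ gu\in AC,\ A_0u\in L^1,\ \lim_{x\uparrow d_1}g(x)u(x)=0\} \] is the generator of the semigroup $\{P_0(t)\}_{t\ge0}$, and the operator $Au=A_0u-\varphi u$ with domain $\mathcal{D}(A)=\mathcal{D}(A_0)\cap L^1_\varphi$, $L^1_\varphi=\{u\in L^1:\varphi u\in L^1\}$, is the generator of $\{S(t)\}_{t\ge0}$. Moreover, for $\lambda>0$ the resolvent of $A$ is \[ R(\lambda,A)v(x)=\int_x^{d_1}\frac{1}{|g(x)|}e^{Q_\lambda(y)-Q_\lambda(x)}v(y)\,dy,\quad v\in L^1, \] where $Q_\lambda=\lambda G+Q$.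
   Context: $AC$ denotes the space of absolutely continuous functions on $E$. $G(x)=\int_{x_0}^x\frac{dz}{g(z)}$ and $Q(x)=\int_{x_1}^x\frac{\varphi(z)}{g(z)}dz$, where $x_0=d_0$ (resp. $x_1=d_0$) if the corresponding integral is finite for all $x\in E$, and otherwise $x_0$ (resp. $x_1$) is a fixed point of $E$; $G(d_0)$ is the limit as $x\downarrow d_0$. Here $G$ is strictly decreasing and $Q$ is nonincreasing. $G^{-1}$ is defined on $G(E)$ and extended continuously to $\mathbb{R}$ so that it takes values in $\{d_0,d_1\}$ outside $G(E)$; $\pi_tx=G^{-1}(G(x)+t)$ is the solution of $a'=g(a)$, $a(0)=x$. *)

theory Defs
  imports "HOL-Analysis.Analysis"
begin

definition Eint :: "ereal \<Rightarrow> ereal \<Rightarrow> real set" where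
  "Eint d0 d1 = {x. d0 < ereal x \<and> ereal x < d1}"

definition lower_end :: "ereal \<Rightarrow> real filter" where
  "lower_end d0 = (if d0 = -\<infinity> then at_bot else at_right (real_of_ereal d0))"

definition upper_end :: "ereal \<Rightarrow> real filter" where
  "upper_end d1 = (if d1 = \<infinity> then at_top else at_left (real_of_ereal d1))"

definition L1 :: "real set \<Rightarrow> (real \<Rightarrow> real) \<Rightarrow> bool" where
  "L1 E u \<longleftrightarrow> set_integrable lebesgue E u"

definition L1norm :: "real set \<Rightarrow> (real \<Rightarrow> real) \<Rightarrow> real" where
  "L1norm E u = (LINT x:E|lebesgue. \<bar>u x\<bar>)"

definition abs_cont_on :: "real set \<Rightarrow> (real \<Rightarrow> real) \<Rightarrow> bool" where
  "abs_cont_on S f \<longleftrightarrow>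
     (\<forall>\<epsilon>>0. \<exists>\<delta>>0. \<forall>(n::nat) (a::nat \<Rightarrow> real) (b::nat \<Rightarrow> real).
        (\<forall>i<n. a i \<in> S \<and> b i \<in> S \<and> a i \<le> b i) \<and>
        (\<forall>i j. i < j \<and> j < n \<longrightarrow> b i \<le> a j) \<and>
        (\<Sum>i<n. b i - a i) < \<delta>
        \<longrightarrow> (\<Sum>i<n. \<bar>f (b i) - f (a i)\<bar>) < \<epsilon>)"

definition AC_on :: "real set \<Rightarrow> (real \<Rightarrow> real) \<Rightarrow> bool" where
  "AC_on E f \<longleftrightarrow> (\<forall>a b. {a..b} \<subseteq> E \<longrightarrow> abs_cont_on {a..b} f)"

text \<open>Operators on L1(E) are represented by their graphs, as relations on
  representatives; all relations used below are invariant under a.e. equality.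
  T is a strongly continuous semigroup on L1(E) with generator whose graph is Gr.\<close>
definition is_generator ::
  "real set \<Rightarrow> (real \<Rightarrow> (real \<Rightarrow> real) \<Rightarrow> (real \<Rightarrow> real))
     \<Rightarrow> ((real \<Rightarrow> real) \<Rightarrow> (real \<Rightarrow> real) \<Rightarrow> bool) \<Rightarrow> bool" where
  "is_generator E T Gr \<longleftrightarrow>
     (\<forall>u. L1 E u \<longrightarrow>
        (\<forall>t\<ge>0. L1 E (T t u)) \<and>
        (AE x in lebesgue. x \<in> E \<longrightarrow> T 0 u x = u x) \<and>
        (\<forall>t\<ge>0. \<forall>s\<ge>0. AE x in lebesgue. x \<in> E \<longrightarrow> T (t + s) u x = T t (T s u) x) \<and>
        (\<forall>t\<ge>0. \<forall>v. L1 E v \<longrightarrow> (\<forall>a b. AE x in lebesgue. x \<in> E \<longrightarrow>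
            T t (\<lambda>y. a * u y + b * v y) x = a * T t u x + b * T t v x)) \<and>
        (\<forall>t\<ge>0. \<forall>v. (AE x in lebesgue. x \<in> E \<longrightarrow> u x = v x) \<longrightarrow>
            (AE x in lebesgue. x \<in> E \<longrightarrow> T t u x = T t v x)) \<and>
        ((\<lambda>t. L1norm E (\<lambda>x. T t u x - u x)) \<longlongrightarrow> 0) (at_right 0)) \<and>
     (\<forall>u w. L1 E u \<and> L1 E w \<longrightarrow>
        (Gr u w \<longleftrightarrow>
          ((\<lambda>t. L1norm E (\<lambda>x. (T t u x - u x) / t - w x)) \<longlongrightarrow> 0) (at_right 0))) \<and>
     (\<forall>u w. Gr u w \<longrightarrow> L1 E u \<and> L1 E w)"

definition Gfun :: "(real \<Rightarrow> real) \<Rightarrow> real \<Rightarrow> real \<Rightarrow> real" where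
  "Gfun g x0 x = (LBINT z=ereal x0..ereal x. 1 / g z)"

definition Qfun :: "(real \<Rightarrow> real) \<Rightarrow> (real \<Rightarrow> real) \<Rightarrow> real \<Rightarrow> real \<Rightarrow> real" where
  "Qfun g \<phi> x1 x = (LBINT z=ereal x1..ereal x. \<phi> z / g z)"

text \<open>pi_t x = G^{-1}(G x + t) when G x + t lies in G(E); otherwise it is an
  endpoint of E (not in E).\<close>
definition flow_in :: "real set \<Rightarrow> (real \<Rightarrow> real) \<Rightarrow> real \<Rightarrow> real \<Rightarrow> bool" where
  "flow_in E G t x \<longleftrightarrow> G x + t \<in> G ` E"

definition flow :: "real set \<Rightarrow> (real \<Rightarrow> real) \<Rightarrow> real \<Rightarrow> real \<Rightarrow> real" where
  "flow E G t x = (THE y. y \<in> E \<and> G y = G x + t)"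

definition P0 :: "real set \<Rightarrow> (real \<Rightarrow> real) \<Rightarrow> (real \<Rightarrow> real) \<Rightarrow> real
                   \<Rightarrow> (real \<Rightarrow> real) \<Rightarrow> real \<Rightarrow> real" where
  "P0 E g G t u x =
     (if flow_in E G (-t) x
      then u (flow E G (-t) x) * g (flow E G (-t) x) / g x else 0)"

definition Ssg :: "real set \<Rightarrow> (real \<Rightarrow> real) \<Rightarrow> (real \<Rightarrow> real) \<Rightarrow> (real \<Rightarrow> real)
                   \<Rightarrow> real \<Rightarrow> (real \<Rightarrow> real) \<Rightarrow> real \<Rightarrow> real" where
  "Ssg E g G Q t u x =
     (if flow_in E G (-t) x
      then exp (Q (flow E G (-t) x) - Q x) * P0 E g G t u x else 0)"

definition A0_graph :: "real set \<Rightarrow> ereal \<Rightarrow> (real \<Rightarrow> real)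
                         \<Rightarrow> (real \<Rightarrow> real) \<Rightarrow> (real \<Rightarrow> real) \<Rightarrow> bool" where
  "A0_graph E d1 g u w \<longleftrightarrow> L1 E u \<and> L1 E w \<and>
     (\<exists>v. (AE x in lebesgue. x \<in> E \<longrightarrow> v x = u x) \<and>
          AC_on E (\<lambda>x. g x * v x) \<and>
          (AE x in lebesgue. x \<in> E \<longrightarrow>
              ((\<lambda>y. g y * v y) has_real_derivative (- w x)) (at x)) \<and>
          ((\<lambda>x. g x * v x) \<longlongrightarrow> 0) (upper_end d1))"

definition A_graph :: "real set \<Rightarrow> ereal \<Rightarrow> (real \<Rightarrow> real) \<Rightarrow> (real \<Rightarrow> real)
                         \<Rightarrow> (real \<Rightarrow> real) \<Rightarrow> (real \<Rightarrow> real) \<Rightarrow> bool" where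
  "A_graph E d1 g \<phi> u w \<longleftrightarrow> L1 E (\<lambda>x. \<phi> x * u x) \<and>
     (\<exists>w0. A0_graph E d1 g u w0 \<and>
        (AE x in lebesgue. x \<in> E \<longrightarrow> w x = w0 x - \<phi> x * u x))"

end

theory Submission
  imports Defs
begin

text \<open>
  \<open>P0\<close> is the case \<open>\<phi> = 0\<close> of \<open>S\<close>, so only \<open>S\<close> is treated. Put \<open>D t w = \<integral>\<^sub>0\<^sup>t S(s) w ds\<close>; explicitly, this is
  \<open>D t w x = 1 / |g x| \<integral> exp (Q y - Q x) w y dy\<close> over \<open>x < y\<close> with \<open>G x - G y \<le> t\<close>. Tonelli's theorem gives
  \<open>\<parallel>D t w\<parallel> \<le> t \<parallel>w\<parallel>\<close>, Lebesgue differentiation gives \<open>D t w / t \<rightarrow> w\<close> almost everywhere, and by Scheffe's lemma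
  the convergence holds in \<open>L\<^sup>1\<close>. Strong continuity follows, because \<open>S(s) D t w - D t w = S(t) D s w - D s w\<close>
  has norm at most \<open>2 s \<parallel>w\<parallel>\<close>.

  If \<open>A u = w\<close>, then \<open>(exp Q g u)' = - exp Q w\<close>, and the boundary condition at \<open>d1\<close> yields \<open>S(t) u - u = D t w\<close>, so
  \<open>A\<close> is contained in the generator. The explicit resolvent shows that \<open>\<lambda> - A\<close> is onto, and a contraction semigroup
  has no generator eigenvalue \<open>\<lambda> > 0\<close>; hence the two operators agree and the resolvent is unique.
\<close>

section \<open>Absolutely continuous functions\<close>

text \<open>Since \<phi> is only locally integrable, \<open>Q\<close> is merely absolutely
  continuous and the differential identities hold almost everywhere. The domain of A is stated
  through the \<epsilon>-\<delta> form of absolute continuity, so both passages between this form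
  and integrals are required: indefinite integrals satisfy it (the resolvent maps into the domain),
  and a function satisfying it is recovered from its a.e. derivative (the equation A u = w is
  solved). The assumption on G at \<open>d0\<close> says that no characteristic leaves E in forward
  time. It makes the backward flow map its domain in E onto E, so that \<open>P0\<close> preserves
  the norm. At \<open>d1\<close> characteristics may enter after a finite time; the value 0 put
  there by the formulas is the boundary condition of the domain. The averages D t w are written as a
  potential minus its translate by S(t). The semigroup identities hold pointwise for arbitrary
  functions, so they apply to the potential even when it is not integrable, and the commutation of
  averages with S becomes plain algebra.\<close>

lemma abs_cont_onE:
  assumes "abs_cont_on S f" "\<epsilon> > 0"
  obtains \<delta> where "\<delta> > 0"
    "\<And>(n::nat) a b. (\<And>i. i < n \<Longrightarrow> a i \<in> S \<and> b i \<in> S \<and> a i \<le> b i) \<Longrightarrow>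
        (\<And>i j. i < j \<Longrightarrow> j < n \<Longrightarrow> b i \<le> a j) \<Longrightarrow>
        (\<Sum>i<n. b i - a i) < \<delta> \<Longrightarrow> (\<Sum>i<n. \<bar>f (b i) - f (a i)\<bar>) < \<epsilon>"
proof -
  from assms obtain \<delta> where "\<delta> > 0" "\<forall>(n::nat) a b.
        (\<forall>i<n. a i \<in> S \<and> b i \<in> S \<and> a i \<le> b i) \<and>
        (\<forall>i j. i < j \<and> j < n \<longrightarrow> b i \<le> a j) \<and>
        (\<Sum>i<n. b i - a i) < \<delta>
        \<longrightarrow> (\<Sum>i<n. \<bar>f (b i) - f (a i)\<bar>) < \<epsilon>"
    unfolding abs_cont_on_def by blast
  then show thesis by (intro that) auto
qed

lemma abs_cont_onI:
  assumes "\<And>\<epsilon>. \<epsilon> > 0 \<Longrightarrow> \<exists>\<delta>>0. \<forall>(n::nat) a b.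
        (\<forall>i<n. a i \<in> S \<and> b i \<in> S \<and> a i \<le> b i) \<longrightarrow>
        (\<forall>i j. i < j \<and> j < n \<longrightarrow> b i \<le> a j) \<longrightarrow>
        (\<Sum>i<n. b i - a i) < \<delta> \<longrightarrow> (\<Sum>i<n. \<bar>f (b i) - f (a i)\<bar>) < \<epsilon>"
  shows "abs_cont_on S f"
  using assms unfolding abs_cont_on_def imp_conjL by (intro allI impI)

lemma abs_cont_on_cong:
  assumes "\<And>x. x \<in> S \<Longrightarrow> f x = h x"
  shows "abs_cont_on S f \<longleftrightarrow> abs_cont_on S h"
proof -
  have "abs_cont_on S h'" if f: "abs_cont_on S f'" and eq: "\<And>x. x \<in> S \<Longrightarrow> f' x = h' x" for f' h'
  proof (rule abs_cont_onI)
    fix \<epsilon> :: real assume "\<epsilon> > 0"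
    with f obtain \<delta> where \<delta>: "\<delta> > 0"
      "\<And>(n::nat) a b. (\<And>i. i < n \<Longrightarrow> a i \<in> S \<and> b i \<in> S \<and> a i \<le> b i) \<Longrightarrow>
        (\<And>i j. i < j \<Longrightarrow> j < n \<Longrightarrow> b i \<le> a j) \<Longrightarrow>
        (\<Sum>i<n. b i - a i) < \<delta> \<Longrightarrow> (\<Sum>i<n. \<bar>f' (b i) - f' (a i)\<bar>) < \<epsilon>"
      using abs_cont_onE by blast
    have "(\<Sum>i<n. \<bar>h' (b i) - h' (a i)\<bar>) < \<epsilon>"
      if "\<forall>i<n. a i \<in> S \<and> b i \<in> S \<and> a i \<le> b i" "\<forall>i j. i < j \<and> j < n \<longrightarrow> b i \<le> a j"
        "(\<Sum>i<n. b i - a i) < \<delta>" for n :: nat and a b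
    proof -
      have "(\<Sum>i<n. \<bar>h' (b i) - h' (a i)\<bar>) = (\<Sum>i<n. \<bar>f' (b i) - f' (a i)\<bar>)"
        using that(1) by (intro sum.cong) (auto simp: eq)
      then show ?thesis using \<delta>(2)[of n a b] that by simp
    qed
    then show "\<exists>\<delta>>0. \<forall>(n::nat) a b.
        (\<forall>i<n. a i \<in> S \<and> b i \<in> S \<and> a i \<le> b i) \<longrightarrow>
        (\<forall>i j. i < j \<and> j < n \<longrightarrow> b i \<le> a j) \<longrightarrow>
        (\<Sum>i<n. b i - a i) < \<delta> \<longrightarrow> (\<Sum>i<n. \<bar>h' (b i) - h' (a i)\<bar>) < \<epsilon>"
      using \<delta>(1) by blast
  qed
  then show ?thesis using assms by metis
qed

text \<open>Increments of \<open>k\<close> inherit the \<delta> of the increments that control them.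
  Negatives, products, exponentials and reflections of weights are all reduced to this
  criterion.\<close>

lemma abs_cont_on_dominated:
  assumes f: "abs_cont_on S f" and h: "abs_cont_on S h" and "C \<ge> 0"
    and le: "\<And>x y. x \<in> S \<Longrightarrow> y \<in> S \<Longrightarrow> \<bar>k y - k x\<bar> \<le> C * (\<bar>f y - f x\<bar> + \<bar>h y - h x\<bar>)"
  shows "abs_cont_on S k"
proof (rule abs_cont_onI)
  fix \<epsilon> :: real assume "\<epsilon> > 0"
  \<comment> \<open>The denominator is chosen so that \<open>C * (e + e) < \<epsilon>\<close> also
    when \<open>C = 0\<close>.\<close>
  define e where "e = \<epsilon> / (2 * (C + 1))"
  have "e > 0" using \<open>\<epsilon> > 0\<close> \<open>C \<ge> 0\<close> by (simp add: e_def)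
  obtain \<delta>1 where \<delta>1: "\<delta>1 > 0"
      "\<And>(n::nat) a b. (\<And>i. i < n \<Longrightarrow> a i \<in> S \<and> b i \<in> S \<and> a i \<le> b i) \<Longrightarrow>
        (\<And>i j. i < j \<Longrightarrow> j < n \<Longrightarrow> b i \<le> a j) \<Longrightarrow>
        (\<Sum>i<n. b i - a i) < \<delta>1 \<Longrightarrow> (\<Sum>i<n. \<bar>f (b i) - f (a i)\<bar>) < e"
    using abs_cont_onE[OF f \<open>e > 0\<close>] by blast
  obtain \<delta>2 where \<delta>2: "\<delta>2 > 0"
      "\<And>(n::nat) a b. (\<And>i. i < n \<Longrightarrow> a i \<in> S \<and> b i \<in> S \<and> a i \<le> b i) \<Longrightarrow>
        (\<And>i j. i < j \<Longrightarrow> j < n \<Longrightarrow> b i \<le> a j) \<Longrightarrow>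
        (\<Sum>i<n. b i - a i) < \<delta>2 \<Longrightarrow> (\<Sum>i<n. \<bar>h (b i) - h (a i)\<bar>) < e"
    using abs_cont_onE[OF h \<open>e > 0\<close>] by blast
  have "(\<Sum>i<n. \<bar>k (b i) - k (a i)\<bar>) < \<epsilon>"
    if ab: "\<forall>i<n. a i \<in> S \<and> b i \<in> S \<and> a i \<le> b i" "\<forall>i j. i < j \<and> j < n \<longrightarrow> b i \<le> a j"
      "(\<Sum>i<n. b i - a i) < min \<delta>1 \<delta>2" for n :: nat and a b
  proof -
    have "(\<Sum>i<n. \<bar>k (b i) - k (a i)\<bar>) \<le> (\<Sum>i<n. C * (\<bar>f (b i) - f (a i)\<bar> + \<bar>h (b i) - h (a i)\<bar>))"
      using ab(1) by (intro sum_mono le) auto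
    also have "\<dots> = C * ((\<Sum>i<n. \<bar>f (b i) - f (a i)\<bar>) + (\<Sum>i<n. \<bar>h (b i) - h (a i)\<bar>))"
      by (simp only: sum_distrib_left[symmetric] sum.distrib)
    also have "\<dots> \<le> C * (e + e)"
      using \<delta>1(2)[of n a b] \<delta>2(2)[of n a b] ab \<open>C \<ge> 0\<close> by (intro mult_left_mono add_mono) auto
    also have "\<dots> < \<epsilon>"
      using \<open>\<epsilon> > 0\<close> \<open>C \<ge> 0\<close> by (auto simp: e_def divide_simps)
    finally show ?thesis .
  qed
  then show "\<exists>\<delta>>0. \<forall>(n::nat) a b.
        (\<forall>i<n. a i \<in> S \<and> b i \<in> S \<and> a i \<le> b i) \<longrightarrow>
        (\<forall>i j. i < j \<and> j < n \<longrightarrow> b i \<le> a j) \<longrightarrow>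
        (\<Sum>i<n. b i - a i) < \<delta> \<longrightarrow> (\<Sum>i<n. \<bar>k (b i) - k (a i)\<bar>) < \<epsilon>"
    using \<delta>1(1) \<delta>2(1) by (intro exI[of _ "min \<delta>1 \<delta>2"]) auto
qed

lemma abs_cont_on_minus: "abs_cont_on S (\<lambda>x. - f x)" if "abs_cont_on S f"
  by (rule abs_cont_on_dominated[OF that that, of 1]) (auto simp: abs_if)

lemma abs_cont_on_imp_continuous_on:
  assumes f: "abs_cont_on S f"
  shows "continuous_on S f"
  unfolding continuous_on_iff
proof (intro ballI allI impI)
  fix x e :: real assume "x \<in> S" "e > 0"
  obtain \<delta> where \<delta>: "\<delta> > 0"
      "\<And>(n::nat) a b. (\<And>i. i < n \<Longrightarrow> a i \<in> S \<and> b i \<in> S \<and> a i \<le> b i) \<Longrightarrow>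
        (\<And>i j. i < j \<Longrightarrow> j < n \<Longrightarrow> b i \<le> a j) \<Longrightarrow>
        (\<Sum>i<n. b i - a i) < \<delta> \<Longrightarrow> (\<Sum>i<n. \<bar>f (b i) - f (a i)\<bar>) < e"
    using abs_cont_onE[OF f \<open>e > 0\<close>] by blast
  have "dist (f x') (f x) < e" if "x' \<in> S" "dist x' x < \<delta>" for x'
    using \<delta>(2)[of 1 "\<lambda>_. min x x'" "\<lambda>_. max x x'"] that \<open>x \<in> S\<close>
    by (cases "x \<le> x'") (auto simp: min_def max_def dist_real_def)
  then show "\<exists>d>0. \<forall>x'\<in>S. dist x' x < d \<longrightarrow> dist (f x') (f x) < e"
    using \<delta>(1) by blast
qed

lemma abs_cont_on_bounded:
  fixes a b :: real
  assumes "abs_cont_on {a..b} f"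
  obtains B where "B \<ge> 0" "\<And>x. x \<in> {a..b} \<Longrightarrow> \<bar>f x\<bar> \<le> B"
proof -
  have "bounded (f ` {a..b})"
    using abs_cont_on_imp_continuous_on[OF assms] by (intro compact_imp_bounded compact_continuous_image) auto
  then obtain B where "\<forall>y\<in>f ` {a..b}. \<bar>y\<bar> \<le> B" by (auto simp: bounded_iff)
  then show thesis by (intro that[of "max 0 B"]) (auto simp: le_max_iff_disj)
qed

lemma abs_cont_on_mult:
  fixes a b :: real
  assumes f: "abs_cont_on {a..b} f" and h: "abs_cont_on {a..b} h"
  shows "abs_cont_on {a..b} (\<lambda>x. f x * h x)"
proof -
  obtain B where B: "B \<ge> 0" "\<And>x. x \<in> {a..b} \<Longrightarrow> \<bar>f x\<bar> \<le> B" using abs_cont_on_bounded[OF f] by blast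
  obtain C where C: "C \<ge> 0" "\<And>x. x \<in> {a..b} \<Longrightarrow> \<bar>h x\<bar> \<le> C" using abs_cont_on_bounded[OF h] by blast
  have "\<bar>f y * h y - f x * h x\<bar> \<le> (B + C) * (\<bar>f y - f x\<bar> + \<bar>h y - h x\<bar>)"
    if "x \<in> {a..b}" "y \<in> {a..b}" for x y
  proof -
    \<comment> \<open>The usual splitting of a product increment; both factors are bounded because
      they are continuous on a compact interval.\<close>
    have "f y * h y - f x * h x = f y * (h y - h x) + h x * (f y - f x)" by (simp add: algebra_simps)
    then have "\<bar>f y * h y - f x * h x\<bar> \<le> \<bar>f y\<bar> * \<bar>h y - h x\<bar> + \<bar>h x\<bar> * \<bar>f y - f x\<bar>"
      by (metis abs_mult abs_triangle_ineq)
    also have "\<dots> \<le> B * \<bar>h y - h x\<bar> + C * \<bar>f y - f x\<bar>"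
      using B C that by (intro add_mono mult_right_mono) auto
    also have "\<dots> \<le> (B + C) * (\<bar>f y - f x\<bar> + \<bar>h y - h x\<bar>)"
      using B C by (simp add: algebra_simps)
    finally show ?thesis .
  qed
  then show ?thesis using B(1) C(1) by (intro abs_cont_on_dominated[OF f h, of "B + C"]) auto
qed

lemma abs_cont_on_exp:
  fixes a b :: real
  assumes f: "abs_cont_on {a..b} f"
  shows "abs_cont_on {a..b} (\<lambda>x. exp (f x))"
proof -
  obtain B where B: "B \<ge> 0" "\<And>x. x \<in> {a..b} \<Longrightarrow> \<bar>f x\<bar> \<le> B" using abs_cont_on_bounded[OF f] by blast
  \<comment> \<open>By convexity, exp has Lipschitz constant \<open>exp B\<close> on arguments at
    most \<open>B\<close>; the bound comes from \<open>1 + s \<le> exp s\<close> at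
    \<open>s = u - v\<close>.\<close>
  have *: "exp v - exp u \<le> exp B * (v - u)" if "u \<le> v" "v \<le> B" for u v :: real
  proof -
    have "1 + (u - v) \<le> exp (u - v)" by (rule exp_ge_add_one_self)
    then have "exp v * (1 + (u - v)) \<le> exp v * exp (u - v)" by (intro mult_left_mono) auto
    then have "exp v - exp u \<le> exp v * (v - u)" by (simp add: exp_diff algebra_simps)
    also have "\<dots> \<le> exp B * (v - u)" using that by (intro mult_right_mono) auto
    finally show ?thesis .
  qed
  have "\<bar>exp (f y) - exp (f x)\<bar> \<le> exp B * (\<bar>f y - f x\<bar> + \<bar>f y - f x\<bar>)"
    if "x \<in> {a..b}" "y \<in> {a..b}" for x y
  proof -
    have "\<bar>exp (f y) - exp (f x)\<bar> \<le> exp B * \<bar>f y - f x\<bar>"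
      using *[of "f x" "f y"] *[of "f y" "f x"] B(2)[OF that(1)] B(2)[OF that(2)]
      by (cases "f x \<le> f y") (auto simp: abs_le_iff)
    also have "\<dots> \<le> exp B * (\<bar>f y - f x\<bar> + \<bar>f y - f x\<bar>)" by simp
    finally show ?thesis .
  qed
  then show ?thesis using abs_cont_on_dominated[OF f f, of "exp B"] by simp
qed

section \<open>Absolute continuity of indefinite integrals\<close>

lemma sum_increments_le:
  fixes \<Phi> :: "real \<Rightarrow> real" and p q :: "nat \<Rightarrow> real"
  assumes mono: "\<And>x y. a \<le> x \<Longrightarrow> x \<le> y \<Longrightarrow> y \<le> b \<Longrightarrow> \<Phi> x \<le> \<Phi> y"
  shows "\<lbrakk>\<And>i. i < n \<Longrightarrow> a \<le> p i \<and> p i \<le> q i \<and> q i \<le> c; a \<le> c; c \<le> b;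
           \<And>i j. i < j \<Longrightarrow> j < n \<Longrightarrow> q i \<le> p j\<rbrakk>
         \<Longrightarrow> (\<Sum>i<n. \<Phi> (q i) - \<Phi> (p i)) \<le> \<Phi> c - \<Phi> a"
proof (induction n arbitrary: c)
  case 0
  then show ?case using mono[of a c] by simp
next
  case (Suc n)
  have pn: "a \<le> p n" "p n \<le> q n" "q n \<le> c" using Suc.prems(1)[of n] by auto
  \<comment> \<open>The remaining intervals end no later than \<open>p n\<close>, so the induction
    hypothesis is used with \<open>p n\<close> as the right bound; this is why \<open>c\<close> is
    generalised.\<close>
  have "(\<Sum>i<n. \<Phi> (q i) - \<Phi> (p i)) \<le> \<Phi> (p n) - \<Phi> a"
  proof (rule Suc.IH)
    show "a \<le> p i \<and> p i \<le> q i \<and> q i \<le> p n" if "i < n" for i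
      using Suc.prems(1)[of i] Suc.prems(4)[of i n] that by auto
    show "p n \<le> b" using pn Suc.prems by linarith
  qed (use pn Suc.prems in auto)
  moreover have "\<Phi> (q n) \<le> \<Phi> c"
    using pn Suc.prems(3) by (intro mono) linarith+
  ultimately show ?case by simp
qed

text \<open>Truncation at height \<open>m\<close>: the excess \<open>h m\<close> of |f| over
  \<open>m\<close> has small total integral by dominated convergence, whatever the intervals are,
  and the truncated part contributes at most \<open>m\<close> times their total length.\<close>

lemma abs_cont_on_indefinite_integral:
  fixes f F :: "real \<Rightarrow> real"
  assumes f: "f absolutely_integrable_on {a..b}"
    and F: "\<And>x y. a \<le> x \<Longrightarrow> x \<le> y \<Longrightarrow> y \<le> b \<Longrightarrow> F y - F x = integral {x..y} f"
  shows "abs_cont_on {a..b} F"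
proof (rule abs_cont_onI)
  fix \<epsilon> :: real assume "\<epsilon> > 0"
  define h where "h = (\<lambda>(m::nat) x. \<bar>f x\<bar> - min \<bar>f x\<bar> (real m))"
  have fabs: "(\<lambda>x. \<bar>f x\<bar>) absolutely_integrable_on {a..b}"
    using absolutely_integrable_norm[OF f] by (simp add: o_def)
  have habs: "h m absolutely_integrable_on {a..b}" for m
    unfolding h_def
    by (intro set_integral_diff(1) fabs absolutely_integrable_min_1) auto
  have hint: "h m integrable_on {a..b}" for m
    using habs[of m] by (simp add: absolutely_integrable_on_def)
  have fint: "f integrable_on {a..b}" "(\<lambda>x. \<bar>f x\<bar>) integrable_on {a..b}"
    using f fabs by (auto simp: absolutely_integrable_on_def)
  have "(\<lambda>m. integral {a..b} (h m)) \<longlonglongrightarrow> integral {a..b} (\<lambda>x. 0)"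
  proof (rule dominated_convergence(2)[OF hint fint(2)])
    show "norm (h m x) \<le> \<bar>f x\<bar>" for m x by (auto simp: h_def min_def)
    show "(\<lambda>m. h m x) \<longlonglongrightarrow> 0" for x
    proof (rule tendsto_eventually)
      obtain M :: nat where "\<bar>f x\<bar> \<le> M" using real_arch_simple by blast
      then show "\<forall>\<^sub>F m in sequentially. h m x = 0"
        by (intro eventually_sequentiallyI[of M]) (auto simp: h_def min_def)
    qed
  qed
  then have "\<forall>\<^sub>F m in sequentially. integral {a..b} (h m) < \<epsilon> / 2"
    using \<open>\<epsilon> > 0\<close> by (intro order_tendstoD(2)) auto
  then obtain m where m: "integral {a..b} (h m) < \<epsilon> / 2"
    by (auto simp: eventually_sequentially)
  \<comment> \<open>Makes \<open>real m * \<delta>\<close> at most \<open>\<epsilon> / 2\<close>;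
    the summand 1 covers \<open>m = 0\<close>.\<close>
  define \<delta> where "\<delta> = \<epsilon> / (2 * (real m + 1))"
  have "\<delta> > 0" using \<open>\<epsilon> > 0\<close> by (simp add: \<delta>_def)
  define \<Phi> where "\<Phi> = (\<lambda>x. integral {a..x} (h m))"
  have sub: "k integrable_on {x..y}" if "k integrable_on {a..b}" "a \<le> x" "y \<le> b" for k :: "real \<Rightarrow> real" and x y
    using integrable_on_subinterval[OF that(1)] that by auto
  have \<Phi>: "\<Phi> y - \<Phi> x = integral {x..y} (h m)" if "a \<le> x" "x \<le> y" "y \<le> b" for x y
    using Henstock_Kurzweil_Integration.integral_combine[OF that(1,2), of "h m"] sub[OF hint[of m], of a y] that
    by (simp add: \<Phi>_def)
  have h0: "h m x \<ge> 0" for x by (simp add: h_def)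
  have mono: "\<Phi> x \<le> \<Phi> y" if "a \<le> x" "x \<le> y" "y \<le> b" for x y
    using \<Phi>[OF that] integral_nonneg[OF sub[OF hint[of m]], of x y] that h0 by auto
  have Fle: "\<bar>F y - F x\<bar> \<le> (\<Phi> y - \<Phi> x) + real m * (y - x)" if "a \<le> x" "x \<le> y" "y \<le> b" for x y
  proof -
    have "\<bar>F y - F x\<bar> \<le> integral {x..y} (\<lambda>z. h m z + real m)"
    proof -
      have "norm (integral {x..y} f) \<le> integral {x..y} (\<lambda>z. h m z + real m)"
        using sub[OF fint(1), of x y] sub[OF hint[of m], of x y] that
        by (intro integral_norm_bound_integral integrable_add) (auto simp: h_def)
      then show ?thesis using F[OF that] by simp
    qed
    also have "\<dots> = integral {x..y} (h m) + real m * (y - x)"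
      using sub[OF hint[of m], of x y] that
      by (subst Henstock_Kurzweil_Integration.integral_add) auto
    finally show ?thesis using \<Phi>[OF that] by simp
  qed
  have "(\<Sum>i<n. \<bar>F (q i) - F (p i)\<bar>) < \<epsilon>"
    if pq: "\<forall>i<n. p i \<in> {a..b} \<and> q i \<in> {a..b} \<and> p i \<le> q i" "\<forall>i j. i < j \<and> j < n \<longrightarrow> q i \<le> p j"
      "(\<Sum>i<n. q i - p i) < \<delta>" for n :: nat and p q
  proof (cases "a \<le> b")
    case True
    have "(\<Sum>i<n. \<bar>F (q i) - F (p i)\<bar>) \<le> (\<Sum>i<n. (\<Phi> (q i) - \<Phi> (p i)) + real m * (q i - p i))"
      using pq(1) by (intro sum_mono Fle) auto
    also have "\<dots> = (\<Sum>i<n. \<Phi> (q i) - \<Phi> (p i)) + real m * (\<Sum>i<n. q i - p i)"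
      by (simp add: sum.distrib sum_distrib_left)
    also have "\<dots> \<le> (\<Phi> b - \<Phi> a) + real m * \<delta>"
      using pq True by (intro add_mono sum_increments_le[of a b] mono mult_left_mono) auto
    also have "\<Phi> b - \<Phi> a = integral {a..b} (h m)" using \<Phi>[of a b] True by simp
    also have "integral {a..b} (h m) + real m * \<delta> < \<epsilon> / 2 + \<epsilon> / 2"
      using m \<open>\<epsilon> > 0\<close> by (intro add_less_le_mono) (auto simp: \<delta>_def field_simps)
    finally show ?thesis by simp
  next
    case False
    then have "n = 0" using pq(1) by (cases n) auto
    then show ?thesis using \<open>\<epsilon> > 0\<close> by simp
  qed
  then show "\<exists>\<delta>>0. \<forall>(n::nat) p q.
        (\<forall>i<n. p i \<in> {a..b} \<and> q i \<in> {a..b} \<and> p i \<le> q i) \<longrightarrow>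
        (\<forall>i j. i < j \<and> j < n \<longrightarrow> q i \<le> p j) \<longrightarrow>
        (\<Sum>i<n. q i - p i) < \<delta> \<longrightarrow> (\<Sum>i<n. \<bar>F (q i) - F (p i)\<bar>) < \<epsilon>"
    using \<open>\<delta> > 0\<close> by blast
qed

section \<open>Recovering an absolutely continuous function from its derivative\<close>

text \<open>Tagged divisions supply intervals without any order, whereas absolute continuity is
  phrased for intervals listed from left to right. Sorting by left endpoints passes from one to the
  other.\<close>

lemma abs_cont_on_finite_family:
  fixes f :: "real \<Rightarrow> real"
  assumes f: "abs_cont_on S f" and "\<epsilon> > 0"
  shows "\<exists>\<delta>>0. \<forall>I (l :: 'i \<Rightarrow> real) r. finite I \<longrightarrow> (\<forall>i\<in>I. l i \<in> S \<and> r i \<in> S \<and> l i \<le> r i) \<longrightarrow>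
        (\<forall>i\<in>I. \<forall>j\<in>I. i \<noteq> j \<longrightarrow> {l i<..<r i} \<inter> {l j<..<r j} = {}) \<longrightarrow>
        (\<Sum>i\<in>I. r i - l i) < \<delta> \<longrightarrow> (\<Sum>i\<in>I. \<bar>f (r i) - f (l i)\<bar>) < \<epsilon>"
proof -
  obtain \<delta> where \<delta>: "\<delta> > 0"
      "\<And>(n::nat) a b. (\<And>i. i < n \<Longrightarrow> a i \<in> S \<and> b i \<in> S \<and> a i \<le> b i) \<Longrightarrow>
        (\<And>i j. i < j \<Longrightarrow> j < n \<Longrightarrow> b i \<le> a j) \<Longrightarrow>
        (\<Sum>i<n. b i - a i) < \<delta> \<Longrightarrow> (\<Sum>i<n. \<bar>f (b i) - f (a i)\<bar>) < \<epsilon>"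
    using abs_cont_onE[OF f \<open>\<epsilon> > 0\<close>] by blast
  show ?thesis
  proof (intro exI[of _ \<delta>] conjI allI impI \<delta>(1))
    fix I and l r :: "'i \<Rightarrow> real"
    assume fin: "finite I" and "\<forall>i\<in>I. l i \<in> S \<and> r i \<in> S \<and> l i \<le> r i"
      and "\<forall>i\<in>I. \<forall>j\<in>I. i \<noteq> j \<longrightarrow> {l i<..<r i} \<inter> {l j<..<r j} = {}"
      and small: "(\<Sum>i\<in>I. r i - l i) < \<delta>"
    then have lr: "\<And>i. i \<in> I \<Longrightarrow> l i \<in> S \<and> r i \<in> S \<and> l i \<le> r i"
      and disj: "\<And>i j. i \<in> I \<Longrightarrow> j \<in> I \<Longrightarrow> i \<noteq> j \<Longrightarrow> {l i<..<r i} \<inter> {l j<..<r j} = {}"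
      by blast+
    \<comment> \<open>Degenerate intervals contribute 0 to both sums, but could share a left
      endpoint with another interval; without them disjointness of the interiors makes
      \<open>l\<close> injective.\<close>
    define J where "J = {i\<in>I. l i < r i}"
    have JI: "finite J" "J \<subseteq> I" using fin by (auto simp: J_def)
    have apart: "r i \<le> l j" if ij: "i \<in> J" "j \<in> J" "l i < l j" for i j
    proof (rule ccontr)
      assume "\<not> r i \<le> l j"
      then obtain z where z: "l j < z" "z < min (r i) (r j)"
        using dense[of "l j" "min (r i) (r j)"] ij by (auto simp: J_def)
      then have "z \<in> {l i<..<r i} \<inter> {l j<..<r j}" using ij by auto
      moreover have "i \<in> I" "j \<in> I" "i \<noteq> j" using ij JI by auto
      ultimately show False using disj[of i j] by blast
    qed
    have inj: "inj_on l J"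
    proof (rule inj_onI, rule ccontr)
      fix i j assume ij: "i \<in> J" "j \<in> J" "l i = l j" "i \<noteq> j"
      then obtain z where "l i < z" "z < min (r i) (r j)"
        using dense[of "l i" "min (r i) (r j)"] by (auto simp: J_def)
      then have "z \<in> {l i<..<r i} \<inter> {l j<..<r j}" using ij by auto
      moreover have "i \<in> I" "j \<in> I" "i \<noteq> j" using ij JI by auto
      ultimately show False using disj[of i j] by blast
    qed
    define xs where "xs = sorted_list_of_set (l ` J)"
    define n where "n = card J"
    have len: "length xs = n" by (simp add: xs_def n_def card_image[OF inj])
    define idx where "idx = (\<lambda>k. inv_into J l (xs ! k))"
    have bij: "bij_betw idx {..<n} J"
    proof -
      have "bij_betw ((!) xs) {..<n} (l ` J)"
        using JI by (intro bij_betw_nth) (auto simp: xs_def len[symmetric])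
      moreover have "bij_betw (inv_into J l) (l ` J) J"
        using inj by (intro bij_betw_inv_into) (simp add: bij_betw_def)
      ultimately have "bij_betw (inv_into J l \<circ> (!) xs) {..<n} J" by (rule bij_betw_trans)
      then show ?thesis by (simp add: idx_def o_def)
    qed
    have idxJ: "idx k \<in> J" if "k < n" for k using bij that by (auto simp: bij_betw_def)
    have lidx: "l (idx k) = xs ! k" if "k < n" for k
    proof -
      have "xs ! k \<in> set xs" using that len by simp
      then show ?thesis using JI by (simp add: idx_def f_inv_into_f xs_def)
    qed
    have sorted: "xs ! i < xs ! j" if "i < j" "j < n" for i j
      using strict_sorted_list_of_set[of "l ` J"] that len
      by (simp add: xs_def[symmetric] sorted_wrt_nth_less)
    have drop: "(\<Sum>i\<in>I. F i) = (\<Sum>k<n. F (idx k))" if "\<And>i. i \<in> I \<Longrightarrow> l i = r i \<Longrightarrow> F i = 0" for F :: "'i \<Rightarrow> real"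
    proof -
      have "(\<Sum>i\<in>I. F i) = (\<Sum>i\<in>J. F i)"
        using fin that lr by (intro sum.mono_neutral_right) (force simp: J_def)+
      also have "\<dots> = (\<Sum>k<n. F (idx k))"
        using sum.reindex_bij_betw[OF bij, of F] by simp
      finally show ?thesis .
    qed
    have "(\<Sum>k<n. \<bar>f (r (idx k)) - f (l (idx k))\<bar>) < \<epsilon>"
    proof (rule \<delta>(2))
      show "l (idx i) \<in> S \<and> r (idx i) \<in> S \<and> l (idx i) \<le> r (idx i)" if "i < n" for i
        using idxJ[OF that] JI lr by blast
      show "r (idx i) \<le> l (idx j)" if "i < j" "j < n" for i j
        using apart[of "idx i" "idx j"] idxJ lidx sorted[OF that] that by auto
      show "(\<Sum>k<n. r (idx k) - l (idx k)) < \<delta>"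
        using small drop[of "\<lambda>i. r i - l i"] by simp
    qed
    then show "(\<Sum>i\<in>I. \<bar>f (r i) - f (l i)\<bar>) < \<epsilon>"
      using drop[of "\<lambda>i. \<bar>f (r i) - f (l i)\<bar>"] by simp
  qed
qed


text \<open>The gauge integral is verified from its definition, so integrability of \<open>f\<close>
  is part of the result. At tags where the derivative exists the gauge makes the linear
  approximation accurate; at tags in the null set it forces the intervals into an open set of small
  measure, where absolute continuity bounds the increments of \<open>F\<close>.\<close>

theorem abs_cont_on_FTC:
  fixes f F :: "real \<Rightarrow> real"
  assumes F: "abs_cont_on {a..b} F" and "a \<le> b"
    and ae: "AE x in lebesgue. x \<in> {a..b} \<longrightarrow> (F has_real_derivative f x) (at x)"
  shows "(f has_integral (F b - F a)) {a..b}"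
proof -
  obtain N where N: "N \<in> null_sets lebesgue" "{x. \<not> (x \<in> {a..b} \<longrightarrow> (F has_real_derivative f x) (at x))} \<subseteq> N"
    using ae by (auto simp: eventually_ae_filter)
  have negN: "negligible N" using N(1) by (simp add: negligible_iff_null_sets)
  have der: "(F has_real_derivative f x) (at x)" if "x \<in> {a..b}" "x \<notin> N" for x
    using N(2) that by blast
  \<comment> \<open>With the value 0 on the exceptional set, tags there contribute nothing to the
    Riemann sum, and only the increments of \<open>F\<close> remain to be estimated.\<close>
  define f0 where "f0 = (\<lambda>x. if x \<in> N then 0 else f x)"
  have "(f0 has_integral (F b - F a)) {a..b}"
    unfolding has_integral_real
  proof (intro allI impI)
    fix e :: real assume "e > 0"
    \<comment> \<open>The errors at good tags add up to at most \<open>e1 * (b - a)\<close>, which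
      stays below \<open>e / 2\<close>; adding 1 covers \<open>a = b\<close>.\<close>
    define e1 where "e1 = e / (2 * (b - a + 1))"
    have "e1 > 0" using \<open>e > 0\<close> \<open>a \<le> b\<close> by (simp add: e1_def)
    obtain \<delta> where \<delta>: "\<delta> > 0"
      "\<forall>I (l :: real \<times> real set \<Rightarrow> real) r. finite I \<longrightarrow>
        (\<forall>i\<in>I. l i \<in> {a..b} \<and> r i \<in> {a..b} \<and> l i \<le> r i) \<longrightarrow>
        (\<forall>i\<in>I. \<forall>j\<in>I. i \<noteq> j \<longrightarrow> {l i<..<r i} \<inter> {l j<..<r j} = {}) \<longrightarrow>
        (\<Sum>i\<in>I. r i - l i) < \<delta> \<longrightarrow> (\<Sum>i\<in>I. \<bar>F (r i) - F (l i)\<bar>) < e / 2"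
      using abs_cont_on_finite_family[where 'i = "real \<times> real set", OF F half_gt_zero[OF \<open>e > 0\<close>]]
      by (elim exE conjE)
    have "N \<in> sets lebesgue" using N(1) by auto
    then obtain U where U: "open U" "N \<subseteq> U" "U - N \<in> lmeasurable" "emeasure lebesgue (U - N) < ennreal \<delta>"
      using sets_lebesgue_outer_open \<delta>(1) by blast
    have "emeasure lebesgue U = emeasure lebesgue (U - N)"
      using N(1) U(1) by (subst emeasure_Diff_null_set) auto
    then have Um: "emeasure lebesgue U < ennreal \<delta>" using U(4) by simp
    then have Ulm: "U \<in> lmeasurable" using U(1)
      by (intro fmeasurableI) (auto intro: less_trans simp: top.not_eq_extremum[symmetric])
    have mU: "measure lebesgue U < \<delta>"
      using Um \<delta>(1) by (simp add: emeasure_eq_measure2[OF Ulm] ennreal_less_iff)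
    have near: "\<exists>d>0. (x \<in> N \<longrightarrow> ball x d \<subseteq> U) \<and>
        (x \<in> {a..b} - N \<longrightarrow> (\<forall>y. \<bar>y - x\<bar> < d \<longrightarrow> \<bar>F y - F x - f x * (y - x)\<bar> \<le> e1 * \<bar>y - x\<bar>))" for x
    proof (cases "x \<in> N")
      case True
      then show ?thesis using U(1,2) by (auto simp: open_contains_ball)
    next
      case False
      show ?thesis
      proof (cases "x \<in> {a..b}")
        case True
        then have "(F has_derivative (*) (f x)) (at x)"
          using der False by (auto simp: has_field_derivative_def)
        then have "\<exists>d>0. \<forall>y. norm (y - x) < d \<longrightarrow> norm (F y - F x - f x * (y - x)) \<le> e1 * norm (y - x)"
          using \<open>e1 > 0\<close> unfolding has_derivative_at_alt by blast
        then show ?thesis using False by (auto simp: real_norm_def)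
      qed (use False in \<open>auto intro: exI[of _ 1]\<close>)
    qed
    obtain d where d: "\<And>x. d x > 0" "\<And>x. x \<in> N \<Longrightarrow> ball x (d x) \<subseteq> U"
      "\<And>x y. x \<in> {a..b} \<Longrightarrow> x \<notin> N \<Longrightarrow> \<bar>y - x\<bar> < d x \<Longrightarrow> \<bar>F y - F x - f x * (y - x)\<bar> \<le> e1 * \<bar>y - x\<bar>"
    proof -
      have "\<exists>d. \<forall>x. d x > 0 \<and> (x \<in> N \<longrightarrow> ball x (d x) \<subseteq> U) \<and>
        (x \<in> {a..b} - N \<longrightarrow> (\<forall>y. \<bar>y - x\<bar> < d x \<longrightarrow> \<bar>F y - F x - f x * (y - x)\<bar> \<le> e1 * \<bar>y - x\<bar>))"
        using near by (intro choice) auto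
      then show thesis using that by auto
    qed
    define \<gamma> where "\<gamma> = (\<lambda>x. ball x (d x))"
    have "gauge \<gamma>" using d(1) by (auto simp: \<gamma>_def gauge_def)
    moreover have fine: "norm ((\<Sum>(x, K)\<in>p. measure lborel K *\<^sub>R f0 x) - (F b - F a)) < e"
      if p: "p tagged_division_of {a..b}" "\<gamma> fine p" for p
    proof -
      note tp = tagged_division_ofD[OF p(1)]
      have K: "\<exists>u v. K = {u..v} \<and> u \<le> v \<and> x \<in> {u..v} \<and> {u..v} \<subseteq> {a..b} \<and> {u..v} \<subseteq> ball x (d x)"
        if xK: "(x, K) \<in> p" for x K
      proof -
        obtain u v where "K = cbox u v" using tp(4)[OF xK] by blast
        moreover have "x \<in> K" "K \<subseteq> {a..b}" using tp(2,3)[OF xK] by auto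
        moreover have "K \<subseteq> ball x (d x)" using p(2) xK by (auto simp: fine_def \<gamma>_def)
        ultimately show ?thesis by (intro exI[of _ u] exI[of _ v]) auto
      qed
      have tele: "(\<Sum>(x, K)\<in>p. F (Sup K) - F (Inf K)) = F b - F a"
        using additive_tagged_division_1[OF \<open>a \<le> b\<close>, of p F] p(1) by simp
      define pN where "pN = {z\<in>p. fst z \<in> N}"
      define pG where "pG = {z\<in>p. fst z \<notin> N}"
      have pp: "p = pN \<union> pG" "pN \<inter> pG = {}" "finite pN" "finite pG" "pN \<subseteq> p" "pG \<subseteq> p"
        using tp(1) by (auto simp: pN_def pG_def)
      let ?D = "\<lambda>z. measure lborel (snd z) * f0 (fst z) - (F (Sup (snd z)) - F (Inf (snd z)))"
      have good: "\<bar>?D z\<bar> \<le> e1 * measure lborel (snd z)" if zG: "z \<in> pG" for z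
      proof -
        obtain x K where z: "z = (x, K)" by (cases z)
        then have xK: "(x, K) \<in> p" "x \<notin> N" using zG by (auto simp: pG_def)
        then obtain u v where uv: "K = {u..v}" "u \<le> v" "x \<in> {u..v}" "{u..v} \<subseteq> {a..b}" "{u..v} \<subseteq> ball x (d x)"
          using K by blast
        have xab: "x \<in> {a..b}" using uv by blast
        have "u \<in> ball x (d x)" "v \<in> ball x (d x)" using uv(2,5) by auto
        then have bnd: "\<bar>F u - F x - f x * (u - x)\<bar> \<le> e1 * \<bar>u - x\<bar>" "\<bar>F v - F x - f x * (v - x)\<bar> \<le> e1 * \<bar>v - x\<bar>"
          using d(3)[OF xab xK(2)] by (auto simp: dist_real_def abs_minus_commute)
        have abs: "\<bar>u - x\<bar> = x - u" "\<bar>v - x\<bar> = v - x" using uv(3) by auto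
        \<comment> \<open>The tag lies in its interval, so the errors towards the two endpoints add
          up to \<open>e1\<close> times the length.\<close>
        have "(v - u) * f x - (F v - F u)
            = (F u - F x - f x * (u - x)) - (F v - F x - f x * (v - x))" by (simp add: algebra_simps)
        then have "\<bar>(v - u) * f x - (F v - F u)\<bar> \<le> e1 * (x - u) + e1 * (v - x)"
          using bnd unfolding abs by (simp only:)
        also have "\<dots> = e1 * (v - u)" by (simp add: algebra_simps)
        finally show ?thesis using uv xK by (simp add: z f0_def)
      qed
      have sumcont: "(\<Sum>z\<in>p. measure lborel (snd z)) = b - a"
        using additive_content_tagged_division[of p a b] p(1) \<open>a \<le> b\<close> by (simp add: split_beta)
      have "\<bar>\<Sum>z\<in>pG. ?D z\<bar> \<le> (\<Sum>z\<in>pG. e1 * measure lborel (snd z))"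
        by (intro order_trans[OF sum_abs] sum_mono good)
      also have "\<dots> = e1 * (\<Sum>z\<in>pG. measure lborel (snd z))" by (simp add: sum_distrib_left)
      also have "\<dots> \<le> e1 * (\<Sum>z\<in>p. measure lborel (snd z))"
        using \<open>e1 > 0\<close> pp tp(1) by (intro mult_left_mono sum_mono2) auto
      also have "\<dots> \<le> e / 2" unfolding sumcont using \<open>e > 0\<close> \<open>a \<le> b\<close>
        by (auto simp: e1_def divide_simps algebra_simps)
      finally have G: "\<bar>\<Sum>z\<in>pG. ?D z\<bar> \<le> e / 2" .
      have lrN: "Inf (snd z) \<in> {a..b} \<and> Sup (snd z) \<in> {a..b} \<and> Inf (snd z) \<le> Sup (snd z)
          \<and> snd z = {Inf (snd z)..Sup (snd z)} \<and> (z \<in> pN \<longrightarrow> snd z \<subseteq> U)" if zp: "z \<in> p" for z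
      proof -
        obtain x K' where z: "z = (x, K')" by (cases z)
        then obtain u v where "K' = {u..v}" "u \<le> v" "x \<in> {u..v}" "{u..v} \<subseteq> {a..b}" "{u..v} \<subseteq> ball x (d x)"
          using K zp by blast
        then show ?thesis using d(2)[of x] z by (auto simp: pN_def)
      qed
      have "(\<Sum>z\<in>pN. \<bar>F (Sup (snd z)) - F (Inf (snd z))\<bar>) < e / 2"
      proof (rule \<delta>(2)[rule_format, OF pp(3)])
        show "Inf (snd z) \<in> {a..b} \<and> Sup (snd z) \<in> {a..b} \<and> Inf (snd z) \<le> Sup (snd z)" if "z \<in> pN" for z
          using lrN[of z] that pp(5) by blast
        have int: "interior (snd z) = {Inf (snd z)<..<Sup (snd z)}" if "z \<in> pN" for z
        proof -
          have "snd z = {Inf (snd z)..Sup (snd z)}" using lrN[of z] that pp(5) by blast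
          then have "interior (snd z) = interior {Inf (snd z)..Sup (snd z)}" by (rule arg_cong)
          then show ?thesis by simp
        qed
        show disj: "{Inf (snd z)<..<Sup (snd z)} \<inter> {Inf (snd y)<..<Sup (snd y)} = {}"
          if "z \<in> pN" "y \<in> pN" "z \<noteq> y" for z y
          using tp(5)[of "fst z" "snd z" "fst y" "snd y"] that pp(5) int[of z] int[of y] by auto
        let ?O = "\<lambda>z::real \<times> real set. {Inf (snd z)<..<Sup (snd z)}"
        \<comment> \<open>The interiors are disjoint and lie in \<open>U\<close>, so the total
          length is bounded by the measure of \<open>U\<close>.\<close>
        have "(\<Sum>z\<in>pN. Sup (snd z) - Inf (snd z)) = (\<Sum>z\<in>pN. measure lebesgue (?O z))"
          using lrN pp(5) by (intro sum.cong) auto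
        also have "\<dots> = measure lebesgue (\<Union>z\<in>pN. ?O z)"
        proof (rule measure_finite_Union[symmetric, OF pp(3)])
          show "emeasure lebesgue (?O z) \<noteq> \<infinity>" for z
            using emeasure_lborel_box_finite[of "Inf (snd z)" "Sup (snd z)"] by simp
          show "disjoint_family_on ?O pN" unfolding disjoint_family_on_def using disj by blast
        qed auto
        also have "\<dots> \<le> measure lebesgue U"
        proof (rule measure_mono_fmeasurable[OF _ _ Ulm])
          show "(\<Union>z\<in>pN. ?O z) \<subseteq> U"
          proof (rule UN_least)
            fix z assume "z \<in> pN"
            then have "snd z = {Inf (snd z)..Sup (snd z)}" "snd z \<subseteq> U" using lrN[of z] pp(5) by auto
            moreover have "?O z \<subseteq> {Inf (snd z)..Sup (snd z)}" by auto
            ultimately show "?O z \<subseteq> U" by blast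
          qed
          show "(\<Union>z\<in>pN. ?O z) \<in> sets lebesgue"
            using pp(3) by (intro sets.finite_UN) auto
        qed
        finally show "(\<Sum>z\<in>pN. Sup (snd z) - Inf (snd z)) < \<delta>" using mU by simp
      qed
      moreover have "\<bar>\<Sum>z\<in>pN. ?D z\<bar> \<le> (\<Sum>z\<in>pN. \<bar>F (Sup (snd z)) - F (Inf (snd z))\<bar>)"
        by (intro order_trans[OF sum_abs] sum_mono) (auto simp: pN_def f0_def)
      ultimately have B: "\<bar>\<Sum>z\<in>pN. ?D z\<bar> < e / 2" by simp
      have "(\<Sum>(x, K)\<in>p. measure lborel K *\<^sub>R f0 x) - (F b - F a) = (\<Sum>z\<in>p. ?D z)"
        unfolding tele[symmetric] by (simp add: sum_subtractf split_beta)
      also have "\<dots> = (\<Sum>z\<in>pN. ?D z) + (\<Sum>z\<in>pG. ?D z)"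
        using sum.union_disjoint[OF pp(3,4,2), of ?D] pp(1) by simp
      finally show ?thesis using G B by simp
    qed
    ultimately show "\<exists>\<gamma>. gauge \<gamma> \<and> (\<forall>p. p tagged_division_of {a..b} \<and> \<gamma> fine p \<longrightarrow>
        norm ((\<Sum>(x, K)\<in>p. measure lborel K *\<^sub>R f0 x) - (F b - F a)) < e)"
      by (intro exI[of _ \<gamma>] conjI allI impI fine) simp_all
  qed
  then show ?thesis
    by (rule has_integral_spike[OF negN, rotated]) (simp add: f0_def)
qed

section \<open>Almost everywhere differentiation of integrals\<close>

text \<open>Averages to the right converge by the known theorem. Averages to the left are averages
  to the right of the reflected function, and reflection preserves null sets.\<close>

theorem lebesgue_differentiation:
  fixes f :: "real \<Rightarrow> real"
  assumes "\<And>a b. f integrable_on {a..b}"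
  shows "AE x in lebesgue. \<forall>e>0. \<exists>d>0. \<forall>h. 0 < h \<and> h < d \<longrightarrow>
    \<bar>integral {x..x + h} f / h - f x\<bar> < e \<and> \<bar>integral {x - h..x} f / h - f x\<bar> < e"
proof -
  obtain N1 where N1: "negligible N1" "\<And>x e. \<lbrakk>x \<notin> N1; 0 < e\<rbrakk> \<Longrightarrow>
      \<exists>d>0. \<forall>h. 0 < h \<and> h < d \<longrightarrow> norm (integral (cbox x (x + h *\<^sub>R One)) f /\<^sub>R h ^ DIM(real) - f x) < e"
    using integrable_ccontinuous_explicit[of f] assms unfolding cbox_interval by blast
  let ?f = "\<lambda>x. f (- x)"
  have "?f integrable_on {a..b}" for a b
    using assms[of "- b" "- a"] Henstock_Kurzweil_Integration.integrable_reflect_real[of f "-a" "-b"] by simp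
  then obtain N2 where N2: "negligible N2" "\<And>x e. \<lbrakk>x \<notin> N2; 0 < e\<rbrakk> \<Longrightarrow>
      \<exists>d>0. \<forall>h. 0 < h \<and> h < d \<longrightarrow> norm (integral (cbox x (x + h *\<^sub>R One)) ?f /\<^sub>R h ^ DIM(real) - ?f x) < e"
    using integrable_ccontinuous_explicit[of ?f] unfolding cbox_interval by blast
  have "negligible (uminus ` N2)"
    using N2(1) by (intro negligible_differentiable_image_negligible) (auto intro!: derivative_intros simp: differentiable_on_def)
  then have "N1 \<union> uminus ` N2 \<in> null_sets lebesgue"
    using N1(1) by (simp add: negligible_iff_null_sets[symmetric])
  then show ?thesis
  proof (rule AE_I', intro subsetI)
    fix x assume "x \<in> {x \<in> space lebesgue. \<not> (\<forall>e>0. \<exists>d>0. \<forall>h. 0 < h \<and> h < d \<longrightarrow>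
      \<bar>integral {x..x + h} f / h - f x\<bar> < e \<and> \<bar>integral {x - h..x} f / h - f x\<bar> < e)}"
    then obtain e where e: "e > 0" "\<not> (\<exists>d>0. \<forall>h. 0 < h \<and> h < d \<longrightarrow>
      \<bar>integral {x..x + h} f / h - f x\<bar> < e \<and> \<bar>integral {x - h..x} f / h - f x\<bar> < e)" by auto
    show "x \<in> N1 \<union> uminus ` N2"
    proof (rule ccontr)
      assume "x \<notin> N1 \<union> uminus ` N2"
      then have x: "x \<notin> N1" "- x \<notin> N2" by (auto intro: rev_image_eqI)
      obtain d1 where d1: "d1 > 0" "\<And>h. 0 < h \<Longrightarrow> h < d1 \<Longrightarrow> \<bar>integral {x..x + h} f / h - f x\<bar> < e"
        using N1(2)[OF x(1) e(1)] by (auto simp: divide_inverse mult.commute)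
      obtain d2 where d2: "d2 > 0" "\<And>h. 0 < h \<Longrightarrow> h < d2 \<Longrightarrow> \<bar>integral {- x..- x + h} ?f / h - f x\<bar> < e"
        using N2(2)[OF x(2) e(1)] by (auto simp: divide_inverse mult.commute)
      have "integral {- x..- x + h} ?f = integral {x - h..x} f" for h
        using Henstock_Kurzweil_Integration.integral_reflect_real[of x "x - h" f] by simp
      then have "\<forall>h. 0 < h \<and> h < min d1 d2 \<longrightarrow>
          \<bar>integral {x..x + h} f / h - f x\<bar> < e \<and> \<bar>integral {x - h..x} f / h - f x\<bar> < e"
        using d1(2) d2(2) by auto
      moreover have "min d1 d2 > 0" using d1(1) d2(1) by simp
      ultimately show False using e(2) by blast
    qed
  qed
qed

text \<open>Integrability is only local in \<open>E\<close>, while the differentiation theorem asks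
  for it on all intervals. Cutting \<open>f\<close> off outside intervals with rational endpoints
  leaves countably many functions, hence a single null set, and each point of \<open>E\<close> is
  interior to one of these intervals.\<close>

lemma AE_has_derivative_indefinite_integral:
  fixes f F :: "real \<Rightarrow> real"
  assumes "open E" and f: "\<And>a b. {a..b} \<subseteq> E \<Longrightarrow> f integrable_on {a..b}"
    and F: "\<And>x y. x \<le> y \<Longrightarrow> {x..y} \<subseteq> E \<Longrightarrow> F y - F x = integral {x..y} f"
  shows "AE x in lebesgue. x \<in> E \<longrightarrow> (F has_real_derivative f x) (at x)"
proof -
  define C where "C = {(a, b). a \<in> \<rat> \<and> b \<in> \<rat> \<and> {a..b} \<subseteq> E}"
  have "countable C"
    by (rule countable_subset[of _ "\<rat> \<times> \<rat>"]) (auto simp: C_def countable_rat)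
  define fr where "fr = (\<lambda>(a, b) x. if x \<in> {a..b} then f x else 0)"
  have fr: "fr c integrable_on {u..v}" if "c \<in> C" for c u v
  proof -
    obtain a b where c: "c = (a, b)" by (cases c)
    then have "f integrable_on {a..b}" using that f by (auto simp: C_def)
    then have "fr c integrable_on UNIV" unfolding c fr_def prod.case by (simp only: integrable_restrict_UNIV)
    then show ?thesis using integrable_on_subcbox[of "fr c" UNIV u v] by simp
  qed
  have "AE x in lebesgue. \<forall>c\<in>C. \<forall>e>0. \<exists>d>0. \<forall>h. 0 < h \<and> h < d \<longrightarrow>
    \<bar>integral {x..x + h} (fr c) / h - fr c x\<bar> < e \<and> \<bar>integral {x - h..x} (fr c) / h - fr c x\<bar> < e"
    using \<open>countable C\<close> fr by (subst AE_ball_countable) (auto intro!: lebesgue_differentiation)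
  then show ?thesis
  proof (rule AE_mp, intro AE_I2 impI)
    fix x assume *: "\<forall>c\<in>C. \<forall>e>0. \<exists>d>0. \<forall>h. 0 < h \<and> h < d \<longrightarrow>
      \<bar>integral {x..x + h} (fr c) / h - fr c x\<bar> < e \<and> \<bar>integral {x - h..x} (fr c) / h - fr c x\<bar> < e"
      and "x \<in> E"
    obtain r where r: "r > 0" "ball x r \<subseteq> E" using \<open>open E\<close> \<open>x \<in> E\<close> by (auto simp: open_contains_ball)
    obtain a where a: "a \<in> \<rat>" "x - r < a" "a < x" using Rats_dense_in_real[of "x - r" x] r by auto
    obtain b where b: "b \<in> \<rat>" "x < b" "b < x + r" using Rats_dense_in_real[of x "x + r"] r by auto
    have ab: "{a..b} \<subseteq> E" using a b r by (auto simp: ball_def dist_real_def subset_iff)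
    then have C: "(a, b) \<in> C" using a b by (simp add: C_def)
    have eq: "integral {u..v} (fr (a, b)) = F v - F u" if "a \<le> u" "u \<le> v" "v \<le> b" for u v
    proof -
      have "{u..v} \<subseteq> E" using ab that by auto
      then have "F v - F u = integral {u..v} f" using F that by auto
      also have "\<dots> = integral {u..v} (fr (a, b))"
        using that by (intro integral_cong) (auto simp: fr_def)
      finally show ?thesis by simp
    qed
    show "(F has_real_derivative f x) (at x)"
      unfolding DERIV_def LIM_eq
    proof (intro allI impI)
      fix e :: real assume "e > 0"
      then obtain d where d: "d > 0" "\<And>h. 0 < h \<Longrightarrow> h < d \<Longrightarrow>
          \<bar>integral {x..x + h} (fr (a, b)) / h - fr (a, b) x\<bar> < e \<and> \<bar>integral {x - h..x} (fr (a, b)) / h - fr (a, b) x\<bar> < e"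
        using * C by blast
      have fx: "fr (a, b) x = f x" using a b by (simp add: fr_def)
      have "norm ((F (x + h) - F x) / h - f x) < e" if h: "h \<noteq> 0" "norm (h - 0) < min d (min (x - a) (b - x))" for h
      proof (cases "h > 0")
        case True
        then show ?thesis using d(2)[of h] eq[of x "x + h"] h fx a b by simp
      next
        case False
        then have "(F (x + h) - F x) / h = integral {x - (- h)..x} (fr (a, b)) / (- h)"
          using eq[of "x + h" x] h a b by (simp add: minus_divide_left)
        then show ?thesis using d(2)[of "- h"] False h fx by simp
      qed
      moreover have "min d (min (x - a) (b - x)) > 0" using d(1) a b by simp
      ultimately show "\<exists>s>0. \<forall>h. h \<noteq> 0 \<and> norm (h - 0) < s \<longrightarrow> norm ((F (x + h) - F x) / h - f x) < e"
        by blast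
    qed
  qed
qed

section \<open>The space \<open>L\<^sup>1\<close>\<close>

text \<open>Completeness of Lebesgue measure yields the measurability of \<open>v\<close>; this
  allows pointwise formulas that are known only almost everywhere to be exchanged freely.\<close>

lemma L1_cong_AE:
  assumes u: "L1 E u" and ae: "AE x in lebesgue. x \<in> E \<longrightarrow> u x = v x"
  shows "L1 E v"
proof -
  obtain N where N: "N \<in> null_sets lebesgue" "{x. \<not> (x \<in> E \<longrightarrow> u x = v x)} \<subseteq> N"
    using ae by (auto simp: eventually_ae_filter)
  have "v absolutely_integrable_on E"
  proof (rule absolutely_integrable_spike)
    show "u absolutely_integrable_on E" using u by (simp add: L1_def)
    show "negligible N" using N(1) by (simp add: negligible_iff_null_sets)
    show "v x = u x" if "x \<in> E - N" for x using N(2) that by auto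
  qed
  then show ?thesis by (simp add: L1_def)
qed

lemma L1_add: "L1 E u \<Longrightarrow> L1 E v \<Longrightarrow> L1 E (\<lambda>x. u x + v x)"
  unfolding L1_def by (rule set_integral_add(1))

lemma L1_diff: "L1 E u \<Longrightarrow> L1 E v \<Longrightarrow> L1 E (\<lambda>x. u x - v x)"
  unfolding L1_def by (rule set_integral_diff(1))

lemma L1_cmult: "L1 E u \<Longrightarrow> L1 E (\<lambda>x. c * u x)"
  unfolding L1_def by (rule set_integrable_mult_right) simp

lemma L1_cdiv: "L1 E u \<Longrightarrow> L1 E (\<lambda>x. u x / c)"
  using L1_cmult[of E u "inverse c"] by (simp add: divide_inverse mult.commute)

lemma L1_abs: "L1 E u \<Longrightarrow> L1 E (\<lambda>x. \<bar>u x\<bar>)"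
  unfolding L1_def by (rule set_integrable_abs)

lemma L1norm_nonneg: "0 \<le> L1norm E u"
  unfolding L1norm_def set_lebesgue_integral_def by (intro integral_nonneg_AE) auto

lemma L1norm_cmult: "L1norm E (\<lambda>x. c * u x) = \<bar>c\<bar> * L1norm E u"
  unfolding L1norm_def abs_mult by (rule set_integral_mult_right)

lemma L1norm_cdiv: "L1norm E (\<lambda>x. u x / c) = L1norm E u / \<bar>c\<bar>"
  using L1norm_cmult[of E "inverse c" u] by (simp add: divide_inverse mult.commute)

lemma L1norm_mono_AE:
  assumes "L1 E u" "L1 E v" "AE x in lebesgue. x \<in> E \<longrightarrow> \<bar>u x\<bar> \<le> v x"
  shows "L1norm E u \<le> (LINT x:E|lebesgue. v x)"
  using assms(2,3) L1_abs[OF assms(1)] unfolding L1norm_def L1_def by (rule_tac set_integral_mono_AE) auto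

lemma L1norm_cong_AE:
  assumes u: "L1 E u" and ae: "AE x in lebesgue. x \<in> E \<longrightarrow> u x = v x"
  shows "L1norm E u = L1norm E v"
proof (rule antisym)
  have v: "L1 E v" by (rule L1_cong_AE[OF u ae])
  have "AE x in lebesgue. x \<in> E \<longrightarrow> \<bar>u x\<bar> \<le> \<bar>v x\<bar>" using ae by eventually_elim auto
  from L1norm_mono_AE[OF u L1_abs[OF v] this]
  show "L1norm E u \<le> L1norm E v" by (simp add: L1norm_def)
  have "AE x in lebesgue. x \<in> E \<longrightarrow> \<bar>v x\<bar> \<le> \<bar>u x\<bar>" using ae by eventually_elim auto
  from L1norm_mono_AE[OF v L1_abs[OF u] this]
  show "L1norm E v \<le> L1norm E u" by (simp add: L1norm_def)
qed

lemma L1norm_triangle: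
  assumes u: "L1 E u" and v: "L1 E v"
  shows "L1norm E (\<lambda>x. u x + v x) \<le> L1norm E u + L1norm E v"
proof -
  have "L1norm E (\<lambda>x. u x + v x) \<le> (LINT x:E|lebesgue. \<bar>u x\<bar> + \<bar>v x\<bar>)"
    by (intro L1norm_mono_AE L1_add L1_abs u v AE_I2) auto
  also have "\<dots> = L1norm E u + L1norm E v"
    using L1_abs[OF u] L1_abs[OF v] unfolding L1norm_def L1_def by (rule set_integral_add(2))
  finally show ?thesis .
qed

lemma L1norm_triangle_diff:
  assumes u: "L1 E u" and v: "L1 E v"
  shows "L1norm E (\<lambda>x. u x - v x) \<le> L1norm E u + L1norm E v"
  using L1norm_triangle[OF u L1_cmult[OF v, of "-1"]] L1norm_cmult[of E "-1" v] by simp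

lemma L1norm_eq_0_AE:
  assumes u: "L1 E u" and "L1norm E u = 0"
  shows "AE x in lebesgue. x \<in> E \<longrightarrow> u x = 0"
proof -
  have int: "integrable lebesgue (\<lambda>x. indicator E x *\<^sub>R \<bar>u x\<bar>)"
    using L1_abs[OF u] by (simp add: L1_def set_integrable_def)
  have "AE x in lebesgue. indicator E x *\<^sub>R \<bar>u x\<bar> = 0"
    using assms(2) integral_nonneg_eq_0_iff_AE[OF int]
    by (auto simp: L1norm_def set_lebesgue_integral_def)
  then show ?thesis by eventually_elim (auto simp: indicator_def)
qed

text \<open>Schur's test for \<open>L\<^sup>1\<close>: Tonelli's theorem reduces the bound to the column integrals of the kernel.\<close>

theorem L1_kernel:
  fixes k :: "real \<Rightarrow> real \<Rightarrow> real" and C :: real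
  assumes k_meas: "(\<lambda>p. k (fst p) (snd p)) \<in> borel_measurable (borel \<Otimes>\<^sub>M borel)"
    and k_nonneg: "\<And>x y. 0 \<le> k x y" and k_E: "\<And>x y. x \<notin> E \<or> y \<notin> E \<Longrightarrow> k x y = 0"
    and col: "\<And>y. y \<in> E \<Longrightarrow> (\<integral>\<^sup>+x. ennreal (k x y) \<partial>lborel) \<le> ennreal C" and "0 \<le> C"
    and E: "E \<in> sets borel" and v: "L1 E v"
  shows "L1 E (\<lambda>x. LINT y|lebesgue. k x y * v y)"
    and "L1norm E (\<lambda>x. LINT y|lebesgue. k x y * v y) \<le> C * L1norm E v"
proof -
  note [measurable] = E
  have km [measurable]: "(\<lambda>y. k x y) \<in> borel_measurable borel" for x
    using measurable_compose[OF measurable_Pair1', OF _ k_meas, of x] by simp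
  have vi: "integrable lebesgue (\<lambda>y. indicator E y * v y)"
    using v by (simp add: L1_def set_integrable_def)
  then have "(\<lambda>y. indicator E y * v y) \<in> borel_measurable lebesgue" by auto
  \<comment> \<open>Tonelli's theorem is applied on the Borel \<sigma>-algebra, so \<open>v\<close>
    is replaced by a Borel version that vanishes almost everywhere off \<open>E\<close>.\<close>
  then obtain v' where v' [measurable]: "v' \<in> borel_measurable lborel" and ae: "AE y in lborel. indicator E y * v y = v' y"
    using completion_ex_borel_measurable_real by blast
  have ae': "AE y in lebesgue. indicator E y * v y = v' y" using ae by (rule AE_completion)
  have v'l: "v' \<in> borel_measurable lebesgue" using v' by (intro measurable_completion) auto
  have v'int: "integrable lborel v'"
  proof -
    have "integrable lebesgue v'" using integrable_cong_AE_imp[OF vi v'l] ae' by simp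
    then show ?thesis using integrable_completion[of v' lborel] by simp
  qed
  have nv: "(\<integral>\<^sup>+y. ennreal \<bar>v' y\<bar> \<partial>lborel) = ennreal (L1norm E v)"
  proof -
    have "(\<integral>\<^sup>+y. ennreal \<bar>v' y\<bar> \<partial>lborel) = ennreal (LINT y|lborel. \<bar>v' y\<bar>)"
      using v'int by (intro nn_integral_eq_integral) auto
    also have "(LINT y|lborel. \<bar>v' y\<bar>) = (LINT y|lebesgue. \<bar>v' y\<bar>)"
      by (intro integral_completion[symmetric]) auto
    also have "\<dots> = L1norm E v"
      unfolding L1norm_def set_lebesgue_integral_def
    proof (rule integral_cong_AE)
      have "(\<lambda>y. \<bar>indicator E y * v y\<bar>) \<in> borel_measurable lebesgue"
        using vi by measurable
      then show "(\<lambda>y. indicator E y *\<^sub>R \<bar>v y\<bar>) \<in> borel_measurable lebesgue"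
        by (simp add: abs_mult)
      show "AE y in lebesgue. \<bar>v' y\<bar> = indicator E y *\<^sub>R \<bar>v y\<bar>"
        using ae' by eventually_elim (auto simp: indicator_def split: if_splits)
    qed (use v'l in measurable)
    finally show ?thesis .
  qed
  define r where "r = (\<lambda>x. LINT y|lborel. k x y * v' y)"
  have r_eq: "(LINT y|lebesgue. k x y * v y) = r x" for x
  proof -
    have kE: "k x y * v y = k x y * (indicator E y * v y)" for y
      using k_E[of x y] by (auto simp: indicator_def)
    have kl: "k x \<in> borel_measurable lebesgue" by (intro measurable_completion) simp
    have "(LINT y|lebesgue. k x y * v y) = (LINT y|lebesgue. k x y * v' y)"
    proof (rule integral_cong_AE)
      show "(\<lambda>y. k x y * v y) \<in> borel_measurable lebesgue"
        unfolding kE using kl borel_measurable_integrable[OF vi] by (rule borel_measurable_times)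
      show "(\<lambda>y. k x y * v' y) \<in> borel_measurable lebesgue"
        using kl v'l by (intro borel_measurable_times)
      show "AE y in lebesgue. k x y * v y = k x y * v' y"
        unfolding kE using ae' by eventually_elim simp
    qed
    also have "\<dots> = r x" unfolding r_def by (rule integral_completion) simp
    finally show ?thesis .
  qed
  have rm [measurable]: "r \<in> borel_measurable borel"
  proof -
    have "(\<lambda>p. k (fst p) (snd p) * v' (snd p)) \<in> borel_measurable (borel \<Otimes>\<^sub>M lborel)"
      using k_meas by measurable
    then show ?thesis unfolding r_def
      by (intro lborel.borel_measurable_lebesgue_integral) (simp add: split_beta')
  qed
  have r0: "r x = 0" if "x \<notin> E" for x using that k_E by (simp add: r_def)
  \<comment> \<open>Where the integrand is not integrable, the Bochner integral is 0 by convention,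
    so the bound persists.\<close>
  have le: "ennreal \<bar>r x\<bar> \<le> (\<integral>\<^sup>+y. ennreal (k x y) * ennreal \<bar>v' y\<bar> \<partial>lborel)" for x
  proof (cases "integrable lborel (\<lambda>y. k x y * v' y)")
    case True
    have "ennreal (norm (r x)) \<le> (\<integral>\<^sup>+y. ennreal (norm (k x y * v' y)) \<partial>lborel)"
      unfolding r_def by (rule integral_norm_bound_ennreal[OF True])
    then show ?thesis using k_nonneg by (simp add: abs_mult ennreal_mult)
  qed (simp add: r_def not_integrable_integral_eq)
  have "(\<integral>\<^sup>+x. ennreal \<bar>r x\<bar> \<partial>lborel) \<le> (\<integral>\<^sup>+x. (\<integral>\<^sup>+y. ennreal (k x y) * ennreal \<bar>v' y\<bar> \<partial>lborel) \<partial>lborel)"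
    by (intro nn_integral_mono le)
  also have "\<dots> = (\<integral>\<^sup>+y. (\<integral>\<^sup>+x. ennreal (k x y) * ennreal \<bar>v' y\<bar> \<partial>lborel) \<partial>lborel)"
  proof (rule lborel_pair.Fubini'[symmetric])
    show "(\<lambda>(x, y). ennreal (k x y) * ennreal \<bar>v' y\<bar>) \<in> borel_measurable (lborel \<Otimes>\<^sub>M lborel)"
      using k_meas unfolding split_beta' by measurable
  qed
  also have "\<dots> \<le> (\<integral>\<^sup>+y. ennreal C * ennreal \<bar>v' y\<bar> \<partial>lborel)"
  proof (rule nn_integral_mono)
    fix y
    have [measurable]: "(\<lambda>x. k x y) \<in> borel_measurable borel"
      using measurable_compose[OF measurable_Pair2', OF _ k_meas, of y] by simp
    have "(\<integral>\<^sup>+x. ennreal (k x y) * ennreal \<bar>v' y\<bar> \<partial>lborel) = (\<integral>\<^sup>+x. ennreal (k x y) \<partial>lborel) * ennreal \<bar>v' y\<bar>"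
      by (rule nn_integral_multc) simp
    also have "(\<integral>\<^sup>+x. ennreal (k x y) \<partial>lborel) \<le> ennreal C"
      using col k_E by (cases "y \<in> E") auto
    finally show "(\<integral>\<^sup>+x. ennreal (k x y) * ennreal \<bar>v' y\<bar> \<partial>lborel) \<le> ennreal C * ennreal \<bar>v' y\<bar>"
      by (simp add: mult_right_mono)
  qed
  also have "\<dots> = ennreal C * (\<integral>\<^sup>+y. ennreal \<bar>v' y\<bar> \<partial>lborel)" by (rule nn_integral_cmult) simp
  also have "\<dots> = ennreal (C * L1norm E v)"
    unfolding nv using \<open>0 \<le> C\<close> L1norm_nonneg by (simp add: ennreal_mult)
  finally have bound: "(\<integral>\<^sup>+x. ennreal \<bar>r x\<bar> \<partial>lborel) \<le> ennreal (C * L1norm E v)" .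
  have rint: "integrable lborel r"
    using bound by (intro integrableI_bounded) (auto simp: le_less_trans[OF _ ennreal_less_top])
  have ind: "indicator E x *\<^sub>R r x = r x" for x using r0 by (auto simp: indicator_def)
  show "L1 E (\<lambda>x. LINT y|lebesgue. k x y * v y)"
    unfolding r_eq L1_def set_integrable_def ind using rint integrable_completion[of r lborel] by simp
  have ind': "indicator E x *\<^sub>R \<bar>r x\<bar> = \<bar>r x\<bar>" for x using r0 by (auto simp: indicator_def)
  have "ennreal (LINT x|lborel. \<bar>r x\<bar>) \<le> ennreal (C * L1norm E v)"
    using bound rint by (subst nn_integral_eq_integral[symmetric]) auto
  then have "(LINT x|lborel. \<bar>r x\<bar>) \<le> C * L1norm E v"
    using \<open>0 \<le> C\<close> L1norm_nonneg by (subst (asm) ennreal_le_iff) auto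
  then show "L1norm E (\<lambda>x. LINT y|lebesgue. k x y * v y) \<le> C * L1norm E v"
    unfolding r_eq L1norm_def set_lebesgue_integral_def ind' by (subst integral_completion) auto
qed

text \<open>Scheffe's lemma: \<open>|a - b| \<le> a - b + 2 max 0 (b - a)\<close> pointwise, and the last term is dominated by \<open>b\<close>.\<close>

theorem L1_scheffe:
  assumes u: "\<And>n::nat. L1 E (u n)" and w: "L1 E w"
    and nonneg: "\<And>n x. x \<in> E \<Longrightarrow> 0 \<le> u n x" "\<And>x. x \<in> E \<Longrightarrow> 0 \<le> w x"
    and lim: "AE x in lebesgue. x \<in> E \<longrightarrow> (\<lambda>n. u n x) \<longlonglongrightarrow> w x"
    and le: "\<And>n. L1norm E (u n) \<le> L1norm E w"
  shows "(\<lambda>n. L1norm E (\<lambda>x. u n x - w x)) \<longlonglongrightarrow> 0"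
proof -
  define p where "p = (\<lambda>n x. indicator E x * max 0 (w x - u n x))"
  have dL1: "L1 E (\<lambda>x. max 0 (w x - u n x))" for n
  proof -
    have "max 0 (w x - u n x) = (1/2) * ((w x - u n x) + \<bar>w x - u n x\<bar>)" for x
      by (auto simp: max_def abs_if field_simps)
    then show ?thesis by (simp only:) (intro L1_cmult L1_add L1_abs L1_diff w u)
  qed
  have "(\<lambda>n. LINT x|lebesgue. p n x) \<longlonglongrightarrow> (LINT (x::real)|lebesgue. 0 :: real)"
  proof (rule Bochner_Integration.integral_dominated_convergence[where f = "\<lambda>_. 0" and w = "\<lambda>x. indicator E x * w x"])
    show "p n \<in> borel_measurable lebesgue" for n
      using dL1[of n] by (auto simp: L1_def set_integrable_def p_def)
    show "integrable lebesgue (\<lambda>x. indicator E x * w x)"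
      using w by (simp add: L1_def set_integrable_def)
    show "AE x in lebesgue. (\<lambda>n. p n x) \<longlonglongrightarrow> 0"
      using lim
    proof eventually_elim
      case (elim x)
      show ?case
      proof (cases "x \<in> E")
        case True
        then have "(\<lambda>n. max 0 (w x - u n x)) \<longlonglongrightarrow> max 0 (w x - w x)"
          using elim by (intro tendsto_intros) auto
        then show ?thesis using True by (simp add: p_def)
      qed (simp add: p_def)
    qed
    show "AE x in lebesgue. norm (p n x) \<le> indicator E x * w x" for n
      using nonneg by (intro AE_I2) (auto simp: p_def indicator_def)
  qed simp
  then have "(\<lambda>n. 2 * (LINT x|lebesgue. p n x)) \<longlonglongrightarrow> 2 * 0"
    by (intro tendsto_mult tendsto_const) simp
  then have lim0: "(\<lambda>n. 2 * (LINT x|lebesgue. p n x)) \<longlonglongrightarrow> 0" by simp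
  have "L1norm E (\<lambda>x. u n x - w x) \<le> 2 * (LINT x|lebesgue. p n x)" for n
  proof -
    have "L1norm E (\<lambda>x. u n x - w x) \<le> (LINT x:E|lebesgue. (\<bar>u n x\<bar> - \<bar>w x\<bar>) + 2 * max 0 (w x - u n x))"
      using nonneg by (intro L1norm_mono_AE L1_diff L1_add L1_cmult L1_abs u w dL1 AE_I2) (auto simp: max_def)
    also have "\<dots> = (LINT x:E|lebesgue. \<bar>u n x\<bar> - \<bar>w x\<bar>) + (LINT x:E|lebesgue. 2 * max 0 (w x - u n x))"
      by (rule set_integral_add(2)) (simp_all add: L1_def[symmetric] L1_diff L1_cmult L1_abs u w dL1)
    also have "(LINT x:E|lebesgue. \<bar>u n x\<bar> - \<bar>w x\<bar>) = L1norm E (u n) - L1norm E w"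
      unfolding L1norm_def by (rule set_integral_diff(2)) (simp_all add: L1_def[symmetric] L1_abs u w)
    also have "(LINT x:E|lebesgue. 2 * max 0 (w x - u n x)) = 2 * (LINT x|lebesgue. p n x)"
      unfolding set_integral_mult_right by (simp add: set_lebesgue_integral_def p_def)
    \<comment> \<open>By \<open>le\<close> the difference of the norms is at most 0, which leaves
      only the dominated term.\<close>
    finally show ?thesis using le[of n] by simp
  qed
  then show ?thesis
    by (intro tendsto_sandwich[OF _ _ tendsto_const lim0]) (auto intro!: always_eventually L1norm_nonneg)
qed

text \<open>The measure is a parameter because the fact serves twice: for Lebesgue measure with the
  exponential weights, and for \<open>lborel\<close> with the factor \<open>1 / g\<close> in the
  integrand of \<open>Q\<close>.\<close>

lemma set_integrable_mult_continuous_bounded: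
  fixes h v :: "real \<Rightarrow> real"
  assumes M: "(\<lambda>x. x) \<in> M \<rightarrow>\<^sub>M borel"
    and v: "set_integrable M A v" and A: "A \<in> sets borel" and h: "continuous_on A h"
    and B: "\<And>x. x \<in> A \<Longrightarrow> \<bar>h x\<bar> \<le> B"
  shows "set_integrable M A (\<lambda>x. h x * v x)"
  unfolding set_integrable_def
proof (rule Bochner_Integration.integrable_bound)
  have vi: "integrable M (\<lambda>x. indicator A x *\<^sub>R v x)"
    using v by (simp add: set_integrable_def)
  then show "integrable M (\<lambda>x. B * (indicator A x *\<^sub>R v x))" by simp
  have "(\<lambda>x. indicator A x *\<^sub>R h x) \<in> borel_measurable M"
    by (rule measurable_compose[OF M borel_measurable_continuous_on_indicator[OF A h]])
  then have "(\<lambda>x. (indicator A x *\<^sub>R h x) * (indicator A x *\<^sub>R v x)) \<in> borel_measurable M"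
    using borel_measurable_integrable[OF vi] by (rule borel_measurable_times)
  then show "(\<lambda>x. indicator A x *\<^sub>R (h x * v x)) \<in> borel_measurable M"
    by (rule back_subst[of "\<lambda>f. f \<in> borel_measurable M"]) (auto simp: indicator_def)
  show "AE x in M. norm (indicator A x *\<^sub>R (h x * v x)) \<le> norm (B * (indicator A x *\<^sub>R v x))"
  proof (intro AE_I2)
    fix x
    have "\<bar>h x\<bar> * \<bar>v x\<bar> \<le> \<bar>B\<bar> * \<bar>v x\<bar>" if "x \<in> A"
      using B[OF that] by (intro mult_right_mono) auto
    then show "norm (indicator A x *\<^sub>R (h x * v x)) \<le> norm (B * (indicator A x *\<^sub>R v x))"
      by (auto simp: indicator_def abs_mult)
  qed
qed

lemma L1_mult_continuous_bounded:
  fixes h v :: "real \<Rightarrow> real"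
  assumes "L1 A v" "A \<in> sets borel" "continuous_on A h" "\<And>x. x \<in> A \<Longrightarrow> \<bar>h x\<bar> \<le> B"
  shows "L1 A (\<lambda>x. h x * v x)"
proof -
  have "(\<lambda>x::real. x) \<in> lebesgue \<rightarrow>\<^sub>M borel" by (intro measurable_completion) simp
  then show ?thesis using assms unfolding L1_def by (rule set_integrable_mult_continuous_bounded)
qed

lemma L1_subset:
  assumes "L1 S v" "T \<subseteq> S" "T \<in> sets borel"
  shows "L1 T v"
  using assms unfolding L1_def by (intro set_integrable_subset[of lebesgue S v T]) auto

section \<open>The flow and the transport semigroup\<close>

lemma Eint_open: "open (Eint d0 d1)"
proof -
  have "Eint d0 d1 = ereal -` {d0<..<d1}" by (auto simp: Eint_def)
  then show ?thesis using open_ereal_vimage[of "{d0<..<d1}"] by simp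
qed

lemma Eint_interval: "{a..b} \<subseteq> Eint d0 d1" if "a \<in> Eint d0 d1" "b \<in> Eint d0 d1"
proof
  fix z assume "z \<in> {a..b}"
  then have "d0 < ereal a" "ereal a \<le> ereal z" "ereal z \<le> ereal b" "ereal b < d1"
    using that by (auto simp: Eint_def)
  then have "d0 < ereal z" "ereal z < d1" by (blast intro: less_le_trans le_less_trans)+
  then show "z \<in> Eint d0 d1" by (simp add: Eint_def)
qed

text \<open>\<open>G\<close> and \<open>Q\<close> enter through their derivative and their
  increments, so that one development covers both \<open>\<phi> = 0\<close>, \<open>Q = 0\<close>
  and the general case. \<open>G_up\<close> encodes the divergence of \<open>G\<close> at
  \<open>d0\<close>: every value above an attained one is attained, that is, the flow can be
  followed forward for all times.\<close>

locale transport =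
  fixes d0 d1 :: ereal and E :: "real set" and g \<phi> G Q :: "real \<Rightarrow> real"
  assumes E_eq: "E = Eint d0 d1" and E_ne: "E \<noteq> {}"
    and g_cont: "continuous_on E g" and g_neg: "\<And>x. x \<in> E \<Longrightarrow> g x < 0"
    and phi_nonneg: "\<And>x. x \<in> E \<Longrightarrow> 0 \<le> \<phi> x" and phi_meas: "\<phi> \<in> borel_measurable borel"
    and G_deriv: "\<And>x. x \<in> E \<Longrightarrow> (G has_real_derivative 1 / g x) (at x)"
    and G_up: "\<And>x s. x \<in> E \<Longrightarrow> G x \<le> s \<Longrightarrow> s \<in> G ` E"
    and Q_int: "\<And>a b. {a..b} \<subseteq> E \<Longrightarrow> (\<lambda>x. \<phi> x / g x) absolutely_integrable_on {a..b}"
    and Q_diff: "\<And>x y. x \<le> y \<Longrightarrow> {x..y} \<subseteq> E \<Longrightarrow> Q y - Q x = integral {x..y} (\<lambda>z. \<phi> z / g z)"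
begin

lemma E_open: "open E"
  unfolding E_eq by (rule Eint_open)

lemma E_borel [measurable]: "E \<in> sets borel" using E_open by simp

lemma E_interval: "{x..y} \<subseteq> E" if "x \<in> E" "y \<in> E"
  using Eint_interval that unfolding E_eq .

lemma E_between: "z \<in> E" if "x \<in> E" "y \<in> E" "x \<le> z" "z \<le> y"
  using E_interval[OF that(1,2)] that(3,4) by auto

lemma tail_eq: "{y. x < y \<and> ereal y < d1} = {y\<in>E. x < y}" if "x \<in> E" for x
proof -
  have "y \<in> E" if "x < y" "ereal y < d1" for y
  proof -
    have "d0 < ereal x" using \<open>x \<in> E\<close> by (simp add: E_eq Eint_def)
    also have "ereal x < ereal y" using that by simp
    finally show ?thesis using that by (simp add: E_eq Eint_def)
  qed
  then show ?thesis by (auto simp: E_eq Eint_def)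
qed

lemma eventually_upper_end: "\<forall>\<^sub>F x in upper_end d1. x \<in> E \<and> c \<le> x" if "c \<in> E"
proof -
  have c: "d0 < ereal c" "ereal c < d1" using that by (auto simp: E_eq Eint_def)
  have in_E: "x \<in> E" if "c \<le> x" "ereal x < d1" for x
  proof -
    have "d0 < ereal x" using c(1) that(1) by (auto intro: less_le_trans)
    then show ?thesis using that(2) by (simp add: E_eq Eint_def)
  qed
  show ?thesis
  proof (cases "d1 = \<infinity>")
    case True
    have "\<forall>\<^sub>F x in at_top. x \<in> E \<and> c \<le> x"
      using eventually_ge_at_top[of c] by eventually_elim (use in_E True in auto)
    then show ?thesis using True by (simp add: upper_end_def)
  next
    case False
    then obtain r where r: "d1 = ereal r" using c(2) by (cases d1) auto
    then have "c < r" using c(2) by simp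
    then have "\<forall>\<^sub>F x in at_left r. x \<in> E \<and> c \<le> x"
      using in_E r by (auto simp: eventually_at_left[of c r] intro!: exI[of _ c])
    then show ?thesis using r by (simp add: upper_end_def)
  qed
qed

lemma upper_end_nontrivial: "upper_end d1 \<noteq> bot"
  by (simp add: upper_end_def)

lemma d0_less_d1: "d0 < d1"
proof -
  obtain e where "e \<in> E" using E_ne by auto
  then show ?thesis unfolding E_eq Eint_def by (auto intro: less_trans)
qed

lemma upper_sequence: "\<exists>b :: nat \<Rightarrow> real. (\<forall>n. b n \<in> E) \<and> incseq b \<and> (\<forall>x\<in>E. \<exists>n. x < b n)"
proof -
  obtain b where b: "incseq b" "\<And>i. d0 < ereal (b i)" "\<And>i. ereal (b i) < d1" "(\<lambda>i. ereal (b i)) \<longlonglongrightarrow> d1"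
    using ereal_incseq_approx[OF d0_less_d1] by blast
  have "\<exists>n. x < b n" if "x \<in> E" for x
  proof -
    have "ereal x < d1" using that by (auto simp: E_eq Eint_def)
    from order_tendstoD(1)[OF b(4) this] show ?thesis by (auto simp: eventually_sequentially)
  qed
  then show ?thesis using b by (intro exI[of _ b]) (auto simp: E_eq Eint_def)
qed

lemma lower_sequence: "\<exists>a :: nat \<Rightarrow> real. (\<forall>n. a n \<in> E) \<and> decseq a \<and> (\<forall>x\<in>E. \<exists>n. a n < x)"
proof -
  obtain a where a: "decseq a" "\<And>i. d0 < ereal (a i)" "\<And>i. ereal (a i) < d1" "(\<lambda>i. ereal (a i)) \<longlonglongrightarrow> d0"
    using ereal_decseq_approx[OF d0_less_d1] by blast
  have "\<exists>n. a n < x" if "x \<in> E" for x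
  proof -
    have "d0 < ereal x" using that by (auto simp: E_eq Eint_def)
    from order_tendstoD(2)[OF a(4) this] show ?thesis by (auto simp: eventually_sequentially)
  qed
  then show ?thesis using a by (intro exI[of _ a]) (auto simp: E_eq Eint_def)
qed

section \<open>The time function G and the exponential weights\<close>

lemma G_less: "G y < G x" if "x \<in> E" "y \<in> E" "x < y"
proof (rule DERIV_neg_imp_decreasing[OF that(3)])
  fix z assume z: "x \<le> z" "z \<le> y"
  have "z \<in> E" by (rule E_between[OF that(1,2) z])
  then show "\<exists>D. (G has_real_derivative D) (at z) \<and> D < 0"
    using G_deriv[of z] g_neg[of z] by (intro exI[of _ "1 / g z"]) auto
qed

lemma G_le_iff: "G y \<le> G x \<longleftrightarrow> x \<le> y" if "x \<in> E" "y \<in> E"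
  using G_less[OF that] G_less[OF that(2,1)] by (cases x y rule: linorder_cases) auto

lemma G_eq_iff: "G y = G x \<longleftrightarrow> x = y" if "x \<in> E" "y \<in> E"
  using G_less[OF that] G_less[OF that(2,1)] by (cases x y rule: linorder_cases) auto

lemma G_inj: "inj_on G E" by (rule inj_onI) (simp add: G_eq_iff)

lemma G_cont: "continuous_on E G"
  using G_deriv by (meson DERIV_continuous_on has_field_derivative_at_within)

text \<open>This is Q_\<lambda>. Admitting \<open>lam = 0\<close> lets the same estimates serve the
  semigroup (weight \<open>Q\<close>) and the resolvent.\<close>

definition W :: "real \<Rightarrow> real \<Rightarrow> real" where "W lam x = lam * G x + Q x"

lemma W_0: "W 0 = Q" by (simp add: W_def fun_eq_iff)

lemma g_recip_cont: "continuous_on E (\<lambda>x. 1 / g x)"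
  using g_cont g_neg by (intro continuous_intros) force+

lemma W_int: "(\<lambda>x. (lam + \<phi> x) / g x) absolutely_integrable_on {a..b}" if ab: "{a..b} \<subseteq> E"
proof -
  have "(\<lambda>x. lam * (1 / g x)) absolutely_integrable_on {a..b}"
    using ab by (intro absolutely_integrable_continuous_real continuous_intros continuous_on_subset[OF g_recip_cont])
  from set_integral_add(1)[OF this Q_int[OF ab]] show ?thesis by (simp add: add_divide_distrib)
qed

lemma G_diff: "G y - G x = integral {x..y} (\<lambda>z. 1 / g z)" "(\<lambda>z. 1 / g z) integrable_on {x..y}"
  if "x \<le> y" "{x..y} \<subseteq> E"
proof -
  have "((\<lambda>z. 1 / g z) has_integral (G y - G x)) {x..y}"
  proof (rule fundamental_theorem_of_calculus[OF that(1)])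
    fix z assume "z \<in> {x..y}"
    then have "z \<in> E" using that(2) by blast
    then show "(G has_vector_derivative 1 / g z) (at z within {x..y})"
      using has_field_derivative_at_within[OF G_deriv] by (simp add: has_real_derivative_iff_has_vector_derivative)
  qed
  then show "G y - G x = integral {x..y} (\<lambda>z. 1 / g z)" "(\<lambda>z. 1 / g z) integrable_on {x..y}"
    by (auto simp: integral_unique has_integral_integrable)
qed

lemma W_diff: "W lam y - W lam x = integral {x..y} (\<lambda>z. (lam + \<phi> z) / g z)" if "x \<le> y" "{x..y} \<subseteq> E"
proof -
  have "integral {x..y} (\<lambda>z. lam * (1 / g z) + \<phi> z / g z)
      = integral {x..y} (\<lambda>z. lam * (1 / g z)) + integral {x..y} (\<lambda>z. \<phi> z / g z)"
    using G_diff(2)[OF that] Q_int[OF that(2)]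
    by (intro Henstock_Kurzweil_Integration.integral_add integrable_on_mult_right)
       (auto simp: absolutely_integrable_on_def)
  also have "integral {x..y} (\<lambda>z. lam * (1 / g z)) = lam * (G y - G x)"
    unfolding G_diff(1)[OF that] by (rule integral_mult_right)
  finally show ?thesis using Q_diff[OF that]
    by (simp add: W_def add_divide_distrib algebra_simps)
qed

lemma W_abs_cont: "abs_cont_on {a..b} (W lam)" if ab: "{a..b} \<subseteq> E"
proof (rule abs_cont_on_indefinite_integral[OF W_int[OF ab, of lam]])
  show "W lam y - W lam x = integral {x..y} (\<lambda>z. (lam + \<phi> z) / g z)" if "a \<le> x" "x \<le> y" "y \<le> b" for x y
    using ab that by (intro W_diff) auto
qed

lemma W_deriv: "AE x in lebesgue. x \<in> E \<longrightarrow> (W lam has_real_derivative (lam + \<phi> x) / g x) (at x)"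
  using W_int W_diff
  by (intro AE_has_derivative_indefinite_integral[OF E_open]) (auto simp: absolutely_integrable_on_def)

lemma W_antimono: "W lam y \<le> W lam x" if "0 \<le> lam" "x \<in> E" "y \<in> E" "x \<le> y"
proof -
  have xy: "{x..y} \<subseteq> E" using E_interval that by auto
  have "integral {x..y} (\<lambda>z. (lam + \<phi> z) / g z) \<le> integral {x..y} (\<lambda>z. 0)"
  proof (rule integral_le)
    show "(\<lambda>z. (lam + \<phi> z) / g z) integrable_on {x..y}" using W_int[OF xy] by (simp add: absolutely_integrable_on_def)
    show "(lam + \<phi> z) / g z \<le> 0" if "z \<in> {x..y}" for z
    proof -
      have "z \<in> E" using xy that by auto
      then show ?thesis using phi_nonneg[of z] g_neg[of z] \<open>0 \<le> lam\<close> by (simp add: divide_le_0_iff)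
    qed
  qed auto
  then show ?thesis using W_diff[OF that(4) xy, of lam] by simp
qed

lemma continuous_on_E_I:
  fixes h :: "real \<Rightarrow> real"
  assumes "\<And>a b. {a..b} \<subseteq> E \<Longrightarrow> continuous_on {a..b} h"
  shows "continuous_on E h"
proof (rule continuous_at_imp_continuous_on, rule ballI)
  fix x assume "x \<in> E"
  then obtain e where e: "e > 0" "cball x e \<subseteq> E" using E_open open_contains_cball by blast
  then have "continuous_on {x - e..x + e} h"
    by (intro assms) (auto simp: cball_eq_atLeastAtMost)
  moreover have "x \<in> interior {x - e..x + e}" using e by simp
  ultimately show "isCont h x" using continuous_on_interior by blast
qed

lemma W_cont: "continuous_on E (W lam)"
  by (intro continuous_on_E_I abs_cont_on_imp_continuous_on W_abs_cont)

lemma Q_cont: "continuous_on E Q" and Q_antimono: "x \<in> E \<Longrightarrow> y \<in> E \<Longrightarrow> x \<le> y \<Longrightarrow> Q y \<le> Q x"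
  using W_cont[of 0] W_antimono[of 0 x y] by (auto simp: W_0)

section \<open>Weighted tail integrals\<close>

text \<open>The primitive of \<open>- exp (W lam) * v\<close> that is normalised at
  \<open>d1\<close>. Divided by \<open>|g|\<close> and \<open>exp (W lam)\<close> it gives the
  resolvent for \<open>lam > 0\<close> and the formal potential of the semigroup for
  \<open>lam = 0\<close>.\<close>

definition K :: "real \<Rightarrow> (real \<Rightarrow> real) \<Rightarrow> real \<Rightarrow> real" where
  "K lam v x = (LINT y:{y\<in>E. x < y}|lebesgue. exp (W lam y) * v y)"

lemma tail_borel: "{y\<in>E. x < y} \<in> sets borel"
proof -
  have "{y\<in>E. x < y} = E \<inter> {x<..}" by auto
  then show ?thesis by simp
qed

text \<open>The weight is nonincreasing, so on the tail it is bounded by its value at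
  \<open>x\<close>; near \<open>d0\<close> it may be unbounded, which is why only tails are
  integrated.\<close>

lemma K_integrable:
  assumes v: "L1 E v" and "0 \<le> lam" and "x \<in> E"
  shows "L1 {y\<in>E. x < y} (\<lambda>y. exp (W lam y) * v y)"
proof (rule L1_mult_continuous_bounded)
  show "L1 {y\<in>E. x < y} v" using v tail_borel by (rule_tac L1_subset) auto
  show "continuous_on {y\<in>E. x < y} (\<lambda>y. exp (W lam y))"
    by (intro continuous_intros continuous_on_subset[OF W_cont]) auto
  show "\<bar>exp (W lam y)\<bar> \<le> exp (W lam x)" if "y \<in> {y\<in>E. x < y}" for y
    using W_antimono[of lam x y] that assms by auto
qed (rule tail_borel)

lemma weight_integrable:
  assumes v: "L1 E v" and ab: "{a..b} \<subseteq> E"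
  shows "(\<lambda>y. exp (W lam y) * v y) absolutely_integrable_on {a..b}"
proof -
  have c: "continuous_on {a..b} (\<lambda>y. exp (W lam y))"
    by (intro continuous_intros continuous_on_subset[OF W_cont ab])
  then have "bounded ((\<lambda>y. exp (W lam y)) ` {a..b})"
    by (intro compact_imp_bounded compact_continuous_image) auto
  then obtain B where "\<forall>y\<in>{a..b}. \<bar>exp (W lam y)\<bar> \<le> B" unfolding bounded_iff by (auto simp: image_iff)
  then have "\<And>y. y \<in> {a..b} \<Longrightarrow> \<bar>exp (W lam y)\<bar> \<le> B" by blast
  moreover have "L1 {a..b} v" using L1_subset[OF v ab] by simp
  ultimately have "L1 {a..b} (\<lambda>y. exp (W lam y) * v y)"
    using c by (intro L1_mult_continuous_bounded) auto
  then show ?thesis by (simp add: L1_def)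
qed

lemma K_diff:
  assumes v: "L1 E v" and lam: "0 \<le> lam" and xy: "x \<le> y" "{x..y} \<subseteq> E"
  shows "K lam v x - K lam v y = integral {x..y} (\<lambda>z. exp (W lam z) * v z)"
proof -
  let ?f = "\<lambda>z. exp (W lam z) * v z"
  have E: "x \<in> E" "y \<in> E" using xy by auto
  have hK: "(?f has_integral K lam v z) {u\<in>E. z < u}" if "z \<in> E" for z
    using has_integral_set_lebesgue[OF K_integrable[OF v lam that, unfolded L1_def]] by (simp add: K_def)
  have "(?f has_integral (integral {x..y} ?f + K lam v y)) ({x..y} \<union> {u\<in>E. y < u})"
  proof (rule has_integral_Un)
    show "(?f has_integral integral {x..y} ?f) {x..y}"
      using weight_integrable[OF v xy(2)] by (intro integrable_integral) (auto simp: absolutely_integrable_on_def)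
    have "{x..y} \<inter> {u\<in>E. y < u} = {}" by auto
    then show "negligible ({x..y} \<inter> {u\<in>E. y < u})" by simp
  qed (rule hK[OF E(2)])
  \<comment> \<open>The closed interval contains \<open>x\<close> and the tail does not; this single
    point is a null set.\<close>
  also have "{x..y} \<union> {u\<in>E. y < u} = insert x {u\<in>E. x < u}" using xy E by auto
  finally have "(?f has_integral (integral {x..y} ?f + K lam v y)) {u\<in>E. x < u}"
    by (subst has_integral_spike_set_eq[of _ "insert x {u\<in>E. x < u}"]) (auto intro: negligible_subset[of "{x}"])
  then show ?thesis using has_integral_unique[OF hK[OF E(1)]] by simp
qed

lemma K_subtract:
  assumes "L1 E u" "L1 E v" "0 \<le> lam" "x \<in> E"
  shows "K lam (\<lambda>y. u y - v y) x = K lam u x - K lam v x"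
  using set_integral_diff(2)[OF K_integrable[OF assms(1,3,4), unfolded L1_def] K_integrable[OF assms(2,3,4), unfolded L1_def]]
  by (simp add: K_def right_diff_distrib)

lemma K_abs_cont:
  assumes v: "L1 E v" and lam: "0 \<le> lam" and ab: "{a..b} \<subseteq> E"
  shows "abs_cont_on {a..b} (K lam v)"
proof (rule abs_cont_on_indefinite_integral)
  show "(\<lambda>y. - (exp (W lam y) * v y)) absolutely_integrable_on {a..b}"
    using L1_cmult[of "{a..b}" _ "-1"] weight_integrable[OF v ab] by (simp add: L1_def)
  show "K lam v y - K lam v x = integral {x..y} (\<lambda>y. - (exp (W lam y) * v y))" if "a \<le> x" "x \<le> y" "y \<le> b" for x y
  proof -
    have "{x..y} \<subseteq> E" using that ab by auto
    from K_diff[OF v lam that(2) this] show ?thesis by simp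
  qed
qed

lemma K_deriv:
  assumes v: "L1 E v" and lam: "0 \<le> lam"
  shows "AE x in lebesgue. x \<in> E \<longrightarrow> (K lam v has_real_derivative - (exp (W lam x) * v x)) (at x)"
proof (rule AE_has_derivative_indefinite_integral[OF E_open])
  show "(\<lambda>x. - (exp (W lam x) * v x)) integrable_on {a..b}" if "{a..b} \<subseteq> E" for a b
    using weight_integrable[OF v that] by (auto simp: absolutely_integrable_on_def intro: integrable_neg)
  show "K lam v y - K lam v x = integral {x..y} (\<lambda>y. - (exp (W lam y) * v y))" if "x \<le> y" "{x..y} \<subseteq> E" for x y
    using K_diff[OF v lam that] by auto
qed

text \<open>Dominated convergence works along a sequence tending to \<open>d1\<close>; monotonicity
  of the tail in \<open>x\<close> transfers the limit to the filter.\<close>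

lemma tail_mass_tendsto_0:
  assumes v: "L1 E v"
  shows "((\<lambda>x. LINT y:{y\<in>E. x < y}|lebesgue. \<bar>v y\<bar>) \<longlongrightarrow> 0) (upper_end d1)"
proof (rule tendstoI)
  fix e :: real assume "e > 0"
  obtain b :: "nat \<Rightarrow> real" where b: "\<And>n. b n \<in> E" "incseq b" "\<And>x. x \<in> E \<Longrightarrow> \<exists>n. x < b n"
    using upper_sequence by blast
  have int: "set_integrable lebesgue {y\<in>E. x < y} (\<lambda>y. \<bar>v y\<bar>)" for x
    using L1_subset[OF L1_abs[OF v], of "{y\<in>E. x < y}"] tail_borel by (auto simp: L1_def)
  have "(\<lambda>n. LINT y|lebesgue. indicator {y\<in>E. b n < y} y *\<^sub>R \<bar>v y\<bar>) \<longlonglongrightarrow> (LINT (y::real)|lebesgue. 0 :: real)"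
  proof (rule Bochner_Integration.integral_dominated_convergence[where f = "\<lambda>_. 0" and w = "\<lambda>y. indicator E y *\<^sub>R \<bar>v y\<bar>"])
    show "integrable lebesgue (\<lambda>y. indicator E y *\<^sub>R \<bar>v y\<bar>)"
      using L1_abs[OF v] by (simp add: L1_def set_integrable_def)
    show "(\<lambda>y. indicator {y\<in>E. b n < y} y *\<^sub>R \<bar>v y\<bar>) \<in> borel_measurable lebesgue" for n
      using int[of "b n"] by (auto simp: set_integrable_def)
    show "AE y in lebesgue. (\<lambda>n. indicator {y\<in>E. b n < y} y *\<^sub>R \<bar>v y\<bar>) \<longlonglongrightarrow> 0"
    proof (intro AE_I2 tendsto_eventually)
      fix y
      show "\<forall>\<^sub>F n in sequentially. indicator {y\<in>E. b n < y} y *\<^sub>R \<bar>v y\<bar> = 0"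
      proof (cases "y \<in> E")
        case True
        then obtain m where "y < b m" using b(3) by blast
        then have "y < b n" if "m \<le> n" for n using incseqD[OF b(2) that] by simp
        then show ?thesis by (intro eventually_sequentiallyI[of m]) (force simp: indicator_def)
      qed simp
    qed
    show "AE y in lebesgue. norm (indicator {y\<in>E. b n < y} y *\<^sub>R \<bar>v y\<bar>) \<le> indicator E y *\<^sub>R \<bar>v y\<bar>" for n
      by (intro AE_I2) (auto simp: indicator_def)
  qed simp
  then have "\<forall>\<^sub>F n in sequentially. (LINT y:{y\<in>E. b n < y}|lebesgue. \<bar>v y\<bar>) < e"
    using \<open>e > 0\<close> by (intro order_tendstoD(2)) (auto simp: set_lebesgue_integral_def)
  then obtain n where n: "(LINT y:{y\<in>E. b n < y}|lebesgue. \<bar>v y\<bar>) < e" by (auto simp: eventually_sequentially)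
  show "\<forall>\<^sub>F x in upper_end d1. dist (LINT y:{y\<in>E. x < y}|lebesgue. \<bar>v y\<bar>) 0 < e"
    using eventually_upper_end[OF b(1)[of n]]
  proof eventually_elim
    case (elim x)
    have "(LINT y:{y\<in>E. x < y}|lebesgue. \<bar>v y\<bar>) \<le> (LINT y:{y\<in>E. b n < y}|lebesgue. \<bar>v y\<bar>)"
      unfolding set_lebesgue_integral_def using int[of x] int[of "b n"] elim
      by (intro integral_mono) (auto simp: set_integrable_def indicator_def)
    moreover have "0 \<le> (LINT y:{y\<in>E. x < y}|lebesgue. \<bar>v y\<bar>)"
      unfolding set_lebesgue_integral_def by (intro integral_nonneg_AE) auto
    ultimately show ?case using n by (simp add: dist_real_def)
  qed
qed

text \<open>Inside the integral the weights appear as \<open>exp (W lam y - W lam x)\<close> with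
  \<open>x < y\<close>, which is at most 1.\<close>

lemma K_bound:
  assumes v: "L1 E v" and lam: "0 \<le> lam" and x: "x \<in> E"
  shows "\<bar>exp (- W lam x) * K lam v x\<bar> \<le> (LINT y:{y\<in>E. x < y}|lebesgue. \<bar>v y\<bar>)"
proof -
  have int: "L1 {y\<in>E. x < y} (\<lambda>y. \<bar>v y\<bar>)" using L1_subset[OF L1_abs[OF v] _ tail_borel] by auto
  have "\<bar>K lam v x\<bar> \<le> (LINT y:{y\<in>E. x < y}|lebesgue. \<bar>exp (W lam y) * v y\<bar>)"
    unfolding K_def using set_integral_norm_bound[OF K_integrable[OF v lam x, unfolded L1_def]] by simp
  also have "\<dots> \<le> (LINT y:{y\<in>E. x < y}|lebesgue. exp (W lam x) * \<bar>v y\<bar>)"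
  proof (rule set_integral_mono)
    show "set_integrable lebesgue {y\<in>E. x < y} (\<lambda>y. \<bar>exp (W lam y) * v y\<bar>)"
      using L1_abs[OF K_integrable[OF v lam x]] by (simp add: L1_def)
    show "set_integrable lebesgue {y\<in>E. x < y} (\<lambda>y. exp (W lam x) * \<bar>v y\<bar>)"
      using L1_cmult[OF int] by (simp add: L1_def)
    show "\<bar>exp (W lam y) * v y\<bar> \<le> exp (W lam x) * \<bar>v y\<bar>" if "y \<in> {y\<in>E. x < y}" for y
      using W_antimono[OF lam x, of y] that by (auto simp: abs_mult intro!: mult_right_mono)
  qed
  also have "\<dots> = exp (W lam x) * (LINT y:{y\<in>E. x < y}|lebesgue. \<bar>v y\<bar>)" by (rule set_integral_mult_right)
  finally show ?thesis by (simp add: abs_mult exp_minus field_simps)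
qed

text \<open>The factor \<open>exp (- W lam x)\<close> may blow up at \<open>d1\<close>, so the
  product has to be bounded as a whole. The limit gives the boundary condition for the resolvent and
  fixes the constant of integration for solutions of A u = w.\<close>

lemma K_tendsto_0:
  assumes v: "L1 E v" and lam: "0 \<le> lam"
  shows "((\<lambda>x. exp (- W lam x) * K lam v x) \<longlongrightarrow> 0) (upper_end d1)"
proof -
  obtain c where "c \<in> E" using E_ne by auto
  have "\<forall>\<^sub>F x in upper_end d1. \<bar>exp (- W lam x) * K lam v x\<bar> \<le> (LINT y:{y\<in>E. x < y}|lebesgue. \<bar>v y\<bar>)"
    using eventually_upper_end[OF \<open>c \<in> E\<close>] by eventually_elim (use K_bound[OF v lam] in auto)
  then have "((\<lambda>x. \<bar>exp (- W lam x) * K lam v x\<bar>) \<longlongrightarrow> 0) (upper_end d1)"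
    by (intro tendsto_sandwich[OF _ _ tendsto_const tail_mass_tendsto_0[OF v]]) auto
  then show ?thesis by (rule tendsto_rabs_zero_cancel)
qed


section \<open>The semigroup along characteristics\<close>

abbreviation S :: "real \<Rightarrow> (real \<Rightarrow> real) \<Rightarrow> real \<Rightarrow> real" where
  "S \<equiv> Ssg E g G Q"

definition H :: "real \<Rightarrow> real" where "H = inv_into E G"

lemma H_in: "H s \<in> E" and G_H: "G (H s) = s" if "s \<in> G ` E"
  using that by (auto simp: H_def inv_into_into f_inv_into_f)

lemma H_G: "H (G x) = x" if "x \<in> E"
  using that G_inj by (simp add: H_def)

lemma H_deriv: "(H has_real_derivative g x) (at (G x))" if "x \<in> E"
proof -
  have "(H has_derivative (*) (g x)) (at (G x))"
  proof (rule has_derivative_inverse_strong[OF E_open that G_cont H_G])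
    show "(G has_derivative (*) (1 / g x)) (at x)"
      using G_deriv[OF that] by (simp add: has_field_derivative_def)
    show "(*) (1 / g x) \<circ> (*) (g x) = id" using g_neg[OF that] by (auto simp: fun_eq_iff)
  qed
  then show ?thesis by (simp add: has_field_derivative_def)
qed

lemma right_neighbour: "\<exists>z\<in>E. x < z" if "x \<in> E"
  using upper_sequence that by blast

text \<open>A point to the right of \<open>x\<close> gives a smaller value of \<open>G\<close>, and
  everything above that value is attained.\<close>

lemma open_G_image: "open (G ` E)"
proof (subst open_subopen, intro ballI)
  fix s assume "s \<in> G ` E"
  then obtain x where x: "x \<in> E" "s = G x" by auto
  then obtain z where z: "z \<in> E" "x < z" using right_neighbour by blast
  then have "G z < s" using G_less x by auto
  then have "ball s (s - G z) \<subseteq> G ` E"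
    using G_up[OF z(1)] by (auto simp: ball_def dist_real_def)
  then show "\<exists>T. open T \<and> s \<in> T \<and> T \<subseteq> G ` E" using \<open>G z < s\<close> by (intro exI[of _ "ball s (s - G z)"]) auto
qed

text \<open>Replaces the definite description in the flow by any \<open>y\<close> satisfying its
  equation; injectivity of \<open>G\<close> makes it the right one.\<close>

lemma S_flow: "S t u x = exp (Q y - Q x) * (u y * g y / g x)" if "y \<in> E" "G y = G x - t"
proof -
  have "flow E G (- t) x = y"
    unfolding flow_def
  proof (rule the_equality)
    show "z = y" if "z \<in> E \<and> G z = G x + - t" for z
      using G_eq_iff[of y z] that \<open>y \<in> E\<close> \<open>G y = G x - t\<close> by simp
  qed (use that in simp)
  moreover have "flow_in E G (- t) x"
    unfolding flow_in_def using that by (intro image_eqI[of _ _ y]) auto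
  ultimately show ?thesis by (simp add: Ssg_def P0_def)
qed

lemma S_no_flow: "S t u x = 0" if "G x - t \<notin> G ` E"
  using that by (simp add: Ssg_def flow_in_def)

lemma S_linear: "S t (\<lambda>y. a * u y + b * v y) x = a * S t u x + b * S t v x"
  by (simp add: Ssg_def P0_def add_divide_distrib algebra_simps)

lemma S_diff: "S t (\<lambda>y. u y - v y) x = S t u x - S t v x"
  using S_linear[of t 1 u "-1" v x] by simp

lemma S_zero: "S 0 u x = u x" if "x \<in> E"
  using S_flow[of x x 0 u] g_neg[OF that] that by simp

text \<open>The weights telescope along the characteristic. The identity is pointwise and holds for
  arbitrary \<open>u\<close>, hence also for potentials outside L1.\<close>

lemma S_semigroup: "S (t + s) u x = S t (S s u) x" if "0 \<le> s" "x \<in> E"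
proof (cases "G x - t \<in> G ` E")
  case True
  then obtain y where y: "y \<in> E" "G y = G x - t" by auto
  show ?thesis
  proof (cases "G y - s \<in> G ` E")
    case True
    then obtain z where z: "z \<in> E" "G z = G y - s" by auto
    have "S (t + s) u x = exp (Q z - Q x) * (u z * g z / g x)"
      using y z by (intro S_flow) auto
    also have "Q z - Q x = (Q y - Q x) + (Q z - Q y)" by simp
    finally have "S (t + s) u x = exp (Q y - Q x) * exp (Q z - Q y) * (u z * g z / g x)"
      unfolding exp_add .
    then show ?thesis
      using S_flow[OF y, of "S s u"] S_flow[OF z, of u] g_neg[OF y(1)] by simp
  next
    case False
    then have "G x - (t + s) \<notin> G ` E" using y(2) by (simp add: algebra_simps)
    then show ?thesis using S_no_flow[OF False, of u] S_flow[OF y, of "S s u"] S_no_flow by simp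
  qed
next
  case False
  \<comment> \<open>If the characteristic could be followed back for the longer time
    \<open>t + s\<close>, it could also be followed back for \<open>t\<close>, by
    \<open>G_up\<close>.\<close>
  have "G x - (t + s) \<notin> G ` E"
  proof
    assume "G x - (t + s) \<in> G ` E"
    then obtain z where "z \<in> E" "G z = G x - (t + s)" by auto
    then show False using False G_up[of z "G x - t"] \<open>0 \<le> s\<close> by simp
  qed
  then show ?thesis using False S_no_flow by simp
qed

lemma S_cong: "S t u x = S t v x" if "\<And>y. y \<in> E \<Longrightarrow> u y = v y"
proof (cases "G x - t \<in> G ` E")
  case True
  then obtain y where y: "y \<in> E" "G y = G x - t" by auto
  then show ?thesis using S_flow[OF y] that by simp
qed (simp add: S_no_flow)

text \<open>Substitution of the backward flow \<open>p\<close>, a bijection from \<open>D\<close>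
  onto \<open>E\<close>. Its Jacobian \<open>g (p x) / g x\<close> is exactly the factor in
  \<open>P0\<close>, so transport alone preserves the norm, and the exponential factor is at most 1
  because \<open>p\<close> moves points to the right and \<open>Q\<close> is nonincreasing.\<close>

theorem S_contraction:
  assumes u: "L1 E u" and t: "0 \<le> t"
  shows "L1 E (S t u)" and "L1norm E (S t u) \<le> L1norm E u"
proof -
  define D where "D = E \<inter> (\<lambda>x. G x - t) -` (G ` E)"
  define p where "p = (\<lambda>x. H (G x - t))"
  have "open D" unfolding D_def
    by (intro continuous_open_preimage continuous_intros G_cont E_open open_G_image)
  then have Db: "D \<in> sets borel" "D \<in> sets lebesgue" by auto
  have DE: "D \<subseteq> E" by (auto simp: D_def)
  have p: "p x \<in> E" "G (p x) = G x - t" if "x \<in> D" for x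
    using that H_in[of "G x - t"] G_H[of "G x - t"] by (auto simp: D_def p_def)
  define p' where "p' = (\<lambda>x. g (p x) / g x)"
  have der: "(p has_real_derivative p' x) (at x)" if "x \<in> D" for x
  proof -
    have "(H has_real_derivative g (p x)) (at (G x - t))"
      using H_deriv[OF p(1)[OF that]] p(2)[OF that] by simp
    moreover have "((\<lambda>x. G x - t) has_real_derivative 1 / g x) (at x)"
      using G_deriv[of x] DE that by (auto intro!: derivative_eq_intros)
    ultimately have "((\<lambda>x. H (G x - t)) has_real_derivative g (p x) * (1 / g x)) (at x)"
      by (rule DERIV_chain2)
    then show ?thesis by (simp add: p_def p'_def)
  qed
  have p'pos: "p' x > 0" if "x \<in> D" for x
    using g_neg[of x] g_neg[OF p(1)[OF that]] DE that by (auto simp: p'_def divide_neg_neg)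
  have inj: "inj_on p D"
  proof (rule inj_onI)
    fix x y assume xy: "x \<in> D" "y \<in> D" "p x = p y"
    then have "G x = G y" using p(2)[OF xy(1)] p(2)[OF xy(2)] by simp
    then show "x = y" using G_eq_iff[of x y] DE xy by auto
  qed
  have img: "p ` D = E"
  proof
    show "p ` D \<subseteq> E" using p by auto
    \<comment> \<open>Here the behaviour of \<open>G\<close> at \<open>d0\<close> is used: following
      \<open>y\<close> forward for time \<open>t\<close> stays in \<open>E\<close>.\<close>
    show "E \<subseteq> p ` D"
    proof
      fix y assume y: "y \<in> E"
      then obtain x where x: "x \<in> E" "G x = G y + t" using G_up[OF y, of "G y + t"] t by auto
      then have "x \<in> D" "p x = y" using y H_G[OF y] by (auto simp: D_def p_def)
      then show "y \<in> p ` D" by auto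
    qed
  qed
  have cov: "(\<lambda>x. \<bar>p' x\<bar> * f (p x)) absolutely_integrable_on D \<and> integral D (\<lambda>x. \<bar>p' x\<bar> * f (p x)) = b
     \<longleftrightarrow> f absolutely_integrable_on E \<and> integral E f = b" for f :: "real \<Rightarrow> real" and b
    using has_absolute_integral_change_of_variables_1'[OF Db(2) _ inj, of p' f b] der
    unfolding img by (auto intro: has_field_derivative_at_within)
  let ?U = "\<lambda>x. \<bar>p' x\<bar> * u (p x)"
  have U: "L1 D ?U" using cov[of u "integral E u"] u by (simp add: L1_def)
  have contp: "continuous_on D p"
    using der by (intro continuous_at_imp_continuous_on ballI) (auto intro: DERIV_isCont)
  have le1: "\<bar>exp (Q (p x) - Q x)\<bar> \<le> 1" if "x \<in> D" for x
  proof -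
    have "G (p x) \<le> G x" using p(2)[OF that] t by simp
    then have "x \<le> p x" using G_le_iff[of x "p x"] p(1)[OF that] DE that by auto
    then show ?thesis using Q_antimono[of x "p x"] p(1)[OF that] DE that by auto
  qed
  have V: "L1 D (\<lambda>x. exp (Q (p x) - Q x) * ?U x)"
  proof (rule L1_mult_continuous_bounded[OF U Db(1) _ le1])
    show "continuous_on D (\<lambda>x. exp (Q (p x) - Q x))"
      using p(1) DE
      by (intro continuous_intros continuous_on_compose2[OF Q_cont contp] continuous_on_subset[OF Q_cont]) auto
  qed
  have S_D: "S t u x = exp (Q (p x) - Q x) * ?U x" if "x \<in> D" for x
  proof -
    have "?U x = u (p x) * g (p x) / g x" using abs_of_pos[OF p'pos[OF that]] by (simp add: p'_def)
    then show ?thesis using S_flow[OF p[OF that], of u] by simp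
  qed
  have S_0: "S t u x = 0" if "x \<in> E - D" for x
    using that by (intro S_no_flow) (auto simp: D_def)
  have ind: "indicator E x *\<^sub>R S t u x = indicator D x *\<^sub>R (exp (Q (p x) - Q x) * ?U x)" for x
    using S_D[of x] S_0[of x] DE by (auto simp: indicator_def)
  show "L1 E (S t u)"
    using V unfolding L1_def set_integrable_def ind .
  have ind': "indicator E x *\<^sub>R \<bar>S t u x\<bar> = indicator D x *\<^sub>R \<bar>exp (Q (p x) - Q x) * ?U x\<bar>" for x
    using S_D[of x] S_0[of x] DE by (auto simp: indicator_def)
  have "L1norm E (S t u) = L1norm D (\<lambda>x. exp (Q (p x) - Q x) * ?U x)"
    unfolding L1norm_def set_lebesgue_integral_def ind' ..
  also have "\<dots> \<le> (LINT x:D|lebesgue. \<bar>p' x\<bar> * \<bar>u (p x)\<bar>)"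
  proof (rule L1norm_mono_AE[OF V])
    show "L1 D (\<lambda>x. \<bar>p' x\<bar> * \<bar>u (p x)\<bar>)" using L1_abs[OF U] by (simp add: abs_mult)
    show "AE x in lebesgue. x \<in> D \<longrightarrow> \<bar>exp (Q (p x) - Q x) * ?U x\<bar> \<le> \<bar>p' x\<bar> * \<bar>u (p x)\<bar>"
    proof (intro AE_I2 impI)
      fix x assume "x \<in> D"
      have "\<bar>exp (Q (p x) - Q x) * ?U x\<bar> = \<bar>exp (Q (p x) - Q x)\<bar> * (\<bar>p' x\<bar> * \<bar>u (p x)\<bar>)"
        by (simp add: abs_mult)
      also have "\<dots> \<le> 1 * (\<bar>p' x\<bar> * \<bar>u (p x)\<bar>)"
        by (rule mult_right_mono[OF le1[OF \<open>x \<in> D\<close>]]) simp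
      finally show "\<bar>exp (Q (p x) - Q x) * ?U x\<bar> \<le> \<bar>p' x\<bar> * \<bar>u (p x)\<bar>" by simp
    qed
  qed
  also have "\<dots> = L1norm E u"
  proof -
    have au: "(\<lambda>x. \<bar>u x\<bar>) absolutely_integrable_on E" using L1_abs[OF u] by (simp add: L1_def)
    have "(\<lambda>x. \<bar>p' x\<bar> * \<bar>u (p x)\<bar>) absolutely_integrable_on D"
      "integral D (\<lambda>x. \<bar>p' x\<bar> * \<bar>u (p x)\<bar>) = integral E (\<lambda>x. \<bar>u x\<bar>)"
      using cov[of "\<lambda>x. \<bar>u x\<bar>" "integral E (\<lambda>x. \<bar>u x\<bar>)"] au by auto
    then show ?thesis
      unfolding L1norm_def using au by (simp add: set_lebesgue_integral_eq_integral)
  qed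
  finally show "L1norm E (S t u) \<le> L1norm E u" .
qed

text \<open>Contractivity applied to \<open>u - v\<close> avoids tracing null sets along the
  flow.\<close>

lemma S_cong_AE:
  assumes u: "L1 E u" and t: "0 \<le> t" and ae: "AE x in lebesgue. x \<in> E \<longrightarrow> u x = v x"
  shows "AE x in lebesgue. x \<in> E \<longrightarrow> S t u x = S t v x"
proof -
  have v: "L1 E v" by (rule L1_cong_AE[OF u ae])
  have "AE x in lebesgue. x \<in> E \<longrightarrow> u x - v x = 0" using ae by eventually_elim auto
  then have "L1norm E (\<lambda>x. u x - v x) = L1norm E (\<lambda>x. 0)"
    by (rule L1norm_cong_AE[OF L1_diff[OF u v]])
  then have "L1norm E (\<lambda>x. u x - v x) = 0" by (simp add: L1norm_def set_lebesgue_integral_def)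
  then have "L1norm E (S t (\<lambda>x. u x - v x)) = 0"
    using S_contraction(2)[OF L1_diff[OF u v] t] L1norm_nonneg[of E "S t (\<lambda>x. u x - v x)"] by linarith
  then have "AE x in lebesgue. x \<in> E \<longrightarrow> S t (\<lambda>x. u x - v x) x = 0"
    by (rule L1norm_eq_0_AE[OF S_contraction(1)[OF L1_diff[OF u v] t]])
  then show ?thesis unfolding S_diff by eventually_elim auto
qed


section \<open>Integral kernels\<close>

definition kern :: "real set \<Rightarrow> (real \<Rightarrow> real) \<Rightarrow> real \<Rightarrow> real \<Rightarrow> real \<Rightarrow> real" where
  "kern T c lam x y = (if x \<in> E \<and> y \<in> E \<and> x < y \<and> G x - G y \<in> T
     then c x * exp (W lam y - W lam x) / \<bar>g x\<bar> else 0)"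

lemma restricted_borel:
  fixes h :: "real \<Rightarrow> real"
  assumes "continuous_on E h"
  shows "(\<lambda>x. if x \<in> E then h x else 0) \<in> borel_measurable borel"
proof -
  have "(\<lambda>x. indicator E x *\<^sub>R h x) = (\<lambda>x. if x \<in> E then h x else 0)" by (auto simp: indicator_def)
  then show ?thesis using borel_measurable_continuous_on_indicator[OF E_borel assms] by simp
qed

lemma kern_measurable:
  assumes T [measurable]: "T \<in> sets borel" and c [measurable]: "c \<in> borel_measurable borel"
  shows "(\<lambda>p. kern T c lam (fst p) (snd p)) \<in> borel_measurable (borel \<Otimes>\<^sub>M borel)"
proof -
  \<comment> \<open>Continuity is known only on \<open>E\<close>; the extensions by 0 are Borel on
    the whole line and agree with the originals wherever the kernel is not 0.\<close>
  define G' where "G' = (\<lambda>x. if x \<in> E then G x else 0)"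
  define W' where "W' = (\<lambda>x. if x \<in> E then W lam x else 0)"
  define g' where "g' = (\<lambda>x. if x \<in> E then g x else 0)"
  have [measurable]: "G' \<in> borel_measurable borel" "W' \<in> borel_measurable borel" "g' \<in> borel_measurable borel"
    unfolding G'_def W'_def g'_def by (intro restricted_borel G_cont W_cont g_cont)+
  have "kern T c lam x y = (if x \<in> E \<and> y \<in> E \<and> x < y \<and> G' x - G' y \<in> T
     then c x * exp (W' y - W' x) / \<bar>g' x\<bar> else 0)" for x y
    by (auto simp: kern_def G'_def W'_def g'_def)
  then show ?thesis by (simp only:) measurable
qed

lemma kern_nonneg: "0 \<le> kern T c lam x y" if "\<And>x. x \<in> E \<Longrightarrow> 0 \<le> c x"
  using that by (auto simp: kern_def)

lemma kern_outside: "kern T c lam x y = 0" if "x \<notin> E \<or> y \<notin> E"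
  using that by (auto simp: kern_def)

lemma kern_integral:
  assumes "x \<in> E"
  shows "(LINT y|lebesgue. kern T c lam x y * v y)
    = c x * exp (- W lam x) / \<bar>g x\<bar> * (LINT y:{y\<in>E. x < y \<and> G x - G y \<in> T}|lebesgue. exp (W lam y) * v y)"
proof -
  have "kern T c lam x y * v y
      = c x * exp (- W lam x) / \<bar>g x\<bar> * (indicator {y\<in>E. x < y \<and> G x - G y \<in> T} y *\<^sub>R (exp (W lam y) * v y))" for y
    using assms by (auto simp: kern_def indicator_def exp_diff exp_minus field_simps)
  then show ?thesis unfolding set_lebesgue_integral_def by (simp only: integral_mult_right_zero)
qed

text \<open>Without the damping factor, which is at most 1, the column is the integral of
  \<open>1 / |g|\<close> over the points reached from \<open>y\<close> within time \<open>t\<close>.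
  That integral is the elapsed time; \<open>a\<close> is the point reached at time
  \<open>t\<close>.\<close>

lemma flow_kernel_column:
  assumes y: "y \<in> E" and t: "0 \<le> t"
  shows "(\<integral>\<^sup>+x. ennreal (kern {..t} (\<lambda>_. 1) 0 x y) \<partial>lborel) \<le> ennreal t"
proof -
  obtain a where a: "a \<in> E" "G a = G y + t" using G_up[OF y, of "G y + t"] t by auto
  then have "a \<le> y" using G_le_iff[OF a(1) y] t by simp
  have ay: "{a..y} \<subseteq> E" by (rule E_interval[OF a(1) y])
  have "((\<lambda>x. - (1 / g x)) has_integral - (G y - G a)) {a..y}"
    using G_diff[OF \<open>a \<le> y\<close> ay] by (intro has_integral_neg) (metis integrable_integral)
  then have hi: "((\<lambda>x. - (1 / g x)) has_integral t) {a..y}" using a by simp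
  have "(\<integral>\<^sup>+x. ennreal (kern {..t} (\<lambda>_. 1) 0 x y) \<partial>lborel) \<le> (\<integral>\<^sup>+x. ennreal (indicator {a..y} x * - (1 / g x)) \<partial>lborel)"
  proof (intro nn_integral_mono ennreal_leI)
    fix x
    show "kern {..t} (\<lambda>_. 1) 0 x y \<le> indicator {a..y} x * - (1 / g x)"
    proof (cases "x \<in> E \<and> x < y \<and> G x - G y \<le> t")
      case True
      then have "x \<in> {a..y}" using G_le_iff[of a x] a by auto
      moreover have "exp (Q y - Q x) \<le> 1" using Q_antimono[of x y] True y by simp
      ultimately show ?thesis using True y g_neg[of x] by (simp add: kern_def W_0 divide_simps)
    next
      case False
      have "0 \<le> - (1 / g x)" if "x \<in> {a..y}" using g_neg[of x] ay that by (auto simp: divide_simps)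
      then show ?thesis using False by (auto simp: kern_def indicator_def)
    qed
  qed
  also have "\<dots> = ennreal t"
  proof (rule nn_integral_has_integral_lebesgue[OF _ hi])
    show "0 \<le> - (1 / g x)" if "x \<in> {a..y}" for x using g_neg[of x] ay that by (auto simp: divide_simps)
  qed
  finally show ?thesis .
qed

lemma W_reflect_abs_cont: "abs_cont_on {a..b} (\<lambda>x. c - W lam x)" if ab: "{a..b} \<subseteq> E"
  by (rule abs_cont_on_dominated[OF W_abs_cont[OF ab, of lam] W_abs_cont[OF ab, of lam], of 1])
     (auto simp: abs_if)

text \<open>The integrand is the a.e. derivative in \<open>x\<close> of
  \<open>exp (W lam y - W lam x)\<close>. As this holds only almost everywhere, absolute continuity
  is what justifies the integration.\<close>

lemma weight_primitive:
  assumes ay: "a \<in> E" "y \<in> E" "a \<le> y"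
  shows "((\<lambda>x. (lam + \<phi> x) * exp (W lam y - W lam x) / \<bar>g x\<bar>) has_integral (1 - exp (W lam y - W lam a))) {a..y}"
proof -
  have sub: "{a..y} \<subseteq> E" by (rule E_interval[OF ay(1,2)])
  have c: "abs_cont_on {a..y} (\<lambda>x. W lam y - W lam x)" by (rule W_reflect_abs_cont[OF sub])
  have ae: "AE x in lebesgue. x \<in> {a..y} \<longrightarrow>
     ((\<lambda>x. exp (W lam y - W lam x)) has_real_derivative (lam + \<phi> x) * exp (W lam y - W lam x) / \<bar>g x\<bar>) (at x)"
    using W_deriv[of lam]
  proof eventually_elim
    case (elim x)
    show ?case
    proof
      assume "x \<in> {a..y}"
      then have xE: "x \<in> E" using sub by auto
      have "((\<lambda>x. exp (W lam y - W lam x)) has_real_derivative exp (W lam y - W lam x) * (0 - (lam + \<phi> x) / g x)) (at x)"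
        using elim xE by (intro DERIV_fun_exp DERIV_diff DERIV_const) auto
      moreover have "exp (W lam y - W lam x) * (0 - (lam + \<phi> x) / g x) = (lam + \<phi> x) * exp (W lam y - W lam x) / \<bar>g x\<bar>"
        using g_neg[OF xE] by (simp add: field_simps)
      ultimately show "((\<lambda>x. exp (W lam y - W lam x)) has_real_derivative (lam + \<phi> x) * exp (W lam y - W lam x) / \<bar>g x\<bar>) (at x)"
        by simp
    qed
  qed
  show ?thesis using abs_cont_on_FTC[OF abs_cont_on_exp[OF c] ay(3) ae] by simp
qed

text \<open>The factor \<open>lam + \<phi>\<close> makes the column an exact derivative. Exhausting
  \<open>E\<close> towards \<open>d0\<close>, each truncated column is at most
  \<open>1 - exp (W lam y - W lam (a n))\<close>, and monotone convergence keeps the bound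
  1.\<close>

lemma resolvent_kernel_column:
  assumes y: "y \<in> E" and lam: "0 \<le> lam"
  shows "(\<integral>\<^sup>+x. ennreal (kern UNIV (\<lambda>x. lam + \<phi> x) lam x y) \<partial>lborel) \<le> 1"
proof -
  obtain a :: "nat \<Rightarrow> real" where a: "\<And>n. a n \<in> E" "decseq a" "\<And>x. x \<in> E \<Longrightarrow> \<exists>n. a n < x"
    using lower_sequence by blast
  let ?k = "\<lambda>x. kern UNIV (\<lambda>x. lam + \<phi> x) lam x y"
  have k0: "0 \<le> ?k x" for x using phi_nonneg lam by (intro kern_nonneg) auto
  have km: "?k \<in> borel_measurable borel"
    using measurable_compose[OF measurable_Pair2' kern_measurable[of UNIV "\<lambda>x. lam + \<phi> x" lam], of y] phi_meas by simp
  define f where "f = (\<lambda>n x. ennreal (indicator {a n..} x * ?k x))"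
  have "incseq f"
    unfolding incseq_def le_fun_def f_def
  proof (intro allI impI ennreal_leI mult_right_mono k0)
    fix m n :: nat and x :: real assume "m \<le> n"
    then have "a n \<le> a m" using a(2) by (simp add: decseq_def)
    then show "indicator {a m..} x \<le> (indicator {a n..} x :: real)" by (auto simp: indicator_def)
  qed
  have "(\<integral>\<^sup>+x. ennreal (?k x) \<partial>lborel) \<le> (\<integral>\<^sup>+x. (SUP n. f n x) \<partial>lborel)"
  proof (rule nn_integral_mono)
    fix x
    show "ennreal (?k x) \<le> (SUP n. f n x)"
    proof (cases "x \<in> E")
      case True
      then obtain n where "a n < x" using a(3) by blast
      then have "ennreal (?k x) = f n x" by (simp add: f_def)
      then show ?thesis by (metis SUP_upper UNIV_I)
    qed (simp add: kern_outside)
  qed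
  also have "\<dots> = (SUP n. \<integral>\<^sup>+x. f n x \<partial>lborel)"
    using \<open>incseq f\<close> km unfolding f_def by (intro nn_integral_monotone_convergence_SUP) auto
  also have "\<dots> \<le> 1"
  proof (rule SUP_least)
    fix n
    show "(\<integral>\<^sup>+x. f n x \<partial>lborel) \<le> 1"
    proof (cases "a n \<le> y")
      case True
      let ?h = "\<lambda>x. (lam + \<phi> x) * exp (W lam y - W lam x) / \<bar>g x\<bar>"
      have h0: "0 \<le> ?h x" if "x \<in> {a n..y}" for x
        using E_interval[OF a(1)[of n] y] that phi_nonneg[of x] lam by auto
      have "(\<integral>\<^sup>+x. f n x \<partial>lborel) \<le> (\<integral>\<^sup>+x. ennreal (indicator {a n..y} x * ?h x) \<partial>lborel)"
        using h0 unfolding f_def by (intro nn_integral_mono ennreal_leI) (auto simp: kern_def indicator_def)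
      also have "\<dots> = ennreal (1 - exp (W lam y - W lam (a n)))"
        by (rule nn_integral_has_integral_lebesgue[OF h0 weight_primitive[OF a(1) y True]])
      also have "\<dots> \<le> ennreal 1" by (rule ennreal_leI) simp
      finally show ?thesis by simp
    next
      case False
      then have "f n x = 0" for x by (auto simp: f_def kern_def indicator_def)
      then show ?thesis by simp
    qed
  qed
  finally show ?thesis .
qed

section \<open>Difference quotients of the semigroup\<close>

definition kap :: "(real \<Rightarrow> real) \<Rightarrow> real \<Rightarrow> real" where
  "kap w x = exp (- Q x) / \<bar>g x\<bar> * K 0 w x"

text \<open>Formally \<^term>\<open>kap w\<close> is \<open>\<integral>\<^sub>0\<^sup>\<infinity> S(s) w ds\<close>, so that \<open>Dq t w = \<integral>\<^sub>0\<^sup>t S(s) w ds\<close>;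
  \<^term>\<open>kap w\<close> itself need not be integrable.\<close>

definition Dq :: "real \<Rightarrow> (real \<Rightarrow> real) \<Rightarrow> real \<Rightarrow> real" where
  "Dq t w x = kap w x - S t (kap w) x"

text \<open>Along a characteristic the weights and the factors \<open>g\<close> cancel, so S(t) only
  moves the lower limit of the tail integral from \<open>x\<close> to \<open>y\<close>.\<close>

lemma S_kap:
  assumes "x \<in> E" "y \<in> E" "G y = G x - t"
  shows "S t (kap w) x = exp (- Q x) / \<bar>g x\<bar> * K 0 w y"
proof -
  have "S t (kap w) x = exp (Q y - Q x) * (kap w y * g y / g x)" by (rule S_flow[OF assms(2,3)])
  also have "kap w y * g y / g x = exp (- Q y) / \<bar>g x\<bar> * K 0 w y"
    using g_neg[OF assms(1)] g_neg[OF assms(2)] by (simp add: kap_def)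
  also have "exp (Q y - Q x) * (exp (- Q y) / \<bar>g x\<bar> * K 0 w y) = exp (Q y - Q x + - Q y) / \<bar>g x\<bar> * K 0 w y"
    by (simp only: exp_add) simp
  finally show ?thesis by simp
qed

lemma Dq_kernel:
  assumes w: "L1 E w" and t: "0 \<le> t" and x: "x \<in> E"
  shows "Dq t w x = (LINT y|lebesgue. kern {..t} (\<lambda>_. 1) 0 x y * w y)"
proof -
  let ?A = "{y\<in>E. x < y \<and> G x - G y \<in> {..t}}"
  let ?f = "\<lambda>y. exp (W 0 y) * w y"
  have "kap w x - S t (kap w) x = exp (- Q x) / \<bar>g x\<bar> * (LINT y:?A|lebesgue. ?f y)"
  proof (cases "G x - t \<in> G ` E")
    case True
    then obtain z where z: "z \<in> E" "G z = G x - t" by auto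
    have xz: "x \<le> z" using G_le_iff[OF x z(1)] z(2) t by simp
    have A: "?A = {x<..z}"
    proof (intro set_eqI iffI)
      fix y assume "y \<in> ?A"
      then show "y \<in> {x<..z}" using G_le_iff[of y z] z by auto
    next
      fix y assume y: "y \<in> {x<..z}"
      then have "y \<in> E" using E_between[OF x z(1)] by auto
      then show "y \<in> ?A" using y G_le_iff[of y z] z by auto
    qed
    have tail: "{y\<in>E. x < y} = {x<..z} \<union> {y\<in>E. z < y}" using E_between[OF x z(1)] xz by auto
    have "{x<..z} \<subseteq> {y\<in>E. x < y}" using tail by blast
    then have i1: "set_integrable lebesgue {x<..z} ?f"
      using L1_subset[OF K_integrable[OF w order_refl x]] by (simp add: L1_def)
    have i2: "set_integrable lebesgue {y\<in>E. z < y} ?f"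
      using K_integrable[OF w order_refl z(1)] by (simp add: L1_def)
    have "K 0 w x = (LINT y:{x<..z}|lebesgue. ?f y) + K 0 w z"
      unfolding K_def tail by (rule set_integral_Un[OF _ i1 i2]) auto
    then show ?thesis unfolding A S_kap[OF x z] by (simp add: kap_def algebra_simps)
  next
    case False
    \<comment> \<open>If the backward characteristic does not exist up to time \<open>t\<close>, all
      points to the right are within travel time \<open>t\<close>: the translate is 0 and the whole
      tail counts.\<close>
    have "G x - G y \<le> t" if "y \<in> E" for y
    proof (rule ccontr)
      assume "\<not> G x - G y \<le> t"
      then have "G x - t \<in> G ` E" using G_up[OF that, of "G x - t"] by simp
      then show False using False by blast
    qed
    then have "?A = {y\<in>E. x < y}" by auto
    then show ?thesis using S_no_flow[OF False] by (simp add: kap_def K_def)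
  qed
  then show ?thesis unfolding Dq_def kern_integral[OF x] by (simp add: W_0)
qed

lemma Dq_L1: "L1 E (Dq t w)" and Dq_norm: "L1norm E (Dq t w) \<le> t * L1norm E w"
  if w: "L1 E w" and t: "0 \<le> t"
proof -
  have k: "L1 E (\<lambda>x. LINT y|lebesgue. kern {..t} (\<lambda>_. 1) 0 x y * w y)"
    "L1norm E (\<lambda>x. LINT y|lebesgue. kern {..t} (\<lambda>_. 1) 0 x y * w y) \<le> t * L1norm E w"
    using L1_kernel[OF kern_measurable kern_nonneg kern_outside flow_kernel_column t E_borel w] t by auto
  have ae: "AE x in lebesgue. x \<in> E \<longrightarrow> (LINT y|lebesgue. kern {..t} (\<lambda>_. 1) 0 x y * w y) = Dq t w x"
    using Dq_kernel[OF w t] by auto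
  show "L1 E (Dq t w)" by (rule L1_cong_AE[OF k(1) ae])
  show "L1norm E (Dq t w) \<le> t * L1norm E w" using L1norm_cong_AE[OF k(1) ae] k(2) by simp
qed

lemma Dq_nonneg:
  assumes w: "L1 E w" and t: "0 \<le> t" and x: "x \<in> E" and pos: "\<And>y. y \<in> E \<Longrightarrow> 0 \<le> w y"
  shows "0 \<le> Dq t w x"
  unfolding Dq_kernel[OF w t x]
proof (rule integral_nonneg_AE, rule AE_I2)
  show "0 \<le> kern {..t} (\<lambda>_. 1) 0 x y * w y" for y
    using pos[of y] kern_nonneg[of "\<lambda>_. 1"] kern_outside[of x y] by (cases "y \<in> E") auto
qed

lemma Dq_diff:
  assumes "L1 E u" "L1 E v" "x \<in> E"
  shows "Dq t (\<lambda>y. u y - v y) x = Dq t u x - Dq t v x"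
proof -
  have kd: "kap (\<lambda>y. u y - v y) z = kap u z - kap v z" if "z \<in> E" for z
    using K_subtract[OF assms(1,2) order_refl that] by (simp add: kap_def right_diff_distrib)
  have "S t (kap (\<lambda>y. u y - v y)) x = S t (\<lambda>z. kap u z - kap v z) x"
    by (rule S_cong) (rule kd)
  then show ?thesis using kd[OF assms(3)] by (simp add: Dq_def S_diff)
qed

text \<open>For small \<open>t\<close> the quotient is, up to a factor, the difference quotient of
  \<open>K 0 w\<close> along the flow. The flow is differentiable everywhere, so the exceptional set
  is that of \<open>K 0 w\<close> and does not depend on \<open>t\<close>.\<close>

lemma Dq_pointwise:
  assumes w: "L1 E w"
  shows "AE x in lebesgue. x \<in> E \<longrightarrow> ((\<lambda>t. Dq t w x / t) \<longlongrightarrow> w x) (at_right 0)"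
  using K_deriv[OF w order_refl]
proof eventually_elim
  case (elim x)
  show ?case
  proof
    assume x: "x \<in> E"
    have d1: "((\<lambda>t. G x - t) has_real_derivative - 1) (at 0)"
      by (auto intro!: derivative_eq_intros)
    have "((\<lambda>t. H (G x - t)) has_real_derivative g x * - 1) (at 0)"
      by (rule DERIV_chain2[OF _ d1]) (use H_deriv[OF x] in simp)
    then have "((\<lambda>t. K 0 w (H (G x - t))) has_real_derivative - (exp (W 0 x) * w x) * (g x * - 1)) (at 0)"
      by (rule DERIV_chain2[rotated]) (use elim x H_G[OF x] in simp)
    then have "((\<lambda>t. (K 0 w (H (G x - t)) - K 0 w x) / t) \<longlongrightarrow> exp (Q x) * w x * g x) (at 0)"
      by (simp add: DERIV_def H_G[OF x] W_0)
    then have "((\<lambda>t. (K 0 w (H (G x - t)) - K 0 w x) / t) \<longlongrightarrow> exp (Q x) * w x * g x) (at_right 0)"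
      by (rule tendsto_within_subset) simp
    then have "((\<lambda>t. - (exp (- Q x) / \<bar>g x\<bar>) * ((K 0 w (H (G x - t)) - K 0 w x) / t)) \<longlongrightarrow>
        - (exp (- Q x) / \<bar>g x\<bar>) * (exp (Q x) * w x * g x)) (at_right 0)"
      by (intro tendsto_mult tendsto_const)
    moreover have "- (exp (- Q x) / \<bar>g x\<bar>) * (exp (Q x) * w x * g x) = w x"
      using g_neg[OF x] by (simp add: exp_minus field_simps)
    ultimately have lim: "((\<lambda>t. - (exp (- Q x) / \<bar>g x\<bar>) * ((K 0 w (H (G x - t)) - K 0 w x) / t)) \<longlongrightarrow> w x) (at_right 0)"
      by simp
    \<comment> \<open>A point to the right of \<open>x\<close> guarantees that the backward flow
      exists for all sufficiently small \<open>t\<close>.\<close>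
    obtain z where z: "z \<in> E" "x < z" using right_neighbour[OF x] by blast
    have "G x - G z > 0" using G_less[OF x z] by simp
    then have "\<forall>\<^sub>F t in at_right 0. t \<in> {0<..<G x - G z}" by (rule eventually_at_right_real)
    then have "\<forall>\<^sub>F t in at_right 0. - (exp (- Q x) / \<bar>g x\<bar>) * ((K 0 w (H (G x - t)) - K 0 w x) / t) = Dq t w x / t"
    proof eventually_elim
      case (elim t)
      have "G x - t \<in> G ` E" using G_up[OF z(1), of "G x - t"] elim by simp
      from S_kap[OF x H_in[OF this] G_H[OF this]]
      show ?case by (simp add: Dq_def kap_def diff_divide_distrib algebra_simps)
    qed
    then show "((\<lambda>t. Dq t w x / t) \<longlongrightarrow> w x) (at_right 0)" by (rule Lim_transform_eventually[OF lim])
  qed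
qed

text \<open>The bound on the norm of \<open>Dq t w\<close> divided by \<open>t\<close> is precisely
  the comparison of norms that Scheffe's lemma asks for; nonnegativity comes from the
  kernel.\<close>

lemma Dq_L1_limit_nonneg:
  assumes w: "L1 E w" and pos: "\<And>x. x \<in> E \<Longrightarrow> 0 \<le> w x"
  shows "((\<lambda>t. L1norm E (\<lambda>x. Dq t w x / t - w x)) \<longlongrightarrow> 0) (at_right 0)"
proof (rule tendsto_at_right_sequentially[of 0 1])
  fix s :: "nat \<Rightarrow> real" assume s: "\<And>n. 0 < s n" "s \<longlonglongrightarrow> 0"
  then have fl: "filterlim s (at_right 0) sequentially"
    by (auto simp: filterlim_at less_imp_neq[symmetric] intro!: always_eventually)
  show "(\<lambda>n. L1norm E (\<lambda>x. Dq (s n) w x / s n - w x)) \<longlonglongrightarrow> 0"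
  proof (rule L1_scheffe[OF _ w])
    have sn: "0 \<le> s n" for n using s(1)[of n] by simp
    show "L1 E (\<lambda>x. Dq (s n) w x / s n)" for n by (intro L1_cdiv Dq_L1 w sn)
    show "0 \<le> Dq (s n) w x / s n" if "x \<in> E" for n x
      using Dq_nonneg[OF w sn that pos] sn by simp
    show "AE x in lebesgue. x \<in> E \<longrightarrow> (\<lambda>n. Dq (s n) w x / s n) \<longlonglongrightarrow> w x"
      using Dq_pointwise[OF w] by eventually_elim (auto intro: filterlim_compose[OF _ fl])
    show "L1norm E (\<lambda>x. Dq (s n) w x / s n) \<le> L1norm E w" for n
      unfolding L1norm_cdiv using Dq_norm[OF w sn, of n] s(1)[of n] by (simp add: divide_simps mult.commute)
  qed (use pos in auto)
qed simp

text \<open>Scheffe's lemma needs a sign, hence the split into positive and negative parts.\<close>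

lemma Dq_L1_limit:
  assumes w: "L1 E w"
  shows "((\<lambda>t. L1norm E (\<lambda>x. Dq t w x / t - w x)) \<longlongrightarrow> 0) (at_right 0)"
proof -
  define p where "p = (\<lambda>x. (1/2) * (\<bar>w x\<bar> + w x))"
  define n where "n = (\<lambda>x. (1/2) * (\<bar>w x\<bar> - w x))"
  have L: "L1 E p" "L1 E n" unfolding p_def n_def by (intro L1_cmult L1_add L1_diff L1_abs w)+
  have wpn: "w x = p x - n x" for x by (simp add: p_def n_def field_simps)
  have "((\<lambda>t. L1norm E (\<lambda>x. Dq t p x / t - p x) + L1norm E (\<lambda>x. Dq t n x / t - n x)) \<longlongrightarrow> 0 + 0) (at_right 0)"
    by (intro tendsto_add Dq_L1_limit_nonneg L) (auto simp: p_def n_def)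
  then have lim: "((\<lambda>t. L1norm E (\<lambda>x. Dq t p x / t - p x) + L1norm E (\<lambda>x. Dq t n x / t - n x)) \<longlongrightarrow> 0) (at_right 0)"
    by simp
  have le: "\<forall>\<^sub>F t in at_right 0. L1norm E (\<lambda>x. Dq t w x / t - w x)
      \<le> L1norm E (\<lambda>x. Dq t p x / t - p x) + L1norm E (\<lambda>x. Dq t n x / t - n x)"
    using eventually_at_right_less[of 0]
  proof eventually_elim
    case (elim t)
    have P: "L1 E (\<lambda>x. Dq t p x / t - p x)" and N: "L1 E (\<lambda>x. Dq t n x / t - n x)"
      using elim by (intro L1_diff L1_cdiv Dq_L1 L; simp)+
    have eq: "AE x in lebesgue. x \<in> E \<longrightarrow> (Dq t p x / t - p x) - (Dq t n x / t - n x) = Dq t w x / t - w x"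
    proof (intro AE_I2 impI)
      fix x assume "x \<in> E"
      then have "Dq t w x = Dq t p x - Dq t n x"
        using Dq_diff[OF L, of x t] by (simp add: wpn[symmetric])
      then show "(Dq t p x / t - p x) - (Dq t n x / t - n x) = Dq t w x / t - w x"
        by (simp add: wpn diff_divide_distrib)
    qed
    show ?case using L1norm_cong_AE[OF L1_diff[OF P N] eq] L1norm_triangle_diff[OF P N] by simp
  qed
  show ?thesis
    by (rule tendsto_sandwich[OF _ le tendsto_const lim]) (simp add: L1norm_nonneg)
qed

text \<open>Both sides equal \<open>- (I - S s) (I - S t)\<close> applied to \<open>kap w\<close>,
  which is symmetric in \<open>s\<close> and \<open>t\<close>. It trades a small time
  \<open>s\<close> acting on a fixed average for a fixed time acting on an average over a small
  time.\<close>

lemma S_Dq: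
  assumes "0 \<le> s" "0 \<le> t" "x \<in> E"
  shows "S s (Dq t w) x - Dq t w x = S t (Dq s w) x - Dq s w x"
proof -
  have "S s (Dq t w) x = S s (kap w) x - S s (S t (kap w)) x" for s t
    unfolding Dq_def S_diff ..
  then show ?thesis
    using S_semigroup[of t x s "kap w"] S_semigroup[of s x t "kap w"] assms
    by (simp add: Dq_def add.commute)
qed

theorem S_strongly_continuous:
  assumes u: "L1 E u"
  shows "((\<lambda>s. L1norm E (\<lambda>x. S s u x - u x)) \<longlongrightarrow> 0) (at_right 0)"
proof (rule tendstoI)
  fix e :: real assume "e > 0"
  have "\<forall>\<^sub>F t in at_right 0. L1norm E (\<lambda>x. Dq t u x / t - u x) < e / 4 \<and> 0 < t"
    using \<open>e > 0\<close> by (intro eventually_conj order_tendstoD(2)[OF Dq_L1_limit[OF u]] eventually_at_right_less) auto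
  then obtain t where t: "L1norm E (\<lambda>x. Dq t u x / t - u x) < e / 4" "0 < t"
    using eventually_happens'[OF trivial_limit_at_right_real] by blast
  define m where "m = (\<lambda>x. Dq t u x / t)"
  have m: "L1 E m" unfolding m_def using t by (intro L1_cdiv Dq_L1 u) simp
  have d: "L1 E (\<lambda>x. m x - u x)" by (rule L1_diff[OF m u])
  define N where "N = L1norm E u"
  have "N \<ge> 0" by (simp add: N_def L1norm_nonneg)
  \<comment> \<open>For \<open>s < \<delta>\<close> the bound \<open>2 * s * N / t\<close> is at
    most \<open>e / 2\<close>; the summand 1 covers \<open>N = 0\<close>.\<close>
  define \<delta> where "\<delta> = e * t / (4 * (N + 1))"
  have "\<delta> > 0" using \<open>e > 0\<close> t \<open>N \<ge> 0\<close> by (simp add: \<delta>_def)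
  then have "\<forall>\<^sub>F s in at_right 0. s \<in> {0<..<\<delta>}" by (rule eventually_at_right_real)
  then show "\<forall>\<^sub>F s in at_right 0. dist (L1norm E (\<lambda>x. S s u x - u x)) 0 < e"
  proof eventually_elim
    case (elim s)
    then have s: "0 \<le> s" "s < \<delta>" by auto
    have Sm: "L1 E (\<lambda>x. S s m x - m x)" by (intro L1_diff S_contraction m s)
    have SDq: "L1 E (\<lambda>x. S t (Dq s u) x - Dq s u x)"
      using t by (intro L1_diff S_contraction Dq_L1 u s) auto
    have eqm: "AE x in lebesgue. x \<in> E \<longrightarrow> (S t (Dq s u) x - Dq s u x) / t = S s m x - m x"
    proof (intro AE_I2 impI)
      fix x assume x: "x \<in> E"
      have "S s m x = S s (Dq t u) x / t"
        using S_linear[of s "1 / t" "Dq t u" 0 "Dq t u" x] by (simp add: m_def)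
      then show "(S t (Dq s u) x - Dq s u x) / t = S s m x - m x"
        using S_Dq[OF s(1) _ x, of t u] t by (simp add: m_def diff_divide_distrib[symmetric])
    qed
    have "L1norm E (\<lambda>x. S s m x - m x) = L1norm E (\<lambda>x. S t (Dq s u) x - Dq s u x) / t"
      using L1norm_cong_AE[OF L1_cdiv[OF SDq] eqm] t by (simp add: L1norm_cdiv)
    also have "\<dots> \<le> (s * N + s * N) / t"
    proof (rule divide_right_mono)
      have "L1norm E (\<lambda>x. S t (Dq s u) x - Dq s u x) \<le> L1norm E (S t (Dq s u)) + L1norm E (Dq s u)"
        using t by (intro L1norm_triangle_diff S_contraction Dq_L1 u s) auto
      also have "L1norm E (S t (Dq s u)) \<le> L1norm E (Dq s u)"
        using t by (intro S_contraction Dq_L1 u s) auto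
      finally show "L1norm E (\<lambda>x. S t (Dq s u) x - Dq s u x) \<le> s * N + s * N"
        using Dq_norm[OF u s(1)] by (simp add: N_def)
    qed (use t in simp)
    also have "\<dots> \<le> e / 2"
    proof -
      have "s * N \<le> \<delta> * (N + 1)" using s \<open>N \<ge> 0\<close> by (intro mult_mono) auto
      also have "\<dots> = e * t / 4" using \<open>N \<ge> 0\<close> unfolding \<delta>_def by (simp add: divide_simps)
      finally show ?thesis using t by (simp add: field_simps)
    qed
    finally have a: "L1norm E (\<lambda>x. S s m x - m x) \<le> e / 2" .
    have Sd: "L1 E (S s (\<lambda>x. m x - u x))" by (rule S_contraction(1)[OF d s(1)])
    have b: "L1norm E (S s (\<lambda>x. m x - u x)) < e / 4"
      using S_contraction(2)[OF d s(1)] t(1) by (simp add: m_def)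
    \<comment> \<open>The average \<open>m\<close> moves by at most \<open>e / 2\<close>, and each
      of the two replacements of \<open>u\<close> by \<open>m\<close> costs less than
      \<open>e / 4\<close>, one of them by contractivity.\<close>
    have "L1norm E (\<lambda>x. S s u x - u x) = L1norm E (\<lambda>x. ((S s m x - m x) + (m x - u x)) - S s (\<lambda>x. m x - u x) x)"
      by (simp add: S_diff)
    also have "\<dots> \<le> (L1norm E (\<lambda>x. S s m x - m x) + L1norm E (\<lambda>x. m x - u x)) + L1norm E (S s (\<lambda>x. m x - u x))"
      using L1norm_triangle_diff[OF L1_add[OF Sm d] Sd] L1norm_triangle[OF Sm d] by linarith
    also have "\<dots> < e" using a b t(1) by (simp add: m_def)
    finally show ?case using L1norm_nonneg by simp
  qed
qed


section \<open>The resolvent\<close>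

definition R :: "real \<Rightarrow> (real \<Rightarrow> real) \<Rightarrow> real \<Rightarrow> real" where
  "R lam v x = exp (- W lam x) / \<bar>g x\<bar> * K lam v x"

lemma R_kernel:
  assumes "x \<in> E"
  shows "(LINT y|lebesgue. kern UNIV c lam x y * v y) = c x * R lam v x"
  unfolding kern_integral[OF assms] by (simp add: R_def K_def)

lemma R_eq_integral:
  assumes "x \<in> E"
  shows "(LINT y:{y. x < y \<and> ereal y < d1}|lebesgue. 1 / \<bar>g x\<bar> * exp (W lam y - W lam x) * v y) = R lam v x"
proof -
  have "1 / \<bar>g x\<bar> * exp (W lam y - W lam x) * v y = exp (- W lam x) / \<bar>g x\<bar> * (exp (W lam y) * v y)" for y
    by (simp add: exp_diff exp_minus field_simps)
  then show ?thesis unfolding tail_eq[OF assms] R_def K_def by (simp only: set_integral_mult_right)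
qed

text \<open>The kernel with factor \<open>lam + \<phi>\<close> bounds
  \<open>(lam + \<phi>) R\<close>. Since \<open>1 \<le> (lam + \<phi>) / lam\<close>, the plain
  kernel has column bound \<open>1 / lam\<close>; subtraction then gives integrability of
  \<open>\<phi> R\<close>.\<close>

lemma R_L1:
  assumes v: "L1 E v" and lam: "0 < lam"
  shows "L1 E (R lam v)" and "L1 E (\<lambda>x. \<phi> x * R lam v x)"
proof -
  have lam0: "0 \<le> lam" using lam by simp
  have cm: "(\<lambda>x. lam + \<phi> x) \<in> borel_measurable borel" using phi_meas by simp
  let ?k = "kern UNIV (\<lambda>x. lam + \<phi> x) lam"
  have knn: "0 \<le> ?k x y" for x y using phi_nonneg lam0 by (intro kern_nonneg) auto
  have "L1 E (\<lambda>x. LINT y|lebesgue. ?k x y * v y)"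
    using L1_kernel(1)[OF kern_measurable[OF _ cm] knn kern_outside _ _ E_borel v, where C = 1]
      resolvent_kernel_column[OF _ lam0] by simp
  then have 1: "L1 E (\<lambda>x. (lam + \<phi> x) * R lam v x)"
    by (rule L1_cong_AE) (simp add: R_kernel)
  have "L1 E (\<lambda>x. LINT y|lebesgue. kern UNIV (\<lambda>_. 1) lam x y * v y)"
  proof (rule L1_kernel(1)[OF kern_measurable kern_nonneg kern_outside _ _ E_borel v, where C = "1 / lam"])
    fix y assume y: "y \<in> E"
    have km: "(\<lambda>x. ?k x y) \<in> borel_measurable borel"
      using measurable_compose[OF measurable_Pair2' kern_measurable[OF _ cm, of UNIV lam], of y] by simp
    have "(\<integral>\<^sup>+x. ennreal (kern UNIV (\<lambda>_. 1) lam x y) \<partial>lborel) \<le> (\<integral>\<^sup>+x. ennreal (1 / lam) * ennreal (?k x y) \<partial>lborel)"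
    proof (rule nn_integral_mono)
      fix x
      have "kern UNIV (\<lambda>_. 1) lam x y \<le> 1 / lam * ?k x y"
      proof (cases "x \<in> E \<and> x < y")
        case True
        have "1 * (exp (W lam y - W lam x) / \<bar>g x\<bar>) \<le> (lam + \<phi> x) / lam * (exp (W lam y - W lam x) / \<bar>g x\<bar>)"
          using phi_nonneg[of x] True lam by (intro mult_right_mono) (auto simp: divide_simps)
        then show ?thesis using True y by (simp add: kern_def)
      qed (auto simp: kern_def)
      then show "ennreal (kern UNIV (\<lambda>_. 1) lam x y) \<le> ennreal (1 / lam) * ennreal (?k x y)"
        using lam knn by (simp add: ennreal_mult[symmetric] ennreal_leI)
    qed
    also have "\<dots> = ennreal (1 / lam) * (\<integral>\<^sup>+x. ennreal (?k x y) \<partial>lborel)"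
      using km by (intro nn_integral_cmult) simp
    also have "\<dots> \<le> ennreal (1 / lam) * 1"
      by (rule mult_left_mono[OF resolvent_kernel_column[OF y lam0]]) simp
    finally show "(\<integral>\<^sup>+x. ennreal (kern UNIV (\<lambda>_. 1) lam x y) \<partial>lborel) \<le> ennreal (1 / lam)" by simp
  qed (use lam in auto)
  then show 2: "L1 E (R lam v)"
    by (rule L1_cong_AE) (simp add: R_kernel)
  show "L1 E (\<lambda>x. \<phi> x * R lam v x)"
    using L1_diff[OF 1 L1_cmult[OF 2, of lam]] by (simp add: algebra_simps)
qed

text \<open>\<open>g R\<close> equals \<open>- exp (- W lam) * K lam v\<close> on \<open>E\<close>.
  In the product rule the derivative of the weight produces \<open>(lam + \<phi>) R\<close> and the
  derivative of \<open>K\<close> gives back \<open>v\<close>.\<close>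

theorem R_graph:
  assumes v: "L1 E v" and lam: "0 < lam"
  shows "A_graph E d1 g \<phi> (R lam v) (\<lambda>x. lam * R lam v x - v x)"
proof -
  have lam0: "0 \<le> lam" using lam by simp
  note RL = R_L1[OF v lam]
  \<comment> \<open>The value of A0 forced by \<open>lam u - (A0 u - \<phi> u) = v\<close> at
    \<open>u = R lam v\<close>.\<close>
  define w0 where "w0 = (\<lambda>x. (lam * R lam v x - v x) + \<phi> x * R lam v x)"
  have gR: "g x * R lam v x = - (exp (0 - W lam x) * K lam v x)" if "x \<in> E" for x
    using g_neg[OF that] by (simp add: R_def field_simps)
  have "A0_graph E d1 g (R lam v) w0"
    unfolding A0_graph_def
  proof (intro conjI exI[of _ "R lam v"])
    show "L1 E w0" unfolding w0_def by (intro L1_add L1_diff L1_cmult RL v)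
    show "AC_on E (\<lambda>x. g x * R lam v x)"
      unfolding AC_on_def
    proof (intro allI impI)
      fix a b :: real assume ab: "{a..b} \<subseteq> E"
      have "abs_cont_on {a..b} (\<lambda>x. exp (0 - W lam x) * K lam v x)"
        by (intro abs_cont_on_mult abs_cont_on_exp W_reflect_abs_cont K_abs_cont v lam0 ab)
      then have "abs_cont_on {a..b} (\<lambda>x. - (exp (0 - W lam x) * K lam v x))"
        by (rule abs_cont_on_minus)
      then show "abs_cont_on {a..b} (\<lambda>x. g x * R lam v x)"
        using ab by (subst abs_cont_on_cong[OF gR]) auto
    qed
    show "AE x in lebesgue. x \<in> E \<longrightarrow> ((\<lambda>y. g y * R lam v y) has_real_derivative - w0 x) (at x)"
      using K_deriv[OF v lam0] W_deriv[of lam]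
    proof eventually_elim
      case (elim x)
      show ?case
      proof
        assume x: "x \<in> E"
        have "((\<lambda>x. exp (0 - W lam x)) has_real_derivative exp (0 - W lam x) * (0 - (lam + \<phi> x) / g x)) (at x)"
          using elim x by (intro DERIV_fun_exp DERIV_diff DERIV_const) auto
        then have "((\<lambda>x. - (exp (0 - W lam x) * K lam v x)) has_real_derivative
            - (exp (0 - W lam x) * (0 - (lam + \<phi> x) / g x) * K lam v x + - (exp (W lam x) * v x) * exp (0 - W lam x))) (at x)"
          using elim x by (intro DERIV_minus DERIV_mult) auto
        also have "- (exp (0 - W lam x) * (0 - (lam + \<phi> x) / g x) * K lam v x + - (exp (W lam x) * v x) * exp (0 - W lam x)) = - w0 x"
        proof -
          have "- (exp (W lam x) * v x) * exp (0 - W lam x) = - v x" by (simp add: exp_minus)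
          moreover have "exp (0 - W lam x) * (0 - (lam + \<phi> x) / g x) * K lam v x = (lam + \<phi> x) * R lam v x"
            using g_neg[OF x] by (simp add: R_def field_simps)
          ultimately show ?thesis by (simp add: w0_def algebra_simps)
        qed
        finally show "((\<lambda>y. g y * R lam v y) has_real_derivative - w0 x) (at x)"
          by (rule has_field_derivative_transform_within_open[OF _ E_open x]) (simp add: gR)
      qed
    qed
    have lim: "((\<lambda>x. - (exp (- W lam x) * K lam v x)) \<longlongrightarrow> - 0) (upper_end d1)"
      by (intro tendsto_minus K_tendsto_0 v lam0)
    obtain c where c: "c \<in> E" using E_ne by auto
    have "\<forall>\<^sub>F x in upper_end d1. - (exp (- W lam x) * K lam v x) = g x * R lam v x"
      using eventually_upper_end[OF c] by eventually_elim (simp add: gR)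
    then show "((\<lambda>x. g x * R lam v x) \<longlongrightarrow> 0) (upper_end d1)"
      using Lim_transform_eventually[OF lim] by simp
  qed (use RL in auto)
  then show ?thesis
    unfolding A_graph_def using RL by (intro conjI exI[of _ w0]) (auto simp: w0_def)
qed

section \<open>The generator\<close>

lemma A_graph_L1:
  assumes "A_graph E d1 g \<phi> u w"
  shows "L1 E u" and "L1 E w"
proof -
  obtain w0 where w0: "A0_graph E d1 g u w0" "AE x in lebesgue. x \<in> E \<longrightarrow> w x = w0 x - \<phi> x * u x"
    and phu: "L1 E (\<lambda>x. \<phi> x * u x)" using assms unfolding A_graph_def by blast
  then show "L1 E u" unfolding A0_graph_def by blast
  have "L1 E (\<lambda>x. w0 x - \<phi> x * u x)" using w0(1) phu unfolding A0_graph_def by (intro L1_diff) auto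
  then show "L1 E w" by (rule L1_cong_AE) (use w0(2) in \<open>eventually_elim, auto\<close>)
qed

lemma A_graph_cong:
  assumes A: "A_graph E d1 g \<phi> u w"
    and u: "AE x in lebesgue. x \<in> E \<longrightarrow> u x = u' x" and w: "AE x in lebesgue. x \<in> E \<longrightarrow> w x = w' x"
  shows "A_graph E d1 g \<phi> u' w'"
proof -
  obtain w0 where w0: "A0_graph E d1 g u w0" "AE x in lebesgue. x \<in> E \<longrightarrow> w x = w0 x - \<phi> x * u x"
    and phu: "L1 E (\<lambda>x. \<phi> x * u x)" using A unfolding A_graph_def by blast
  obtain v where v: "AE x in lebesgue. x \<in> E \<longrightarrow> v x = u x" "AC_on E (\<lambda>x. g x * v x)"
      "AE x in lebesgue. x \<in> E \<longrightarrow> ((\<lambda>y. g y * v y) has_real_derivative - w0 x) (at x)"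
      "((\<lambda>x. g x * v x) \<longlongrightarrow> 0) (upper_end d1)" and L: "L1 E u" "L1 E w0"
    using w0(1) unfolding A0_graph_def by blast
  have "L1 E (\<lambda>x. \<phi> x * u' x)"
    by (rule L1_cong_AE[OF phu]) (use u in \<open>eventually_elim, auto\<close>)
  moreover have "A0_graph E d1 g u' w0"
    unfolding A0_graph_def
  proof (intro conjI exI[of _ v])
    show "L1 E u'" by (rule L1_cong_AE[OF L(1) u])
    show "AE x in lebesgue. x \<in> E \<longrightarrow> v x = u' x" using v(1) u by eventually_elim auto
  qed (use v L in auto)
  moreover have "AE x in lebesgue. x \<in> E \<longrightarrow> w' x = w0 x - \<phi> x * u' x"
    using w0(2) u w by eventually_elim auto
  ultimately show ?thesis unfolding A_graph_def by blast
qed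

text \<open>On the range of A the potential determines \<open>u\<close>, so \<open>kap w\<close> is
  integrable there, and \<open>S t u - u\<close> becomes \<open>Dq t w\<close> by the very
  definition of \<open>Dq\<close>.\<close>

theorem A_graph_representation:
  assumes A: "A_graph E d1 g \<phi> u w"
  shows "AE x in lebesgue. x \<in> E \<longrightarrow> u x = - kap w x"
proof -
  note L = A_graph_L1[OF A]
  obtain w0 where w0: "A0_graph E d1 g u w0" "AE x in lebesgue. x \<in> E \<longrightarrow> w x = w0 x - \<phi> x * u x"
    using A unfolding A_graph_def by blast
  obtain v where v: "AE x in lebesgue. x \<in> E \<longrightarrow> v x = u x" "AC_on E (\<lambda>x. g x * v x)"
      "AE x in lebesgue. x \<in> E \<longrightarrow> ((\<lambda>y. g y * v y) has_real_derivative - w0 x) (at x)"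
      "((\<lambda>x. g x * v x) \<longlongrightarrow> 0) (upper_end d1)"
    using w0(1) unfolding A0_graph_def by blast
  \<comment> \<open>The integrating factor \<open>exp Q\<close> absorbs the term
    \<open>\<phi> u\<close>, and \<open>K 0 w\<close> has the same a.e. derivative as
    \<open>h\<close>.\<close>
  define h where "h = (\<lambda>x. exp (W 0 x) * (g x * v x))"
  have ae: "AE x in lebesgue. x \<in> E \<longrightarrow> (h has_real_derivative - (exp (W 0 x) * w x)) (at x)"
    using W_deriv[of 0] v(1,3) w0(2)
  proof eventually_elim
    case (elim x)
    show ?case
    proof
      assume x: "x \<in> E"
      have "((\<lambda>x. exp (W 0 x)) has_real_derivative exp (W 0 x) * ((0 + \<phi> x) / g x)) (at x)"
        using elim x by (intro DERIV_fun_exp) auto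
      then have "(h has_real_derivative
          exp (W 0 x) * ((0 + \<phi> x) / g x) * (g x * v x) + - w0 x * exp (W 0 x)) (at x)"
        unfolding h_def using elim x by (intro DERIV_mult) auto
      moreover have "exp (W 0 x) * ((0 + \<phi> x) / g x) * (g x * v x) + - w0 x * exp (W 0 x) = - (exp (W 0 x) * w x)"
      proof -
        have "w0 x = w x + \<phi> x * v x" using elim x by simp
        then show ?thesis using g_neg[OF x] by (simp add: algebra_simps)
      qed
      ultimately show "(h has_real_derivative - (exp (W 0 x) * w x)) (at x)" by simp
    qed
  qed
  have const: "h a - K 0 w a = h b - K 0 w b" if ab: "a \<in> E" "b \<in> E" "a \<le> b" for a b
  proof -
    have sub: "{a..b} \<subseteq> E" by (rule E_interval[OF ab(1,2)])
    have "abs_cont_on {a..b} h"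
      unfolding h_def using v(2) sub
      by (intro abs_cont_on_mult[OF abs_cont_on_exp[OF W_abs_cont]]) (auto simp: AC_on_def)
    then have "((\<lambda>x. - (exp (W 0 x) * w x)) has_integral (h b - h a)) {a..b}"
      using ae sub by (intro abs_cont_on_FTC ab(3)) (auto elim!: eventually_mono)
    then have "integral {a..b} (\<lambda>x. - (exp (W 0 x) * w x)) = h b - h a" by (rule integral_unique)
    then show ?thesis using K_diff[OF L(2) order_refl ab(3) sub] by simp
  qed
  obtain c where c: "c \<in> E" using E_ne by auto
  \<comment> \<open>The constant \<open>h - K 0 w\<close> is evaluated at \<open>d1\<close>. To the
    right of \<open>c\<close> the factor \<open>exp Q\<close> is bounded by its value at
    \<open>c\<close>, so the limits of \<open>g v\<close> and \<open>exp (- Q) * K 0 w\<close>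
    suffice.\<close>
  have lim: "((\<lambda>x. exp (W 0 c) * \<bar>g x * v x - exp (- W 0 x) * K 0 w x\<bar>) \<longlongrightarrow> exp (W 0 c) * \<bar>0 - 0\<bar>) (upper_end d1)"
    by (intro tendsto_intros v(4) K_tendsto_0[OF L(2) order_refl])
  have "\<bar>h c - K 0 w c\<bar> \<le> exp (W 0 c) * \<bar>0 - 0\<bar>"
  proof (rule tendsto_lowerbound[OF lim _ upper_end_nontrivial])
    show "\<forall>\<^sub>F x in upper_end d1. \<bar>h c - K 0 w c\<bar> \<le> exp (W 0 c) * \<bar>g x * v x - exp (- W 0 x) * K 0 w x\<bar>"
      using eventually_upper_end[OF c]
    proof eventually_elim
      case (elim x)
      have "h c - K 0 w c = h x - K 0 w x" using const[OF c, of x] elim by simp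
      also have "\<dots> = exp (W 0 x) * (g x * v x - exp (- W 0 x) * K 0 w x)"
        by (simp add: h_def algebra_simps exp_minus)
      finally have "\<bar>h c - K 0 w c\<bar> = exp (W 0 x) * \<bar>g x * v x - exp (- W 0 x) * K 0 w x\<bar>"
        by (simp add: abs_mult)
      also have "\<dots> \<le> exp (W 0 c) * \<bar>g x * v x - exp (- W 0 x) * K 0 w x\<bar>"
        using W_antimono[OF order_refl c, of x] elim by (intro mult_right_mono) auto
      finally show ?case .
    qed
  qed
  then have hc: "h c = K 0 w c" by simp
  have hx: "h x = K 0 w x" if "x \<in> E" for x
    using const[OF c that] const[OF that c] hc by (cases "c \<le> x") auto
  have vx: "v x = - kap w x" if x: "x \<in> E" for x
  proof -
    have "K 0 w x = exp (Q x) * (g x * v x)" using hx[OF x] by (simp add: h_def W_0)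
    then show ?thesis using g_neg[OF x] by (simp add: kap_def exp_minus field_simps)
  qed
  show ?thesis using v(1) by eventually_elim (auto simp: vx)
qed

theorem A_graph_imp_limit:
  assumes A: "A_graph E d1 g \<phi> u w"
  shows "((\<lambda>t. L1norm E (\<lambda>x. (S t u x - u x) / t - w x)) \<longlongrightarrow> 0) (at_right 0)"
proof -
  note L = A_graph_L1[OF A] and rep = A_graph_representation[OF A]
  have "\<forall>\<^sub>F t in at_right 0. L1norm E (\<lambda>x. Dq t w x / t - w x) = L1norm E (\<lambda>x. (S t u x - u x) / t - w x)"
    using eventually_at_right_less[of 0]
  proof eventually_elim
    case (elim t)
    then have t: "0 \<le> t" by simp
    show ?case
    proof (rule L1norm_cong_AE)
      show "L1 E (\<lambda>x. Dq t w x / t - w x)" by (intro L1_diff L1_cdiv Dq_L1 L t)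
      have neg: "S t (\<lambda>x. - kap w x) x = - S t (kap w) x" for x
        using S_linear[of t "-1" "kap w" 0 "kap w" x] by simp
      show "AE x in lebesgue. x \<in> E \<longrightarrow> Dq t w x / t - w x = (S t u x - u x) / t - w x"
        using S_cong_AE[OF L(1) t rep] rep by eventually_elim (auto simp: neg Dq_def)
    qed
  qed
  then show ?thesis by (rule Lim_transform_eventually[OF Dq_L1_limit[OF L(2)]])
qed

text \<open>Contractivity gives \<open>(1 + lam t) \<parallel>z\<parallel> \<le> \<parallel>z\<parallel> + o(t)\<close>.\<close>

lemma eigenfunction_zero:
  assumes z: "L1 E z" and lam: "0 < lam"
    and lim: "((\<lambda>t. L1norm E (\<lambda>x. (S t z x - z x) / t - lam * z x)) \<longlongrightarrow> 0) (at_right 0)"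
  shows "AE x in lebesgue. x \<in> E \<longrightarrow> z x = 0"
proof -
  have "lam * L1norm E z \<le> 0"
  proof (rule tendsto_lowerbound[OF lim _ trivial_limit_at_right_real])
    show "\<forall>\<^sub>F t in at_right 0. lam * L1norm E z \<le> L1norm E (\<lambda>x. (S t z x - z x) / t - lam * z x)"
      using eventually_at_right_less[of 0]
    proof eventually_elim
      case (elim t)
      then have t: "0 \<le> t" by simp
      let ?d = "\<lambda>x. (S t z x - z x) / t - lam * z x"
      have Sz: "L1 E (S t z)" by (rule S_contraction(1)[OF z t])
      have d: "L1 E ?d" by (intro L1_diff L1_cdiv L1_cmult Sz z)
      have "(1 + lam * t) * L1norm E z = L1norm E (\<lambda>x. (1 + lam * t) * z x)"
        using lam t by (simp add: L1norm_cmult)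
      also have "(\<lambda>x. (1 + lam * t) * z x) = (\<lambda>x. S t z x - t * ?d x)"
        using elim by (auto simp: fun_eq_iff field_simps)
      also have "L1norm E \<dots> \<le> L1norm E (S t z) + L1norm E (\<lambda>x. t * ?d x)"
        by (intro L1norm_triangle_diff Sz L1_cmult d)
      also have "\<dots> \<le> L1norm E z + t * L1norm E ?d"
        using S_contraction(2)[OF z t] t by (simp add: L1norm_cmult)
      finally have "t * (lam * L1norm E z) \<le> t * L1norm E ?d" by (simp add: algebra_simps)
      then show ?case using elim by simp
    qed
  qed
  then have "L1norm E z = 0"
    using lam L1norm_nonneg[of E z] by (simp add: mult_le_0_iff)
  then show ?thesis by (rule L1norm_eq_0_AE[OF z])
qed

text \<open>Phrased with limits instead of graphs so that it covers both the comparison of the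
  generator with A, where one function is known only through its limit, and the uniqueness of the
  resolvent.\<close>

lemma eigenfunction_difference:
  assumes L: "L1 E u" "L1 E r" "L1 E w" "L1 E w'" and lam: "0 < lam"
    and u: "((\<lambda>t. L1norm E (\<lambda>x. (S t u x - u x) / t - w x)) \<longlongrightarrow> 0) (at_right 0)"
    and r: "((\<lambda>t. L1norm E (\<lambda>x. (S t r x - r x) / t - w' x)) \<longlongrightarrow> 0) (at_right 0)"
    and eq: "\<And>x. w x - w' x = lam * (u x - r x)"
  shows "AE x in lebesgue. x \<in> E \<longrightarrow> u x = r x"
proof -
  let ?z = "\<lambda>x. u x - r x"
  have lim: "((\<lambda>t. L1norm E (\<lambda>x. (S t u x - u x) / t - w x) + L1norm E (\<lambda>x. (S t r x - r x) / t - w' x)) \<longlongrightarrow> 0) (at_right 0)"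
    using tendsto_add[OF u r] by simp
  have "((\<lambda>t. L1norm E (\<lambda>x. (S t ?z x - ?z x) / t - lam * ?z x)) \<longlongrightarrow> 0) (at_right 0)"
  proof (rule tendsto_sandwich[OF _ _ tendsto_const lim])
    show "\<forall>\<^sub>F t in at_right 0. L1norm E (\<lambda>x. (S t ?z x - ?z x) / t - lam * ?z x)
        \<le> L1norm E (\<lambda>x. (S t u x - u x) / t - w x) + L1norm E (\<lambda>x. (S t r x - r x) / t - w' x)"
      using eventually_at_right_less[of 0]
    proof eventually_elim
      case (elim t)
      then have t: "0 \<le> t" by simp
      have "(S t ?z x - ?z x) / t - lam * ?z x
          = ((S t u x - u x) / t - w x) - ((S t r x - r x) / t - w' x)" for x
        unfolding S_diff using eq[of x] by (simp add: diff_divide_distrib)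
      then show ?case
        using L1norm_triangle_diff[of E "\<lambda>x. (S t u x - u x) / t - w x" "\<lambda>x. (S t r x - r x) / t - w' x"]
        by (simp add: L L1_diff L1_cdiv S_contraction(1) t)
    qed
  qed (simp add: L1norm_nonneg)
  from eigenfunction_zero[OF L1_diff[OF L(1,2)] lam this]
  show ?thesis by eventually_elim auto
qed

text \<open>\<open>r\<close> lies in the domain of A and solves the same resolvent equation as
  \<open>u\<close>, namely \<open>r - A r = u - w\<close>. Injectivity for the generator identifies
  them; any positive value in place of 1 would serve.\<close>

theorem limit_imp_A_graph:
  assumes u: "L1 E u" and w: "L1 E w"
    and lim: "((\<lambda>t. L1norm E (\<lambda>x. (S t u x - u x) / t - w x)) \<longlongrightarrow> 0) (at_right 0)"
  shows "A_graph E d1 g \<phi> u w"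
proof -
  define r where "r = R 1 (\<lambda>x. u x - w x)"
  have A: "A_graph E d1 g \<phi> r (\<lambda>x. 1 * r x - (u x - w x))"
    unfolding r_def by (rule R_graph[OF L1_diff[OF u w]]) simp
  have ae: "AE x in lebesgue. x \<in> E \<longrightarrow> u x = r x"
    by (rule eigenfunction_difference[OF u A_graph_L1(1)[OF A] w A_graph_L1(2)[OF A] _ lim A_graph_imp_limit[OF A], of 1]) auto
  show ?thesis
    by (rule A_graph_cong[OF A]) (use ae in \<open>eventually_elim, auto\<close>)+
qed

theorem R_unique:
  assumes v: "L1 E v" and lam: "0 < lam" and A: "A_graph E d1 g \<phi> u (\<lambda>x. lam * u x - v x)"
  shows "AE x in lebesgue. x \<in> E \<longrightarrow> u x = R lam v x"
proof -
  note B = R_graph[OF v lam]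
  show ?thesis
    by (rule eigenfunction_difference[OF A_graph_L1(1)[OF A] A_graph_L1(1)[OF B] A_graph_L1(2)[OF A] A_graph_L1(2)[OF B]
          lam A_graph_imp_limit[OF A] A_graph_imp_limit[OF B]]) (simp add: algebra_simps)
qed

theorem S_generator: "is_generator E S (A_graph E d1 g \<phi>)"
  unfolding is_generator_def
proof (intro conjI allI impI)
  fix u assume u: "L1 E u"
  show "L1 E (S t u)" if "0 \<le> t" for t by (rule S_contraction(1)[OF u that])
  show "AE x in lebesgue. x \<in> E \<longrightarrow> S 0 u x = u x" by (simp add: S_zero)
  show "AE x in lebesgue. x \<in> E \<longrightarrow> S (t + s) u x = S t (S s u) x" if "0 \<le> t" "0 \<le> s" for t s
    using that by (simp add: S_semigroup)
  show "AE x in lebesgue. x \<in> E \<longrightarrow> S t (\<lambda>y. a * u y + b * v y) x = a * S t u x + b * S t v x" for t v a b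
    by (simp add: S_linear)
  show "AE x in lebesgue. x \<in> E \<longrightarrow> S t u x = S t v x"
    if "0 \<le> t" "AE x in lebesgue. x \<in> E \<longrightarrow> u x = v x" for t v
    by (rule S_cong_AE[OF u that])
  show "((\<lambda>t. L1norm E (\<lambda>x. S t u x - u x)) \<longlongrightarrow> 0) (at_right 0)"
    by (rule S_strongly_continuous[OF u])
next
  fix u w assume "L1 E u \<and> L1 E w"
  then show "A_graph E d1 g \<phi> u w \<longleftrightarrow>
      ((\<lambda>t. L1norm E (\<lambda>x. (S t u x - u x) / t - w x)) \<longlongrightarrow> 0) (at_right 0)"
    using A_graph_imp_limit limit_imp_A_graph by blast
qed (simp_all add: A_graph_L1)

end

lemma Ssg_zero: "Ssg E g G (\<lambda>_. 0) = P0 E g G"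
  by (auto simp: fun_eq_iff Ssg_def P0_def)

lemma A_graph_zero: "A_graph E d1 g (\<lambda>_. 0) = A0_graph E d1 g"
proof (intro ext iffI)
  fix u w
  assume "A_graph E d1 g (\<lambda>_. 0) u w"
  then obtain w0 where w0: "A0_graph E d1 g u w0" and ae: "AE x in lebesgue. x \<in> E \<longrightarrow> w x = w0 x"
    by (auto simp: A_graph_def)
  then obtain v where v: "L1 E u" "L1 E w0" "AE x in lebesgue. x \<in> E \<longrightarrow> v x = u x" "AC_on E (\<lambda>x. g x * v x)"
      "AE x in lebesgue. x \<in> E \<longrightarrow> ((\<lambda>y. g y * v y) has_real_derivative - w0 x) (at x)"
      "((\<lambda>x. g x * v x) \<longlongrightarrow> 0) (upper_end d1)"
    unfolding A0_graph_def by blast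
  have "L1 E w" by (rule L1_cong_AE[OF v(2)]) (use ae in \<open>eventually_elim, auto\<close>)
  moreover have "AE x in lebesgue. x \<in> E \<longrightarrow> ((\<lambda>y. g y * v y) has_real_derivative - w x) (at x)"
    using v(5) ae by eventually_elim auto
  ultimately show "A0_graph E d1 g u w" unfolding A0_graph_def using v by blast
next
  fix u w
  assume "A0_graph E d1 g u w"
  then show "A_graph E d1 g (\<lambda>_. 0) u w"
    unfolding A_graph_def by (intro conjI exI[of _ w]) (auto simp: L1_def set_integrable_def)
qed

section \<open>The concrete flow\<close>

lemma interval_integral_difference:
  fixes f :: "real \<Rightarrow> real" and c x y :: real
  assumes int: "\<And>a b. {a..b} \<subseteq> E \<Longrightarrow> set_integrable lborel {a..b} f"
    and conv: "\<And>a b. a \<in> E \<Longrightarrow> b \<in> E \<Longrightarrow> {a..b} \<subseteq> E" and E: "c \<in> E" "x \<in> E" "y \<in> E" and "x \<le> y"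
  shows "(LBINT z=c..y. f z) - (LBINT z=c..x. f z) = integral {x..y} f"
proof -
  \<comment> \<open>The base point may lie on either side of \<open>x\<close> and \<open>y\<close>,
    so additivity is justified on the hull of all three points.\<close>
  define a where "a = min c (min x y)"
  define b where "b = max c (max x y)"
  have ab: "a \<in> E" "b \<in> E" "a \<le> b" using E by (auto simp: a_def b_def min_def max_def)
  have mm: "min (ereal c) (min (ereal x) (ereal y)) = ereal a" "max (ereal c) (max (ereal x) (ereal y)) = ereal b"
    by (simp_all add: a_def b_def)
  have "set_integrable lborel {a<..<b} f"
    by (rule set_integrable_subset[OF int[OF conv[OF ab(1,2)]]]) auto
  then have "interval_lebesgue_integrable lborel (ereal a) (ereal b) f"
    using ab(3) by (simp add: interval_lebesgue_integrable_def)
  then have "(LBINT z=c..x. f z) + (LBINT z=x..y. f z) = (LBINT z=c..y. f z)"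
    by (intro interval_integral_sum) (simp only: mm)
  moreover have "(LBINT z=x..y. f z) = integral {x..y} f"
    by (rule interval_integral_eq_integral[OF \<open>x \<le> y\<close> int[OF conv[OF E(2,3)]]])
  ultimately show ?thesis by simp
qed

lemma set_integrable_lborel_imp_lebesgue:
  fixes f :: "real \<Rightarrow> real"
  assumes "set_integrable lborel A f"
  shows "set_integrable lebesgue A f"
  using assms integrable_completion[of "\<lambda>x. indicator A x *\<^sub>R f x" lborel]
  unfolding set_integrable_def by auto

lemma eventually_lower_end: "\<forall>\<^sub>F x in lower_end d0. x \<in> Eint d0 d1 \<and> x \<le> c" if "c \<in> Eint d0 d1"
proof -
  have c: "d0 < ereal c" "ereal c < d1" using that by (auto simp: Eint_def)
  have in_E: "x \<in> Eint d0 d1" if "x \<le> c" "d0 < ereal x" for x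
  proof -
    have "ereal x \<le> ereal c" using that(1) by simp
    then have "ereal x < d1" using c(2) by (rule le_less_trans)
    then show ?thesis using that(2) by (simp add: Eint_def)
  qed
  show ?thesis
  proof (cases "d0 = -\<infinity>")
    case True
    have "\<forall>\<^sub>F x in at_bot. x \<in> Eint d0 d1 \<and> x \<le> c"
      using eventually_le_at_bot[of c] by eventually_elim (use in_E True in auto)
    then show ?thesis using True by (simp add: lower_end_def)
  next
    case False
    then obtain r where r: "d0 = ereal r" using c(1) by (cases d0) auto
    then have "r < c" using c(1) by simp
    then have "\<forall>\<^sub>F x in at_right r. x \<in> Eint d0 d1 \<and> x \<le> c"
      using in_E r by (auto simp: eventually_at_right[of r c] intro!: exI[of _ c])
    then show ?thesis using r by (simp add: lower_end_def)
  qed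
qed

text \<open>\<open>Q\<close> stays abstract so that both instances, \<open>Q = 0\<close> and the
  integral from \<open>x1\<close>, are obtained here. Only \<open>G\<close> has to be
  analysed.\<close>

lemma transport_concrete:
  fixes d0 d1 :: ereal and g \<phi> Q :: "real \<Rightarrow> real" and x0 :: real
  defines "E \<equiv> Eint d0 d1"
  assumes x0: "x0 \<in> E" and g_cont: "continuous_on E g" and g_neg: "\<forall>x\<in>E. g x < 0"
    and G_d0: "filterlim (Gfun g x0) at_top (lower_end d0)"
    and phi: "\<forall>x\<in>E. 0 \<le> \<phi> x" "\<phi> \<in> borel_measurable borel"
    and Q_int: "\<And>a b. {a..b} \<subseteq> E \<Longrightarrow> set_integrable lborel {a..b} (\<lambda>x. \<phi> x / g x)"
    and Q_diff: "\<And>x y. x \<le> y \<Longrightarrow> {x..y} \<subseteq> E \<Longrightarrow> Q y - Q x = integral {x..y} (\<lambda>z. \<phi> z / g z)"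
  shows "transport d0 d1 E g \<phi> (Gfun g x0) Q"
proof -
  let ?G = "Gfun g x0"
  have conv: "{a..b} \<subseteq> E" if "a \<in> E" "b \<in> E" for a b
    using Eint_interval that by (simp add: E_def)
  have gr: "continuous_on E (\<lambda>x. 1 / g x)"
    using g_cont g_neg by (intro continuous_intros) force+
  have op: "open E" unfolding E_def by (rule Eint_open)
  have G_int: "set_integrable lborel {a..b} (\<lambda>x. 1 / g x)" if "{a..b} \<subseteq> E" for a b
    by (rule borel_integrable_atLeastAtMost'[OF continuous_on_subset[OF gr that]])
  have G_diff: "?G y - ?G x = integral {x..y} (\<lambda>z. 1 / g z)" if "x \<in> E" "y \<in> E" "x \<le> y" for x y
    unfolding Gfun_def by (rule interval_integral_difference[OF G_int conv x0 that])
  have G_deriv: "(?G has_real_derivative 1 / g x) (at x)" if x: "x \<in> E" for x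
  proof -
    obtain e where e: "e > 0" "cball x e \<subseteq> E" using op x open_contains_cball by blast
    define a where "a = x - e"
    define b where "b = x + e"
    have ab: "{a..b} \<subseteq> E" using e by (simp add: a_def b_def cball_eq_atLeastAtMost)
    have xab: "a < x" "x < b" using e by (auto simp: a_def b_def)
    have "((\<lambda>u. integral {a..u} (\<lambda>z. 1 / g z)) has_real_derivative 1 / g x) (at x within {a..b})"
      using xab by (intro integral_has_real_derivative continuous_on_subset[OF gr ab]) auto
    then have "((\<lambda>u. ?G a + integral {a..u} (\<lambda>z. 1 / g z)) has_real_derivative 1 / g x) (at x within {a..b})"
      by (auto intro!: derivative_eq_intros)
    then have "((\<lambda>u. ?G a + integral {a..u} (\<lambda>z. 1 / g z)) has_real_derivative 1 / g x) (at x)"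
      using xab by (simp add: at_within_Icc_at)
    then show ?thesis
    proof (rule has_field_derivative_transform_within_open[of _ _ _ "{a<..<b}"])
      show "?G a + integral {a..u} (\<lambda>z. 1 / g z) = ?G u" if "u \<in> {a<..<b}" for u
      proof -
        have "a \<in> E" "u \<in> E" using ab that by auto
        then show ?thesis using G_diff[of a u] that by simp
      qed
    qed (use xab in auto)
  qed
  have G_up: "s \<in> ?G ` E" if x: "x \<in> E" and s: "?G x \<le> s" for x s
  proof -
    \<comment> \<open>Divergence at \<open>d0\<close> supplies a point left of \<open>x\<close> with
      value at least \<open>s\<close>; the intermediate value theorem then attains \<open>s\<close>
      in between.\<close>
    have "\<forall>\<^sub>F y in lower_end d0. s \<le> ?G y" using G_d0 by (simp add: filterlim_at_top)
    then have "\<forall>\<^sub>F y in lower_end d0. s \<le> ?G y \<and> (y \<in> E \<and> y \<le> x)"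
      using eventually_lower_end[OF x[unfolded E_def]] unfolding E_def by (rule eventually_conj)
    moreover have "lower_end d0 \<noteq> bot" by (simp add: lower_end_def)
    ultimately obtain y where y: "s \<le> ?G y" "y \<in> E" "y \<le> x" using eventually_happens' by blast
    have "continuous_on {y..x} ?G"
      using conv[OF y(2) x] by (intro continuous_at_imp_continuous_on ballI DERIV_isCont[OF G_deriv]) blast
    then obtain z where "y \<le> z" "z \<le> x" "?G z = s"
      using IVT2'[of ?G x s y] s y by auto
    then show ?thesis using conv[OF y(2) x] by auto
  qed
  show ?thesis
  proof
    show "E = Eint d0 d1" by (simp add: E_def)
    show "(\<lambda>x. \<phi> x / g x) absolutely_integrable_on {a..b}" if "{a..b} \<subseteq> E" for a b
      by (rule set_integrable_lborel_imp_lebesgue[OF Q_int[OF that]])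
  qed (use x0 g_cont g_neg phi Q_diff G_deriv G_up in auto)
qed

theorem theorem7p1:
  fixes d0 d1 :: ereal and g \<phi> :: "real \<Rightarrow> real" and x0 x1 :: real
  defines "E \<equiv> Eint d0 d1"
  defines "G \<equiv> Gfun g x0"
  defines "Q \<equiv> Qfun g \<phi> x1"
  assumes d01: "d0 < d1"
    and x0E: "x0 \<in> E" and x1E: "x1 \<in> E"
    and g_cont: "continuous_on E g"
    and g_neg: "\<forall>x\<in>E. g x < 0"
    and phi_nonneg: "\<forall>x\<in>E. 0 \<le> \<phi> x"
    and phi_meas: "\<phi> \<in> borel_measurable borel"
    and phi_loc_int: "\<forall>a b. {a..b} \<subseteq> E \<longrightarrow> set_integrable lborel {a..b} \<phi>"
    and G_d0: "filterlim G at_top (lower_end d0)"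
  shows "is_generator E (P0 E g G) (A0_graph E d1 g)
       \<and> is_generator E (Ssg E g G Q) (A_graph E d1 g \<phi>)
       \<and> (\<forall>lam::real. lam > 0 \<longrightarrow> (\<forall>v. L1 E v \<longrightarrow>
            (let Ql = (\<lambda>x. lam * G x + Q x);
                 r = (\<lambda>x. LINT y:{y. x < y \<and> ereal y < d1}|lebesgue.
                          1 / \<bar>g x\<bar> * exp (Ql y - Ql x) * v y)
             in L1 E r \<and> A_graph E d1 g \<phi> r (\<lambda>x. lam * r x - v x) \<and>
                (\<forall>u. A_graph E d1 g \<phi> u (\<lambda>x. lam * u x - v x) \<longrightarrow>
                     (AE x in lebesgue. x \<in> E \<longrightarrow> u x = r x)))))"
proof -
  have gr: "continuous_on E (\<lambda>x. 1 / g x)"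
    using g_cont g_neg by (intro continuous_intros) force+
  \<comment> \<open>On compact subintervals \<open>1 / g\<close> is continuous and therefore
    bounded, so local integrability passes from \<phi> to \<open>\<phi> / g\<close>.\<close>
  have phi_g: "set_integrable lborel {a..b} (\<lambda>x. \<phi> x / g x)" if "{a..b} \<subseteq> E" for a b
  proof -
    note c = continuous_on_subset[OF gr that]
    then have "bounded ((\<lambda>x. 1 / g x) ` {a..b})"
      by (intro compact_imp_bounded compact_continuous_image) auto
    then obtain B where B: "\<forall>x\<in>{a..b}. \<bar>1 / g x\<bar> \<le> B" by (auto simp: bounded_iff)
    have "set_integrable lborel {a..b} (\<lambda>x. 1 / g x * \<phi> x)"
      by (rule set_integrable_mult_continuous_bounded[OF _ _ _ c, where B = B]) (use phi_loc_int that B in auto)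
    then show ?thesis by simp
  qed
  interpret T0: transport d0 d1 E g "\<lambda>_. 0" G "\<lambda>_. 0"
    unfolding E_def G_def
    by (rule transport_concrete)
       (use x0E g_cont g_neg G_d0 in \<open>auto simp: E_def G_def set_integrable_def\<close>)
  have Q_diff: "Q y - Q x = integral {x..y} (\<lambda>z. \<phi> z / g z)" if "x \<le> y" "{x..y} \<subseteq> E" for x y
    unfolding Q_def Qfun_def using that
    by (intro interval_integral_difference[OF phi_g T0.E_interval x1E]) auto
  interpret T: transport d0 d1 E g \<phi> G Q
    unfolding E_def G_def
    by (rule transport_concrete)
       (use x0E g_cont g_neg G_d0 phi_nonneg phi_meas phi_g Q_diff in \<open>auto simp: E_def G_def\<close>)
  have "is_generator E (P0 E g G) (A0_graph E d1 g)"
    using T0.S_generator by (simp add: Ssg_zero A_graph_zero)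
  moreover have "is_generator E (Ssg E g G Q) (A_graph E d1 g \<phi>)" by (rule T.S_generator)
  moreover have "L1 E r \<and> A_graph E d1 g \<phi> r (\<lambda>x. lam * r x - v x) \<and>
      (\<forall>u. A_graph E d1 g \<phi> u (\<lambda>x. lam * u x - v x) \<longrightarrow> (AE x in lebesgue. x \<in> E \<longrightarrow> u x = r x))"
    if lam: "lam > 0" and v: "L1 E v"
      and r: "r = (\<lambda>x. LINT y:{y. x < y \<and> ereal y < d1}|lebesgue.
               1 / \<bar>g x\<bar> * exp ((lam * G y + Q y) - (lam * G x + Q x)) * v y)" for lam v r
  proof -
    \<comment> \<open>The integral formula agrees with the resolvent on \<open>E\<close> only, since
      its tail need not lie in \<open>E\<close> for other \<open>x\<close>; invariance under a.e.
      equality on \<open>E\<close> does the rest.\<close>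
    have eq: "r x = T.R lam v x" if "x \<in> E" for x
      unfolding r using T.R_eq_integral[OF that, of lam v] by (simp add: T.W_def)
    have ae: "AE x in lebesgue. x \<in> E \<longrightarrow> T.R lam v x = r x" by (simp add: eq)
    have "L1 E r" by (rule L1_cong_AE[OF T.R_L1(1)[OF v lam] ae])
    moreover have "A_graph E d1 g \<phi> r (\<lambda>x. lam * r x - v x)"
      by (rule T.A_graph_cong[OF T.R_graph[OF v lam] ae]) (simp add: eq)
    moreover have "AE x in lebesgue. x \<in> E \<longrightarrow> u x = r x"
      if "A_graph E d1 g \<phi> u (\<lambda>x. lam * u x - v x)" for u
      using T.R_unique[OF v lam that] by eventually_elim (simp add: eq)
    ultimately show ?thesis by blast
  qed
  ultimately show ?thesis unfolding Let_def by blast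
qed

end
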